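(* Let $f : \mathbb{D} \to \mathbb{D}$ be holomorphic and let $I \subset \mathbb{T}$ be a (relatively) open arc. If $$\int_{I} \log(1-\lvert f\rvert)\, dm > -\infty,$$ then $C(f) \cap I$ is a countable union of Beurling-Carleson sets. Conversely, if $E \subset \mathbb{T}$ is a countable union of Beurling-Carleson sets, then there exists an analytic function $f : \mathbb{D} \to \mathbb{D}$ satisfying $$\int_{\mathbb{T}} \log(1-\lvert f\rvert)\, dm > -\infty$$ and $C(f) = E$.
   Context: $\mathbb{D}$ is the open unit disc in the complex plane, $\mathbb{T}$ is the unit circle, and $m$ is the normalized Lebesgue measure on $\mathbb{T}$ (so $m(\mathbb{T})=1$); write $\lvert A\rvert = m(A)$ for $A \subset \mathbb{T}$. The arc $I$ is allowed to be all of $\mathbb{T}$. On $\mathbb{T}$, $f$ denotes its non-tangential boundary values, which exist $m$-almost everywhere; $\log 0 = -\infty$. A holomorphic $f : \mathbb{D} \to \mathbb{D}$ is said to have a (finite) angular derivative in the sense of Carathéodory at $\lambda \in \mathbb{T}$ if (i) $f$ has a non-tangential limit at $\lambda$, and $f(\lambda) = \lim_{r \to 1^-} f(r\lambda)$ satisfies $\lvert f(\lambda)\rvert = 1$; and (ii) the derivative $f'$ has a finite non-tangential limit at $\lambda$. The set of points $\lambda \in \mathbb{T}$ at which $f$ has a finite Carathéodory angular derivative is denoted $C(f)$. A Beurling-Carleson set (of finite entropy) is a closed set $E \subset \mathbb{T}$ with $\lvert E\rvert = 0$ such that $\sum_{J} \lvert J\rvert \log(1/\lvert J\rvert) < \infty$,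 where the sum is over the maximal complementary arcs $J$ of $E$ (the connected components of $\mathbb{T}\setminus E$). *)

theory Defs
  imports "HOL-Complex_Analysis.Complex_Analysis" "HOL-Probability.Probability_Measure"
begin

abbreviation unit_disc :: "complex set" where
  "unit_disc \<equiv> ball 0 1"

abbreviation unit_circle :: "complex set" where
  "unit_circle \<equiv> sphere 0 1"

definition circle_measure :: "complex measure" where
  "circle_measure =
     completion (distr (uniform_measure lborel {0..<2*pi}) (restrict_space borel unit_circle) cis)"

definition holo_self_map :: "(complex \<Rightarrow> complex) \<Rightarrow> bool" where
  "holo_self_map f \<longleftrightarrow> f holomorphic_on unit_disc \<and> f ` unit_disc \<subseteq> unit_disc"

text \<open>The whole circle, and the circle minus one point, are open arcs in this sense.\<close>

definition open_arc :: "complex set \<Rightarrow> bool" where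
  "open_arc I \<longleftrightarrow> openin (top_of_set unit_circle) I \<and> connected I \<and> I \<noteq> {}"

text \<open>The Stolz region of aperture \<open>\<alpha>\<close> at \<open>\<zeta>\<close>; it is empty unless \<open>\<alpha> > 1\<close>.\<close>

definition stolz :: "real \<Rightarrow> complex \<Rightarrow> complex set" where
  "stolz \<alpha> \<zeta> = {z \<in> unit_disc. dist z \<zeta> < \<alpha> * (1 - norm z)}"

definition has_nt_limit :: "(complex \<Rightarrow> complex) \<Rightarrow> complex \<Rightarrow> complex \<Rightarrow> bool" where
  "has_nt_limit f w \<zeta> \<longleftrightarrow> (\<forall>\<alpha>>1. (f \<longlongrightarrow> w) (at \<zeta> within stolz \<alpha> \<zeta>))"

text \<open>Where no non-tangential limit exists, the following value is unspecified. For a bounded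
  holomorphic \<open>f\<close> this happens only on a null set.\<close>

definition nt_value :: "(complex \<Rightarrow> complex) \<Rightarrow> complex \<Rightarrow> complex" where
  "nt_value f \<zeta> = (THE w. has_nt_limit f w \<zeta>)"

definition caratheodory_set :: "(complex \<Rightarrow> complex) \<Rightarrow> complex set" where
  "caratheodory_set f = {\<zeta> \<in> unit_circle.
     (\<exists>w. has_nt_limit f w \<zeta> \<and> norm w = 1) \<and> (\<exists>d. has_nt_limit (deriv f) d \<zeta>)}"

definition beurling_carleson :: "complex set \<Rightarrow> bool" where
  "beurling_carleson E \<longleftrightarrow>
     closed E \<and> E \<subseteq> unit_circle \<and> measure circle_measure E = 0 \<and>
     (\<lambda>J. measure circle_measure J * ln (1 / measure circle_measure J))
       summable_on components (unit_circle - E)"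

definition countable_union_BC :: "complex set \<Rightarrow> bool" where
  "countable_union_BC X \<longleftrightarrow>
     (\<exists>\<E>. countable \<E> \<and> (\<forall>E\<in>\<E>. beurling_carleson E) \<and> X = \<Union>\<E>)"

definition elog :: "real \<Rightarrow> ereal" where
  "elog x = (if x = 0 then -\<infinity> else ereal (ln x))"

text \<open>The Lebesgue integral of an extended real function as positive part minus negative part
  (\<open>e2ennreal\<close> truncates negative values to \<open>0\<close>). It is used below only for a function that is
  nonpositive almost everywhere, so \<open>\<infinity> - \<infinity>\<close> does not occur.\<close>

definition ext_integral :: "'a measure \<Rightarrow> 'a set \<Rightarrow> ('a \<Rightarrow> ereal) \<Rightarrow> ereal" where
  "ext_integral M A \<phi> =
     enn2ereal (\<integral>\<^sup>+x\<in>A. e2ennreal (\<phi> x) \<partial>M) - enn2ereal (\<integral>\<^sup>+x\<in>A. e2ennreal (- \<phi> x) \<partial>M)"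

definition log_integral :: "(complex \<Rightarrow> complex) \<Rightarrow> complex set \<Rightarrow> ereal" where
  "log_integral f I = ext_integral circle_measure I (\<lambda>\<zeta>. elog (1 - norm (nt_value f \<zeta>)))"

lemma cis_measurable_circle:
  "cis \<in> measurable (uniform_measure lborel {0..<2*pi}) (restrict_space borel unit_circle)"
proof -
  have "cis \<in> borel_measurable borel"
    by (intro borel_measurable_continuous_onI continuous_on_cis continuous_on_id)
  then show ?thesis
    by (intro measurable_restrict_space2) (auto simp: measurable_def space_uniform_measure)
qed

lemma space_circle_measure: "space circle_measure = unit_circle"
  by (simp add: circle_measure_def space_restrict_space)

lemma prob_space_circle_measure: "prob_space circle_measure"
  unfolding circle_measure_def
  by (intro prob_space.prob_space_completion prob_space.prob_space_distr[OF _ cis_measurable_circle]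
      prob_space_uniform_measure) auto

end

theory Submission
  imports Defs "HOL-Real_Asymp.Real_Asymp"
begin

text \<open>By Julia-Caratheodory, \<open>\<zeta> \<in> C(f)\<close> iff \<open>1 - |f(r\<zeta>)| \<le> M (1 - r)\<close> for some \<open>M\<close> and all \<open>r\<close>. For fixed
  \<open>M\<close> this is a closed condition. Since \<open>|f|\<close> is subharmonic, the mean of \<open>1 - |f|\<close> over an arc \<open>J\<close>
  adjacent to such a point is \<open>O(M |J|)\<close>, so by Jensen \<open>\<integral>\<^sub>J log (1 / (1 - |f|)) \<ge> |J| log (1 / |J|) - O(|J|)\<close>.
  Summing over disjoint arcs bounds the entropy.

  Conversely, write \<open>E\<close> as an increasing union of sets \<open>F n\<close> with \<open>log (1 / dist(-, F n))\<close> integrable and put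
  \<open>f = exp (- g)\<close>, where \<open>Re g\<close> is the Poisson integral of a measure \<open>\<mu>\<close>. Then \<open>\<zeta> \<in> C(f)\<close> iff
  \<open>\<integral> |\<xi> - \<zeta>|\<^sup>-\<^sup>2 d\<mu>(\<xi>)\<close> is finite. The absolutely continuous part of \<open>\<mu>\<close> has a density at most \<open>A n dist(-, F n)\<^sup>2\<close>
  for all \<open>n\<close>; letting the \<open>A n\<close> grow fast keeps its logarithm integrable. Off \<open>E\<close> divergence is forced
  by atoms off \<open>E\<close>: for each \<open>n\<close> fine nets of small atoms in the dyadic shells around \<open>F n\<close> contribute at
  least \<open>1\<close> off \<open>F n\<close> but only \<open>O(2\<^sup>-\<^sup>n)\<close> on \<open>F n\<close>.\<close>

section \<open>The Julia-Caratheodory theorem\<close>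

text \<open>The logarithmic integral involves non-tangential boundary values, so Fatou's theorem is
  needed before it can be used in either direction; only then may \<open>nt_value\<close> be
  replaced by limits along the fixed radii \<open>approach n\<close>. A Beurling-Carleson set must
  also be null. Nullity and entropy come from one estimate for a single arc: with n equal arcs, each
  arc that meets the set costs about log n / n, which forces measure zero; with complementary arcs
  it gives the entropy sum. In the converse two demands conflict: the density must vanish
  quadratically on \<open>E\<close>, yet its logarithm must stay integrable. Taking the density as
  the product of all min(1, A n dist^2) turns the logarithm into a sum whose terms become as small
  as desired when A n increases. The atoms do no harm to the logarithmic integral, because extra
  mass only increases Re g. They must avoid \<open>E\<close>, where an atom would make the potential
  infinite; this is possible because \<open>E\<close> is null. Their mass is the square of the mesh,
  so that an atom within one mesh width contributes at least 1.\<close>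

definition approach :: "nat \<Rightarrow> real" where
  "approach n = 1 - 1 / (real n + 2)"

text \<open>The shift by 2 keeps \<open>approach 0\<close> positive, so that every dilation by
  \<open>approach n\<close> is holomorphic on the disc of radius
  \<open>1 / approach n > 1\<close>.\<close>

lemma approach: "0 < approach n" "approach n < 1"
  by (auto simp: approach_def field_simps)

lemma approach_lim: "approach \<longlonglongrightarrow> 1"
  unfolding approach_def by real_asymp

lemma approach_at_left: "filterlim approach (at_left 1) sequentially"
  using approach_lim approach(2) by (auto simp: filterlim_at intro!: always_eventually dest: less_imp_neq)

section \<open>Radii, Stolz regions and non-tangential limits\<close>

lemma radial_mem_stolz:
  assumes "norm \<zeta> = 1" "0 \<le> r" "r < 1" "\<alpha> > 1"
  shows "of_real r * \<zeta> \<in> stolz \<alpha> \<zeta>"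
proof -
  have "dist (of_real r * \<zeta>) \<zeta> = norm ((of_real r - 1) * \<zeta>)"
    by (simp add: dist_norm algebra_simps)
  also have "\<dots> = 1 - r"
    using assms by (simp add: norm_mult) (metis abs_minus_commute abs_of_pos diff_gt_0_iff_gt norm_of_real of_real_1 of_real_diff)
  finally have "dist (of_real r * \<zeta>) \<zeta> = 1 - r" .
  then show ?thesis using assms by (simp add: stolz_def norm_mult)
qed

lemma filterlim_radial_stolz:
  assumes "norm \<zeta> = 1" "\<alpha> > 1"
  shows "filterlim (\<lambda>r. of_real r * \<zeta>) (at \<zeta> within stolz \<alpha> \<zeta>) (at_left (1::real))"
proof -
  have ev: "\<forall>\<^sub>F r in at_left (1::real). 0 < r \<and> r < 1"
    by (rule eventually_at_leftI[of 0]) auto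
  have "((\<lambda>r. of_real r * \<zeta>) \<longlongrightarrow> of_real 1 * \<zeta>) (at_left (1::real))"
    by (intro tendsto_intros)
  moreover have "\<forall>\<^sub>F r in at_left (1::real). of_real r * \<zeta> \<in> stolz \<alpha> \<zeta> \<and> of_real r * \<zeta> \<noteq> \<zeta>"
    using ev by eventually_elim (use assms in \<open>auto intro!: radial_mem_stolz\<close>)
  ultimately show ?thesis by (simp add: filterlim_at)
qed

lemma at_stolz_neq_bot:
  assumes "norm \<zeta> = 1" "\<alpha> > 1"
  shows "at \<zeta> within stolz \<alpha> \<zeta> \<noteq> bot"
proof
  assume "at \<zeta> within stolz \<alpha> \<zeta> = bot"
  then have "filtermap (\<lambda>r. of_real r * \<zeta>) (at_left (1::real)) = bot"
    using filterlim_radial_stolz[OF assms] by (simp add: filterlim_def bot.extremum_unique)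
  then show False by (simp add: filtermap_bot_iff)
qed

lemma nt_value_eq:
  assumes "has_nt_limit f w \<zeta>" "norm \<zeta> = 1"
  shows "nt_value f \<zeta> = w"
  unfolding nt_value_def
proof (rule the_equality[where P = "\<lambda>w. has_nt_limit f w \<zeta>"])
  show "has_nt_limit f w \<zeta>" by fact
  fix v assume "has_nt_limit f v \<zeta>"
  then have "(f \<longlongrightarrow> v) (at \<zeta> within stolz 2 \<zeta>)" "(f \<longlongrightarrow> w) (at \<zeta> within stolz 2 \<zeta>)"
    using assms by (simp_all add: has_nt_limit_def)
  then show "v = w" using tendsto_unique[OF at_stolz_neq_bot[of \<zeta> 2]] assms by simp
qed

lemma has_nt_limit_radial:
  assumes "has_nt_limit f w \<zeta>" "norm \<zeta> = 1"
  shows "((\<lambda>r. f (of_real r * \<zeta>)) \<longlongrightarrow> w) (at_left (1::real))"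
proof -
  have "(f \<longlongrightarrow> w) (at \<zeta> within stolz 2 \<zeta>)" using assms by (auto simp: has_nt_limit_def)
  from filterlim_compose[OF this filterlim_radial_stolz] show ?thesis using assms by auto
qed

text \<open>Schwarz's lemma after two changes of variable: \<open>M\<close> carries 0 to
  \<open>w\<close>, and a Cayley transform carries the right half-plane to the disc and
  \<open>q w\<close> to 0. The bound on \<open>F\<close> turns into the claim through |a + cnj b|^2
  - |a - b|^2 = 4 Re a Re b and its counterpart for the disc. Without denominators the bound
  survives limits.\<close>

lemma pick_half_plane_strict:
  assumes hol: "q holomorphic_on unit_disc" and pos: "\<And>z. z \<in> unit_disc \<Longrightarrow> Re (q z) > 0"
    and z: "z \<in> unit_disc" and w: "w \<in> unit_disc"
  shows "(norm (q z + cnj (q w)))\<^sup>2 * ((1 - (norm z)\<^sup>2) * (1 - (norm w)\<^sup>2))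
      \<le> 4 * Re (q z) * Re (q w) * (norm (1 - cnj w * z))\<^sup>2"
proof -
  define M where "M u = (u + w) / (1 + cnj w * u)" for u
  define F where "F u = (q (M u) - q w) / (q (M u) + cnj (q w))" for u
  have M: "M u \<in> unit_disc" "1 + cnj w * u \<noteq> 0" if "u \<in> unit_disc" for u
  proof -
    have "M u = Moebius_function 0 (-w) u" by (simp add: M_def Moebius_function_simple)
    then show "M u \<in> unit_disc" using Moebius_function_norm_lt_1[of "-w" u 0] w that by auto
    have "norm (cnj w * u) < 1" using w that
      by (metis complex_mod_cnj mem_ball_0 mult.right_neutral norm_mult norm_mult_less)
    then show "1 + cnj w * u \<noteq> 0"
      by (metis add_eq_0_iff2 norm_minus_cancel norm_one order_less_irrefl)
  qed
  have ne: "q v + cnj (q w) \<noteq> 0" if "v \<in> unit_disc" for v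
  proof
    assume "q v + cnj (q w) = 0"
    then have "Re (q v + cnj (q w)) = 0" by simp
    then show False using pos[OF that] pos[OF w] by simp
  qed
  have key: "(norm (a + cnj b))\<^sup>2 - (norm (a - b))\<^sup>2 = 4 * Re a * Re b" for a b :: complex
    unfolding cmod_power2 by (simp add: power2_eq_square algebra_simps)
  have holM: "M holomorphic_on unit_disc" unfolding M_def
    by (intro holomorphic_intros) (use M(2) in auto)
  have "(q \<circ> M) holomorphic_on unit_disc"
    using holM hol by (rule holomorphic_on_compose_gen) (use M in auto)
  then have holF: "F holomorphic_on unit_disc" unfolding F_def
    by (intro holomorphic_intros) (use ne M in \<open>auto simp: o_def\<close>)
  have F0: "F 0 = 0" by (simp add: F_def M_def)
  have F1: "norm (F u) < 1" if "norm u < 1" for u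
  proof -
    have "4 * Re (q (M u)) * Re (q w) > 0" using pos[OF M(1)] pos[OF w] that by simp
    then have "(norm (q (M u) - q w))\<^sup>2 < (norm (q (M u) + cnj (q w)))\<^sup>2"
      using key[of "q (M u)" "q w"] by linarith
    then have "norm (q (M u) - q w) < norm (q (M u) + cnj (q w))"
      by (rule power2_less_imp_less) simp
    then show ?thesis by (simp add: F_def norm_divide divide_simps)
  qed
  define u where "u = (z - w) / (1 - cnj w * z)"
  have nz: "1 - cnj w * z \<noteq> 0"
  proof -
    have "norm (cnj w * z) < 1" using w z
      by (metis complex_mod_cnj mem_ball_0 mult.right_neutral norm_mult norm_mult_less)
    then show ?thesis by auto
  qed
  have "u = Moebius_function 0 w z" by (simp add: u_def Moebius_function_simple)
  then have u: "norm u < 1" using Moebius_function_norm_lt_1[of w z 0] w z by auto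
  have Mu: "M u = z"
  proof -
    have "Moebius_function 0 (-w) (Moebius_function 0 w z) = z"
      by (rule Moebius_function_compose) (use w z in auto)
    then show ?thesis by (simp add: M_def u_def Moebius_function_simple)
  qed
  have "norm (F u) \<le> norm u" using Schwarz_Lemma(1)[OF holF F0 F1 u] by simp
  then have "(norm (q z - q w))\<^sup>2 * (norm (1 - cnj w * z))\<^sup>2
      \<le> (norm (z - w))\<^sup>2 * (norm (q z + cnj (q w)))\<^sup>2"
    using ne[OF z] nz unfolding F_def Mu unfolding u_def norm_divide
    by (simp add: divide_simps flip: power_mult_distrib)
  moreover have "(norm (1 - cnj w * z))\<^sup>2 - (norm (z - w))\<^sup>2 = (1 - (norm z)\<^sup>2) * (1 - (norm w)\<^sup>2)"
    unfolding cmod_power2 by (simp add: power2_eq_square algebra_simps)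
  ultimately show ?thesis using key[of "q z" "q w"]
    by (smt (verit) left_diff_distrib' mult.commute)
qed

text \<open>In the existence proof for angular derivatives, a half-plane map is diminished by the
  largest admissible multiple of the Cayley kernel, and the real part of the difference is only
  known to be nonnegative. Adding a constant \<open>e > 0\<close> and letting it tend to 0 covers
  this case.\<close>

lemma pick_half_plane:
  assumes hol: "q holomorphic_on unit_disc" and nn: "\<And>z. z \<in> unit_disc \<Longrightarrow> Re (q z) \<ge> 0"
    and z: "z \<in> unit_disc" and w: "w \<in> unit_disc"
  shows "(norm (q z + cnj (q w)))\<^sup>2 * ((1 - (norm z)\<^sup>2) * (1 - (norm w)\<^sup>2))
      \<le> 4 * Re (q z) * Re (q w) * (norm (1 - cnj w * z))\<^sup>2"
proof (rule tendsto_le[of "at_right (0::real)"])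
  show "\<forall>\<^sub>F e in at_right (0::real).
     (norm (q z + of_real e + cnj (q w + of_real e)))\<^sup>2 * ((1 - (norm z)\<^sup>2) * (1 - (norm w)\<^sup>2))
      \<le> 4 * Re (q z + of_real e) * Re (q w + of_real e) * (norm (1 - cnj w * z))\<^sup>2"
    using eventually_at_right_less[of "0::real"]
  proof eventually_elim
    case (elim e)
    show ?case
      by (rule pick_half_plane_strict[where q = "\<lambda>z. q z + of_real e"])
        (use hol nn z w elim in \<open>auto intro!: holomorphic_intros add_nonneg_pos\<close>)
  qed
  have "((\<lambda>e. 4 * Re (q z + of_real e) * Re (q w + of_real e) * (norm (1 - cnj w * z))\<^sup>2) \<longlongrightarrow>
     4 * Re (q z + of_real 0) * Re (q w + of_real 0) * (norm (1 - cnj w * z))\<^sup>2) (at_right 0)"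
    by (intro tendsto_intros)
  then show "((\<lambda>e. 4 * Re (q z + of_real e) * Re (q w + of_real e) * (norm (1 - cnj w * z))\<^sup>2) \<longlongrightarrow>
     4 * Re (q z) * Re (q w) * (norm (1 - cnj w * z))\<^sup>2) (at_right 0)" by simp
  have "((\<lambda>e. (norm (q z + of_real e + cnj (q w + of_real e)))\<^sup>2 * ((1 - (norm z)\<^sup>2) * (1 - (norm w)\<^sup>2))) \<longlongrightarrow>
     (norm (q z + of_real 0 + cnj (q w + of_real 0)))\<^sup>2 * ((1 - (norm z)\<^sup>2) * (1 - (norm w)\<^sup>2))) (at_right 0)"
    by (intro tendsto_intros)
  then show "((\<lambda>e. (norm (q z + of_real e + cnj (q w + of_real e)))\<^sup>2 * ((1 - (norm z)\<^sup>2) * (1 - (norm w)\<^sup>2))) \<longlongrightarrow>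
     (norm (q z + cnj (q w)))\<^sup>2 * ((1 - (norm z)\<^sup>2) * (1 - (norm w)\<^sup>2))) (at_right 0)" by simp
qed simp

lemma Re_cayley:
  assumes "norm \<zeta> = 1" "z \<noteq> \<zeta>"
  shows "Re ((\<zeta> + z) / (\<zeta> - z)) = (1 - (norm z)\<^sup>2) / (norm (\<zeta> - z))\<^sup>2"
proof -
  have "(Re \<zeta>)\<^sup>2 + (Im \<zeta>)\<^sup>2 = 1" using assms by (simp flip: cmod_power2)
  then show ?thesis unfolding Re_divide cmod_power2
    by (simp add: algebra_simps power2_eq_square) 
qed

text \<open>Composition with the Cayley transform (1 + f) / (1 - f) reduces this to the half-plane,
  so that one Moebius argument serves both. In product form the factor
  \<open>1 - (norm w)\<^sup>2\<close> can be cancelled before \<open>w\<close> goes to the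
  boundary.\<close>

lemma schwarz_pick:
  assumes f: "holo_self_map f" and z: "z \<in> unit_disc" and w: "w \<in> unit_disc"
  shows "(1 - (norm z)\<^sup>2) * (1 - (norm w)\<^sup>2) * (norm (1 - cnj (f w) * f z))\<^sup>2
      \<le> (1 - (norm (f z))\<^sup>2) * (1 - (norm (f w))\<^sup>2) * (norm (1 - cnj w * z))\<^sup>2"
proof -
  have lt: "norm (f v) < 1" if "v \<in> unit_disc" for v
    using f that by (metis holo_self_map_def image_subset_iff mem_ball_0)
  have hol: "f holomorphic_on unit_disc" using f by (auto simp: holo_self_map_def)
  have ne: "f v \<noteq> 1" if "v \<in> unit_disc" for v using lt[OF that] by auto
  define q where "q v = (1 + f v) / (1 - f v)" for v
  have Re: "Re (q v) = (1 - (norm (f v))\<^sup>2) / (norm (1 - f v))\<^sup>2" if "v \<in> unit_disc" for v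
    unfolding q_def using Re_cayley[of 1 "f v"] ne[OF that] by simp
  have "Re (q v) \<ge> 0" if "v \<in> unit_disc" for v
    unfolding Re[OF that] using lt[OF that] by (simp add: power_le_one)
  moreover have "q holomorphic_on unit_disc" unfolding q_def
    using ne by (intro holomorphic_intros hol) force
  ultimately have "(norm (q z + cnj (q w)))\<^sup>2 * ((1 - (norm z)\<^sup>2) * (1 - (norm w)\<^sup>2))
      \<le> 4 * Re (q z) * Re (q w) * (norm (1 - cnj w * z))\<^sup>2"
    using pick_half_plane z w by blast
  moreover have "q z + cnj (q w) = 2 * (1 - cnj (f w) * f z) / ((1 - f z) * cnj (1 - f w))"
  proof -
    have "1 - f z \<noteq> 0" "1 - cnj (f w) \<noteq> 0" using ne[OF z] ne[OF w] by (auto simp: complex_eq_iff)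
    then show ?thesis unfolding q_def by (simp add: field_simps)
  qed
  then have "(norm (q z + cnj (q w)))\<^sup>2
      = 4 * (norm (1 - cnj (f w) * f z))\<^sup>2 / ((norm (1 - f z))\<^sup>2 * (norm (1 - f w))\<^sup>2)"
    by (simp only: norm_divide norm_mult complex_mod_cnj power_divide power_mult_distrib) simp
  moreover have "norm (1 - f z) > 0" "norm (1 - f w) > 0" using ne[OF z] ne[OF w] by auto
  ultimately show ?thesis unfolding Re[OF z] Re[OF w]
    by (simp add: divide_simps mult_ac) (simp add: algebra_simps)
qed

lemma holo_self_map_norm_less:
  assumes "holo_self_map f" "norm z < 1"
  shows "norm (f z) < 1"
  using assms by (metis holo_self_map_def image_subset_iff mem_ball_0)

text \<open>In the inequality of Schwarz and Pick let \<open>w\<close> move to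
  \<open>\<zeta>\<close> along the radius. The hypothesis compares 1 - |f w| with 1 - |w|, so the
  vanishing factor cancels and a limit is left; compactness supplies a limit point
  \<open>\<omega>\<close> of the values along a subsequence. The 2 comes from 1 - b^2 <= 2 (1 -
  b).\<close>

lemma julia_lemma:
  assumes f: "holo_self_map f" and \<zeta>: "norm \<zeta> = 1"
    and bound: "\<And>r. 0 \<le> r \<Longrightarrow> r < 1 \<Longrightarrow> 1 - norm (f (of_real r * \<zeta>)) \<le> M * (1 - r)"
  obtains \<omega> where "norm \<omega> = 1"
    "\<And>z. z \<in> unit_disc \<Longrightarrow> (1 - (norm z)\<^sup>2) * (norm (\<omega> - f z))\<^sup>2
        \<le> 2 * M * (1 - (norm (f z))\<^sup>2) * (norm (\<zeta> - z))\<^sup>2"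
proof -
  have r: "0 \<le> approach n" "approach n < 1" for n using approach[of n] by auto
  define p where "p n = of_real (approach n) * \<zeta>" for n
  have np: "norm (p n) = approach n" for n using r[of n] \<zeta> by (simp add: p_def norm_mult)
  have lt: "norm (f (p n)) < 1" for n using holo_self_map_norm_less[OF f] np r by simp
  have "seq_compact (cball 0 1 :: complex set)" by (simp add: compact_imp_seq_compact)
  then obtain \<omega> s where s: "strict_mono s" and lim: "(\<lambda>n. f (p (s n))) \<longlonglongrightarrow> \<omega>"
    using lt by (elim seq_compactE[where f = "\<lambda>n. f (p n)"]) (auto simp: o_def less_imp_le)
  have rs: "(\<lambda>n. approach (s n)) \<longlonglongrightarrow> 1" using LIMSEQ_subseq_LIMSEQ[OF approach_lim s] by (simp add: o_def)
  have ps: "(\<lambda>n. p (s n)) \<longlonglongrightarrow> \<zeta>"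
    using tendsto_mult[OF tendsto_of_real[OF rs] tendsto_const[of \<zeta>]] by (simp add: p_def)
  have normw: "norm \<omega> = 1"
  proof (rule antisym)
    show "norm \<omega> \<le> 1" using tendsto_norm[OF lim] by (rule LIMSEQ_le_const2) (use lt less_imp_le in blast)
    have "(\<lambda>n. 1 - M * (1 - approach (s n))) \<longlonglongrightarrow> 1 - M * (1 - 1)" by (intro tendsto_intros rs)
    then show "1 \<le> norm \<omega>"
      using LIMSEQ_le[OF _ tendsto_norm[OF lim]] bound[OF r] by (force simp: p_def algebra_simps)
  qed
  show thesis
  proof (rule that[OF normw])
    fix z :: complex assume z: "z \<in> unit_disc"
    have ineq: "(1 - (norm z)\<^sup>2) * (norm (1 - cnj (f (p (s n))) * f z))\<^sup>2
      \<le> 2 * M * ((1 - (norm (f z))\<^sup>2) * (norm (1 - cnj (p (s n)) * z))\<^sup>2)" for n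
    proof -
      define \<rho> where "\<rho> = approach (s n)"
      have \<rho>: "0 \<le> \<rho>" "\<rho> < 1" using r by (auto simp: \<rho>_def)
      let ?b = "norm (f (p (s n)))"
      let ?Q = "(1 - (norm (f z))\<^sup>2) * (norm (1 - cnj (p (s n)) * z))\<^sup>2"
      have Q: "?Q \<ge> 0" using holo_self_map_norm_less[OF f, of z] z by (simp add: power_le_one)
      have "(1 - (norm z)\<^sup>2) * (1 - \<rho>\<^sup>2) * (norm (1 - cnj (f (p (s n))) * f z))\<^sup>2 \<le> (1 - ?b\<^sup>2) * ?Q"
        using schwarz_pick[OF f z, of "p (s n)"] np r by (simp add: \<rho>_def mult_ac)
      also have "\<dots> \<le> (2 * M * (1 - \<rho>\<^sup>2)) * ?Q"
      proof (rule mult_right_mono[OF _ Q])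
        have "1 - ?b\<^sup>2 = (1 - ?b) * (1 + ?b)" by (simp add: power2_eq_square algebra_simps)
        also have "\<dots> \<le> (1 - ?b) * 2" using lt[of "s n"] by (intro mult_left_mono) auto
        also have "\<dots> \<le> (M * (1 - \<rho>)) * 2" using bound[OF \<rho>] by (simp add: p_def \<rho>_def)
        also have "\<dots> \<le> 2 * M * (1 - \<rho>\<^sup>2)"
        proof -
          have "M * (1 - \<rho>) \<ge> 0" using bound[OF \<rho>] lt[of "s n"] by (simp add: p_def \<rho>_def)
          then have "M * (1 - \<rho>) * \<rho> \<ge> 0" using \<rho> by simp
          then show ?thesis by (simp add: power2_eq_square algebra_simps)
        qed
        finally show "1 - ?b\<^sup>2 \<le> 2 * M * (1 - \<rho>\<^sup>2)" .
      qed
      finally have "(1 - \<rho>\<^sup>2) * ((1 - (norm z)\<^sup>2) * (norm (1 - cnj (f (p (s n))) * f z))\<^sup>2)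
           \<le> (1 - \<rho>\<^sup>2) * (2 * M * ?Q)"
        by (simp only: mult_ac)
      moreover have "1 - \<rho>\<^sup>2 > 0" using \<rho> by (simp add: power_less_one_iff abs_square_less_1)
      ultimately show ?thesis by simp
    qed
    have "(1 - (norm z)\<^sup>2) * (norm (1 - cnj \<omega> * f z))\<^sup>2
      \<le> 2 * M * ((1 - (norm (f z))\<^sup>2) * (norm (1 - cnj \<zeta> * z))\<^sup>2)"
    proof (rule LIMSEQ_le)
      show "(\<lambda>n. (1 - (norm z)\<^sup>2) * (norm (1 - cnj (f (p (s n))) * f z))\<^sup>2)
          \<longlonglongrightarrow> (1 - (norm z)\<^sup>2) * (norm (1 - cnj \<omega> * f z))\<^sup>2"
        by (intro tendsto_intros lim)
      show "(\<lambda>n. 2 * M * ((1 - (norm (f z))\<^sup>2) * (norm (1 - cnj (p (s n)) * z))\<^sup>2))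
          \<longlonglongrightarrow> 2 * M * ((1 - (norm (f z))\<^sup>2) * (norm (1 - cnj \<zeta> * z))\<^sup>2)"
        by (intro tendsto_intros ps)
    qed (use ineq in blast)
    moreover have nab: "norm (1 - cnj a * b) = norm (a - b)" if "norm a = 1" for a b :: complex
    proof -
      have "a * cnj a = 1" using that by (simp add: complex_norm_square[symmetric])
      moreover have "a * (1 - cnj a * b) = a - (a * cnj a) * b" by (simp only: right_diff_distrib mult.assoc mult_1_right)
      ultimately have "a - b = a * (1 - cnj a * b)" by simp
      then show ?thesis using that by (simp add: norm_mult)
    qed
    ultimately show "(1 - (norm z)\<^sup>2) * (norm (\<omega> - f z))\<^sup>2
        \<le> 2 * M * (1 - (norm (f z))\<^sup>2) * (norm (\<zeta> - z))\<^sup>2"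
      by (simp only: nab[OF normw] nab[OF \<zeta>] mult.assoc)
  qed
qed


text \<open>Pick's inequality at a point \<open>w\<close> where \<open>Re q\<close> is small relative to the Poisson kernel controls \<open>q\<close>
  in the whole Stolz region.\<close>

lemma nt_limit_times_diff_zero:
  assumes hol: "q holomorphic_on unit_disc" and nn: "\<And>z. z \<in> unit_disc \<Longrightarrow> Re (q z) \<ge> 0"
    and \<zeta>: "norm \<zeta> = 1"
    and small: "\<And>e. e > 0 \<Longrightarrow> \<exists>w\<in>unit_disc. Re (q w) \<le> e * ((1 - (norm w)\<^sup>2) / (norm (\<zeta> - w))\<^sup>2)"
  shows "has_nt_limit (\<lambda>z. (\<zeta> - z) * q z) 0 \<zeta>"
  unfolding has_nt_limit_def
proof (intro allI impI)
  fix \<alpha> :: real assume \<alpha>: "\<alpha> > 1"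
  show "((\<lambda>z. (\<zeta> - z) * q z) \<longlongrightarrow> 0) (at \<zeta> within stolz \<alpha> \<zeta>)"
  proof (rule tendstoI)
    fix e :: real assume e: "e > 0"
    \<comment> \<open>Half of \<open>e\<close> is spent on \<open>q z + cnj (q w)\<close>, whose
      norm ends up below \<open>8 * d\<close> divided by \<open>1 - norm z\<close>; the Stolz
      condition costs a factor \<open>\<alpha>\<close>. The other half absorbs the constant
      \<open>q w\<close>.\<close>
    define d where "d = e / (16 * \<alpha>)"
    have d: "d > 0" using e \<alpha> by (simp add: d_def)
    obtain w where w: "norm w < 1" and Rew: "Re (q w) \<le> d * ((1 - (norm w)\<^sup>2) / (norm (\<zeta> - w))\<^sup>2)"
      using small[OF d] by auto
    have nz: "norm (\<zeta> - w) > 0" using w \<zeta> by auto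
    have zw: "norm (1 - cnj w * \<zeta>) = norm (\<zeta> - w)"
    proof -
      have "\<zeta> * cnj \<zeta> = 1" using \<zeta> by (simp add: complex_norm_square[symmetric])
      then have "1 - cnj w * \<zeta> = \<zeta> * cnj (\<zeta> - w)" by (simp add: algebra_simps)
      then show ?thesis using \<zeta> by (simp only: norm_mult complex_mod_cnj)
    qed
    have "((\<lambda>z. (norm (1 - cnj w * z))\<^sup>2) \<longlongrightarrow> (norm (1 - cnj w * \<zeta>))\<^sup>2) (at \<zeta> within stolz \<alpha> \<zeta>)"
      by (intro tendsto_intros)
    then have ev1: "\<forall>\<^sub>F z in at \<zeta> within stolz \<alpha> \<zeta>. (norm (1 - cnj w * z))\<^sup>2 < 2 * (norm (\<zeta> - w))\<^sup>2"
      by (rule order_tendstoD) (use nz zw in auto)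
    have "((\<lambda>z. norm (\<zeta> - z) * norm (q w)) \<longlongrightarrow> norm (\<zeta> - \<zeta>) * norm (q w)) (at \<zeta> within stolz \<alpha> \<zeta>)"
      by (intro tendsto_intros)
    then have ev2: "\<forall>\<^sub>F z in at \<zeta> within stolz \<alpha> \<zeta>. norm (\<zeta> - z) * norm (q w) < e / 2"
      by (rule order_tendstoD) (use e in auto)
    have ev3: "\<forall>\<^sub>F z in at \<zeta> within stolz \<alpha> \<zeta>. z \<in> stolz \<alpha> \<zeta>"
      by (auto simp: eventually_at_filter)
    show "\<forall>\<^sub>F z in at \<zeta> within stolz \<alpha> \<zeta>. dist ((\<zeta> - z) * q z) 0 < e"
      using ev1 ev2 ev3
    proof eventually_elim
      case (elim z)
      have z: "norm z < 1" and st: "norm (\<zeta> - z) < \<alpha> * (1 - norm z)"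
        using elim(3) by (auto simp: stolz_def dist_norm norm_minus_commute)
      define A where "A = norm (q z + cnj (q w))"
      define B where "B = (norm (1 - cnj w * z))\<^sup>2"
      define P where "P = (1 - (norm z)\<^sup>2)"
      define Q where "Q = (1 - (norm w)\<^sup>2)"
      have Q: "Q > 0" "P > 0" using w z by (auto simp: Q_def P_def abs_square_less_1)
      have A0: "A \<ge> 0" "B \<ge> 0" by (auto simp: A_def B_def)
      have pick: "A\<^sup>2 * (P * Q) \<le> 4 * Re (q z) * Re (q w) * B"
        unfolding A_def B_def P_def Q_def by (rule pick_half_plane[OF hol nn]) (use w z in auto)
      have Rez: "Re (q z) \<le> A"
      proof -
        have "Re (q z) \<le> Re (q z + cnj (q w))" using nn[of w] w by simp
        then show ?thesis unfolding A_def using complex_Re_le_cmod order_trans by blast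
      qed
      have Rw: "Re (q w) \<ge> 0" using nn w by simp
      \<comment> \<open>Pick's bound is quadratic in \<open>A\<close> on the left and linear in
        \<open>Re (q z) \<le> A\<close> on the right, so one factor \<open>A\<close>
        cancels.\<close>
      have "A * (P * Q) \<le> 4 * Re (q w) * B"
      proof (cases "A = 0")
        case True
        then show ?thesis using Rw A0 by simp
      next
        case False
        have "A * (A * (P * Q)) \<le> 4 * Re (q z) * Re (q w) * B" using pick by (simp add: power2_eq_square mult_ac)
        also have "\<dots> \<le> A * (4 * Re (q w) * B)"
          using mult_right_mono[OF Rez, of "4 * Re (q w) * B"] Rw A0 by (simp add: mult_ac)
        finally show ?thesis using False A0 by simp
      qed
      also have "\<dots> \<le> 4 * (d * (Q / (norm (\<zeta> - w))\<^sup>2)) * (2 * (norm (\<zeta> - w))\<^sup>2)"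
        using Rew elim(1) Rw A0 by (intro mult_mono) (auto simp: B_def Q_def)
      also have "\<dots> = 8 * d * Q" using nz by simp
      finally have "A * P \<le> 8 * d" using Q by (simp add: mult.assoc[symmetric])
      moreover have "P \<ge> 1 - norm z" using z by (simp add: P_def power2_eq_square mult_left_le)
      ultimately have A1: "A * (1 - norm z) \<le> 8 * d"
        using mult_left_mono[OF _ A0(1)] order_trans by blast
      have "norm (\<zeta> - z) * A \<le> \<alpha> * (1 - norm z) * A" using st A0 by (intro mult_right_mono) auto
      also have "\<dots> \<le> \<alpha> * (8 * d)" using A1 \<alpha> by (simp add: mult.assoc mult.commute)
      also have "\<dots> = e / 2" using \<alpha> by (simp add: d_def)
      finally have *: "norm (\<zeta> - z) * A \<le> e / 2" .
      have "norm (q z) \<le> A + norm (q w)"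
        using norm_triangle_ineq4[of "q z + cnj (q w)" "cnj (q w)"] by (simp add: A_def)
      then have "norm (\<zeta> - z) * norm (q z) \<le> norm (\<zeta> - z) * (A + norm (q w))"
        by (intro mult_left_mono) auto
      moreover have "dist ((\<zeta> - z) * q z) 0 = norm (\<zeta> - z) * norm (q z)" by (simp add: norm_mult)
      ultimately show ?case using * elim(2) by (simp add: distrib_left)
    qed
  qed
qed

text \<open>Cauchy's estimate for the remainder \<open>h\<close>, which is small compared with the
  distance to \<open>\<zeta>\<close> in a wider Stolz region. The disc of radius
  \<open>(1 - norm z) / 2\<close> about \<open>z\<close> stays inside the region of aperture
  \<open>2 * \<alpha> + 1\<close>, and its radius is comparable to that distance, so dividing by it
  does no harm.\<close>

lemma nt_limit_deriv:
  assumes hol: "f holomorphic_on unit_disc" and \<zeta>: "norm \<zeta> = 1"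
    and lim: "has_nt_limit (\<lambda>z. (\<omega> - f z) / (\<zeta> - z)) L \<zeta>"
  shows "has_nt_limit (deriv f) L \<zeta>"
  unfolding has_nt_limit_def
proof (intro allI impI)
  fix \<alpha> :: real assume \<alpha>: "\<alpha> > 1"
  show "(deriv f \<longlongrightarrow> L) (at \<zeta> within stolz \<alpha> \<zeta>)"
  proof (rule tendstoI)
    fix e :: real assume e: "e > 0"
    define \<beta> where "\<beta> = 2 * \<alpha> + 1"
    define d where "d = e / (4 * (\<alpha> + 1))"
    have d: "d > 0" using e \<alpha> by (simp add: d_def)
    have "((\<lambda>z. (\<omega> - f z) / (\<zeta> - z)) \<longlongrightarrow> L) (at \<zeta> within stolz \<beta> \<zeta>)"
      using lim \<alpha> by (simp add: has_nt_limit_def \<beta>_def)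
    then obtain \<eta> where \<eta>: "\<eta> > 0"
      and close: "\<And>v. v \<in> stolz \<beta> \<zeta> \<Longrightarrow> v \<noteq> \<zeta> \<Longrightarrow> dist v \<zeta> < \<eta> \<Longrightarrow> dist ((\<omega> - f v) / (\<zeta> - v)) L < d"
      using d unfolding tendsto_iff eventually_at by metis
    have "\<forall>\<^sub>F z in at \<zeta> within stolz \<alpha> \<zeta>. dist z \<zeta> < \<eta> / 2"
      using \<eta> by (auto simp: eventually_at intro: exI[of _ "\<eta>/2"])
    moreover have "\<forall>\<^sub>F z in at \<zeta> within stolz \<alpha> \<zeta>. z \<in> stolz \<alpha> \<zeta>"
      by (auto simp: eventually_at_filter)
    ultimately show "\<forall>\<^sub>F z in at \<zeta> within stolz \<alpha> \<zeta>. dist (deriv f z) L < e"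
    proof eventually_elim
      case (elim z)
      have z: "norm z < 1" and st: "dist z \<zeta> < \<alpha> * (1 - norm z)" using elim(2) by (auto simp: stolz_def)
      define \<rho> where "\<rho> = (1 - norm z) / 2"
      have \<rho>: "\<rho> > 0" using z by (simp add: \<rho>_def)
      define h where "h v = f v - \<omega> - L * (v - \<zeta>)" for v
      have zd: "1 - norm z \<le> dist z \<zeta>"
        using norm_triangle_ineq2[of \<zeta> z] \<zeta> by (simp add: dist_norm norm_minus_commute)
      have cb: "norm v < 1" "v \<in> stolz \<beta> \<zeta>" "dist v \<zeta> < \<eta>" "dist v \<zeta> \<le> 2 * (\<alpha> + 1) * \<rho>"
        if v: "v \<in> cball z \<rho>" for v
      proof -
        have "dist z v \<le> \<rho>" using v by simp
        then have nv: "norm v \<le> norm z + \<rho>" using norm_triangle_ineq2[of v z]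
          by (simp add: dist_norm norm_minus_commute)
        then have nv': "1 - norm v \<ge> \<rho>" by (simp add: \<rho>_def field_simps)
        then show "norm v < 1" using \<rho> by simp
        have dv: "dist v \<zeta> \<le> \<rho> + dist z \<zeta>" using \<open>dist z v \<le> \<rho>\<close> dist_triangle[of v \<zeta> z] by (simp add: dist_commute)
        also have "\<dots> < \<rho> + 2 * \<alpha> * \<rho>" using st by (simp add: \<rho>_def)
        finally have dv2: "dist v \<zeta> < \<beta> * \<rho>" by (simp add: \<beta>_def algebra_simps)
        also have "\<dots> \<le> \<beta> * (1 - norm v)" using nv' \<alpha> by (intro mult_left_mono) (auto simp: \<beta>_def)
        finally show "v \<in> stolz \<beta> \<zeta>" using \<open>norm v < 1\<close> by (simp add: stolz_def)
        show "dist v \<zeta> < \<eta>" using dv zd elim(1) \<eta> by (simp add: \<rho>_def field_simps)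
        show "dist v \<zeta> \<le> 2 * (\<alpha> + 1) * \<rho>" using dv2 \<rho> by (simp add: \<beta>_def algebra_simps)
      qed
      have hb: "norm (h v) < d * (2 * (\<alpha> + 1) * \<rho>)" if v: "v \<in> cball z \<rho>" for v
      proof -
        have ne: "v \<noteq> \<zeta>" using cb(1)[OF v] \<zeta> by auto
        have "h v = (v - \<zeta>) * ((\<omega> - f v) / (\<zeta> - v) - L)" using ne by (simp add: h_def field_simps)
        then have "norm (h v) = dist v \<zeta> * dist ((\<omega> - f v) / (\<zeta> - v)) L" by (simp add: norm_mult dist_norm)
        also have "\<dots> < dist v \<zeta> * d" using close[OF cb(2)[OF v] ne cb(3)[OF v]] ne by simp
        also have "\<dots> \<le> 2 * (\<alpha> + 1) * \<rho> * d" using cb(4)[OF v] d by (intro mult_right_mono) auto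
        finally show ?thesis by (simp add: mult_ac)
      qed
      have sub: "cball z \<rho> \<subseteq> unit_disc" using cb(1) by auto
      have holh: "h holomorphic_on cball z \<rho>" unfolding h_def
        by (intro holomorphic_intros holomorphic_on_subset[OF hol sub])
      have "norm ((deriv ^^ 1) h z) \<le> fact 1 * (d * (2 * (\<alpha> + 1) * \<rho>)) / \<rho> ^ 1"
        by (rule Cauchy_higher_deriv_bound[where y = 0])
          (use \<rho> holh hb in \<open>auto intro: holomorphic_on_subset holomorphic_on_imp_continuous_on\<close>)
      also have "\<dots> = e / 2" using \<rho> \<alpha> by (simp add: d_def divide_simps)
      finally have "norm (deriv h z) < e" using e by simp
      moreover have "deriv h z = deriv f z - L"
      proof -
        have "f field_differentiable at z" using hol z by (simp add: holomorphic_on_imp_differentiable_at)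
        then have "(f has_field_derivative deriv f z) (at z)" by (simp add: DERIV_deriv_iff_field_differentiable)
        then have "(h has_field_derivative deriv f z - L) (at z)" unfolding h_def
          by (auto intro!: derivative_eq_intros)
        then show ?thesis by (rule DERIV_imp_deriv)
      qed
      ultimately show ?case by (simp add: dist_norm)
    qed
  qed
qed


text \<open>Let \<open>t\<close> be the largest number for which \<open>H - t K\<close> keeps a
  nonnegative real part; Julia's lemma makes it positive. Points where the quotient of the real
  parts is almost \<open>t\<close> are what \<open>nt_limit_times_diff_zero\<close> asks for, so
  \<open>(\<zeta> - z) * H z\<close> behaves like \<open>t\<close> times the same expression for
  \<open>K\<close> and tends to \<open>2 * t * \<zeta>\<close>. Solving for the difference quotient
  gives the limit \<open>\<omega> / (t * \<zeta>)\<close>.\<close>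

lemma angular_derivative_if_bound:
  assumes f: "holo_self_map f" and \<zeta>: "norm \<zeta> = 1"
    and bound: "\<And>r. 0 \<le> r \<Longrightarrow> r < 1 \<Longrightarrow> 1 - norm (f (of_real r * \<zeta>)) \<le> M * (1 - r)"
  shows "\<zeta> \<in> caratheodory_set f"
proof -
  have hol: "f holomorphic_on unit_disc" using f by (simp add: holo_self_map_def)
  have lt: "norm (f z) < 1" if "norm z < 1" for z using holo_self_map_norm_less[OF f that] .
  obtain \<omega> where \<omega>: "norm \<omega> = 1" and julia:
    "\<And>z. z \<in> unit_disc \<Longrightarrow> (1 - (norm z)\<^sup>2) * (norm (\<omega> - f z))\<^sup>2
        \<le> 2 * M * (1 - (norm (f z))\<^sup>2) * (norm (\<zeta> - z))\<^sup>2"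
    using julia_lemma[OF f \<zeta> bound] by blast
  have "1 - norm (f 0) > 0" using lt[of 0] by simp
  then have M: "M > 0" using bound[of 0] by simp
  define K where "K z = (\<zeta> + z) / (\<zeta> - z)" for z
  define H where "H z = (\<omega> + f z) / (\<omega> - f z)" for z
  have ne: "\<zeta> - z \<noteq> 0" "\<omega> - f z \<noteq> 0" if "norm z < 1" for z
    using that \<zeta> \<omega> lt[OF that] by auto
  have ReK: "Re (K z) = (1 - (norm z)\<^sup>2) / (norm (\<zeta> - z))\<^sup>2" if "norm z < 1" for z
    unfolding K_def using Re_cayley[OF \<zeta>] ne[OF that] by simp
  have ReH: "Re (H z) = (1 - (norm (f z))\<^sup>2) / (norm (\<omega> - f z))\<^sup>2" if "norm z < 1" for z
    unfolding H_def using Re_cayley[OF \<omega>] ne[OF that] by simp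
  have Kpos: "Re (K z) > 0" if "norm z < 1" for z
    unfolding ReK[OF that] using that ne[OF that] by (simp add: abs_square_less_1)
  define t where "t = (INF z\<in>unit_disc. Re (H z) / Re (K z))"
  have low: "1 / (2 * M) \<le> Re (H z) / Re (K z)" if z: "z \<in> unit_disc" for z
  proof -
    have z': "norm z < 1" using z by simp
    have "0 < norm (\<omega> - f z)" "0 < norm (\<zeta> - z)" "0 < 1 - (norm z)\<^sup>2"
      using ne[OF z'] z' by (auto simp: abs_square_less_1)
    then show ?thesis using julia[OF z] M unfolding ReH[OF z'] ReK[OF z']
      by (simp add: divide_simps mult_ac) (simp add: algebra_simps)
  qed
  have bdd: "bdd_below ((\<lambda>z. Re (H z) / Re (K z)) ` unit_disc)"
    by (rule bdd_belowI2[of _ "1 / (2 * M)"]) (rule low)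
  have t: "t > 0"
  proof -
    have "1 / (2 * M) \<le> t" unfolding t_def by (rule cINF_greatest) (use low in auto)
    moreover have "1 / (2 * M) > 0" using M by simp
    ultimately show ?thesis by linarith
  qed
  define q where "q z = H z - of_real t * K z" for z
  have Req: "Re (q z) = Re (H z) - t * Re (K z)" for z by (simp add: q_def)
  have "has_nt_limit (\<lambda>z. (\<zeta> - z) * q z) 0 \<zeta>"
  proof (rule nt_limit_times_diff_zero[OF _ _ \<zeta>])
    show "q holomorphic_on unit_disc" unfolding q_def H_def K_def
      by (intro holomorphic_intros hol) (use ne in auto)
    show "Re (q z) \<ge> 0" if "z \<in> unit_disc" for z
    proof -
      have "t \<le> Re (H z) / Re (K z)" unfolding t_def by (rule cINF_lower[OF bdd that])
      then show ?thesis using Kpos[of z] that by (simp add: Req pos_le_divide_eq)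
    qed
    fix e :: real assume e: "e > 0"
    have "\<exists>z\<in>unit_disc. Re (H z) / Re (K z) < t + e"
      using e by (subst cINF_less_iff[OF _ bdd, symmetric]) (simp_all flip: t_def)
    then obtain w where w: "w \<in> unit_disc" "Re (H w) / Re (K w) < t + e" by blast
    then have "Re (q w) \<le> e * Re (K w)" using Kpos[of w]
      by (simp add: Req pos_divide_less_eq algebra_simps)
    then show "\<exists>w\<in>unit_disc. Re (q w) \<le> e * ((1 - (norm w)\<^sup>2) / (norm (\<zeta> - w))\<^sup>2)"
      using w(1) ReK[of w] by (intro bexI[of _ w]) simp_all
  qed
  then have qlim: "((\<lambda>z. (\<zeta> - z) * q z) \<longlongrightarrow> 0) (at \<zeta> within stolz \<alpha> \<zeta>)" if "\<alpha> > 1" for \<alpha>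
    using that by (simp add: has_nt_limit_def)
  define L where "L = 2 * \<omega> / (of_real t * (2 * \<zeta>))"
  have "\<zeta> \<noteq> 0" using \<zeta> by (metis norm_zero zero_neq_one)
  then have den: "of_real t * (2 * \<zeta>) \<noteq> 0" using t by simp
  have quot: "has_nt_limit (\<lambda>z. (\<omega> - f z) / (\<zeta> - z)) L \<zeta>" and val: "has_nt_limit f \<omega> \<zeta>"
  proof -
    have both: "(f \<longlongrightarrow> \<omega>) (at \<zeta> within stolz \<alpha> \<zeta>) \<and>
       ((\<lambda>z. (\<omega> - f z) / (\<zeta> - z)) \<longlongrightarrow> L) (at \<zeta> within stolz \<alpha> \<zeta>)" if \<alpha>: "\<alpha> > 1" for \<alpha>
    proof -
      let ?F = "at \<zeta> within stolz \<alpha> \<zeta>"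
      have ev: "\<forall>\<^sub>F z in ?F. norm z < 1" by (auto simp: eventually_at_filter stolz_def)
      have "((\<lambda>z. (\<zeta> - z) * q z + of_real t * (\<zeta> + z)) \<longlongrightarrow> 0 + of_real t * (\<zeta> + \<zeta>)) ?F"
        by (intro tendsto_intros qlim \<alpha>)
      moreover have "\<forall>\<^sub>F z in ?F. (\<zeta> - z) * q z + of_real t * (\<zeta> + z) = (\<zeta> - z) * H z"
        using ev by eventually_elim (use ne(1) in \<open>simp add: q_def K_def field_simps\<close>)
      ultimately have Hlim: "((\<lambda>z. (\<zeta> - z) * H z) \<longlongrightarrow> of_real t * (2 * \<zeta>)) ?F"
        by (simp add: tendsto_cong)
      have ev2: "\<forall>\<^sub>F z in ?F. (\<zeta> - z) * H z = (\<zeta> - z) / (\<omega> - f z) * (2 * \<omega>) - (\<zeta> - z)"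
        using ev by eventually_elim (use ne in \<open>simp add: H_def field_simps\<close>)
      \<comment> \<open>Since \<open>H + 1 = 2 \<omega> / (\<omega> - f)\<close>, adding the term
        \<open>\<zeta> - z\<close>, which vanishes in the limit, isolates the difference
        quotient.\<close>
      have "((\<lambda>z. (\<zeta> - z) * H z + (\<zeta> - z)) \<longlongrightarrow> of_real t * (2 * \<zeta>) + (\<zeta> - \<zeta>)) ?F"
        by (intro tendsto_intros Hlim)
      then have "((\<lambda>z. 2 * \<omega> / ((\<zeta> - z) * H z + (\<zeta> - z))) \<longlongrightarrow> L) ?F"
        unfolding L_def by (intro tendsto_intros) (use den in auto)
      moreover have "\<forall>\<^sub>F z in ?F. 2 * \<omega> / ((\<zeta> - z) * H z + (\<zeta> - z)) = (\<omega> - f z) / (\<zeta> - z)"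
        using ev ev2
      proof eventually_elim
        case (elim z)
        have "\<omega> \<noteq> 0" using \<omega> by (metis norm_zero zero_neq_one)
        then have "2 * \<omega> \<noteq> 0" by simp
        then show ?case using ne[OF elim(1)] unfolding elim(2) by simp
      qed
      ultimately have Q: "((\<lambda>z. (\<omega> - f z) / (\<zeta> - z)) \<longlongrightarrow> L) ?F" by (simp add: tendsto_cong)
      have "((\<lambda>z. \<omega> - (\<omega> - f z) / (\<zeta> - z) * (\<zeta> - z)) \<longlongrightarrow> \<omega> - L * (\<zeta> - \<zeta>)) ?F"
        by (intro tendsto_intros Q)
      moreover have "\<forall>\<^sub>F z in ?F. \<omega> - (\<omega> - f z) / (\<zeta> - z) * (\<zeta> - z) = f z"
        using ev by eventually_elim (use ne in simp)
      ultimately have "(f \<longlongrightarrow> \<omega>) ?F" by (simp add: tendsto_cong)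
      with Q show ?thesis by blast
    qed
    then show "has_nt_limit (\<lambda>z. (\<omega> - f z) / (\<zeta> - z)) L \<zeta>" "has_nt_limit f \<omega> \<zeta>"
      by (simp_all add: has_nt_limit_def)
  qed
  have "\<zeta> \<in> unit_circle" using \<zeta> by simp
  then show ?thesis unfolding caratheodory_set_def
    using nt_limit_deriv[OF hol \<zeta> quot] val \<omega> by blast
qed

text \<open>The derivative is bounded on the last part of the radius, and the mean value inequality
  from \<open>r\<close> to \<open>s\<close> gives the linear bound as \<open>s\<close> tends to 1,
  because |f| tends to 1. On the initial part \<open>r \<le> c\<close> the trivial bound 1 is at
  most \<open>(1 - r) / (1 - c)\<close>.\<close>

lemma bound_if_angular_derivative:
  assumes f: "holo_self_map f" and car: "\<zeta> \<in> caratheodory_set f"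
  obtains M where "\<And>r. 0 \<le> r \<Longrightarrow> r < 1 \<Longrightarrow> 1 - norm (f (of_real r * \<zeta>)) \<le> M * (1 - r)"
proof -
  have hol: "f holomorphic_on unit_disc" using f by (simp add: holo_self_map_def)
  obtain \<omega> d where \<zeta>: "norm \<zeta> = 1" and \<omega>: "norm \<omega> = 1" "has_nt_limit f \<omega> \<zeta>"
    and d: "has_nt_limit (deriv f) d \<zeta>" using car by (auto simp: caratheodory_set_def)
  have "((\<lambda>r. norm (deriv f (of_real r * \<zeta>))) \<longlongrightarrow> norm d) (at_left (1::real))"
    by (intro tendsto_intros has_nt_limit_radial d \<zeta>)
  then have "\<forall>\<^sub>F r in at_left (1::real). norm (deriv f (of_real r * \<zeta>)) < norm d + 1"
    by (rule order_tendstoD) simp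
  then obtain b where b: "b < 1" and db: "\<And>r. b < r \<Longrightarrow> r < 1 \<Longrightarrow> norm (deriv f (of_real r * \<zeta>)) < norm d + 1"
    unfolding eventually_at_left[OF zero_less_one] by auto
  define c where "c = max b 0"
  have c: "0 \<le> c" "c < 1" using b by (auto simp: c_def)
  define M where "M = max (norm d + 1) (1 / (1 - c))"
  show thesis
  proof (rule that[of M])
    fix r :: real assume r: "0 \<le> r" "r < 1"
    show "1 - norm (f (of_real r * \<zeta>)) \<le> M * (1 - r)"
    proof (cases "r \<le> c")
      case True
      have "1 - norm (f (of_real r * \<zeta>)) \<le> 1" by simp
      also have "\<dots> \<le> 1 / (1 - c) * (1 - r)" using True c by (simp add: divide_simps)
      also have "\<dots> \<le> M * (1 - r)" using r by (intro mult_right_mono) (auto simp: M_def)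
      finally show ?thesis .
    next
      case False
      have step: "norm (f (of_real s * \<zeta>)) - norm (f (of_real r * \<zeta>)) \<le> (norm d + 1) * (1 - r)"
        if s: "r < s" "s < 1" for s
      proof -
        define S where "S = closed_segment (of_real r * \<zeta>) (of_real s * \<zeta>)"
        have S: "\<exists>u. v = of_real u * \<zeta> \<and> r \<le> u \<and> u \<le> s" if "v \<in> S" for v
        proof -
          obtain u where u: "0 \<le> u" "u \<le> 1" "v = (1 - u) *\<^sub>R (of_real r * \<zeta>) + u *\<^sub>R (of_real s * \<zeta>)"
            using \<open>v \<in> S\<close> by (auto simp: S_def in_segment)
          have "v = of_real (r + u * (s - r)) * \<zeta>" using u(3) by (simp add: scaleR_conv_of_real algebra_simps)
          moreover have "u * (s - r) \<le> 1 * (s - r)" using u s by (intro mult_right_mono) auto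
          moreover have "u * (s - r) \<ge> 0" using u s by simp
          ultimately show ?thesis by (intro exI[of _ "r + u * (s - r)"]) auto
        qed
        have "norm (f (of_real s * \<zeta>) - f (of_real r * \<zeta>)) \<le> (norm d + 1) * norm (of_real s * \<zeta> - of_real r * \<zeta>)"
        proof (rule field_differentiable_bound[of S f "deriv f"])
          show "convex S" by (simp add: S_def)
          fix v assume "v \<in> S"
          then obtain u where u: "v = of_real u * \<zeta>" "r \<le> u" "u \<le> s" using S by blast
          then have "norm v < 1" using s r \<zeta> by (simp add: norm_mult)
          then have "f field_differentiable at v" using hol by (simp add: holomorphic_on_imp_differentiable_at)
          then show "(f has_field_derivative deriv f v) (at v within S)"
            by (simp add: DERIV_deriv_iff_field_differentiable has_field_derivative_at_within)
          show "norm (deriv f v) \<le> norm d + 1"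
            using db[of u] u s False by (auto simp: c_def intro: less_imp_le)
        qed (auto simp: S_def)
        also have "of_real s * \<zeta> - of_real r * \<zeta> = of_real (s - r) * \<zeta>" by (simp add: algebra_simps)
        also have "norm (of_real (s - r) * \<zeta>) = s - r" using \<zeta> s by (simp add: norm_mult del: of_real_diff)
        also have "(norm d + 1) * (s - r) \<le> (norm d + 1) * (1 - r)" using s by (intro mult_left_mono) auto
        finally show ?thesis using norm_triangle_ineq2[of "f (of_real s * \<zeta>)" "f (of_real r * \<zeta>)"] by linarith
      qed
      have "1 - norm (f (of_real r * \<zeta>)) \<le> (norm d + 1) * (1 - r)"
      proof (rule tendsto_upperbound)
        show "((\<lambda>s. norm (f (of_real s * \<zeta>)) - norm (f (of_real r * \<zeta>))) \<longlongrightarrow> 1 - norm (f (of_real r * \<zeta>))) (at_left (1::real))"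
          using tendsto_diff[OF tendsto_norm[OF has_nt_limit_radial[OF \<omega>(2) \<zeta>]] tendsto_const] \<omega>(1) by simp
        show "\<forall>\<^sub>F s in at_left 1. norm (f (of_real s * \<zeta>)) - norm (f (of_real r * \<zeta>)) \<le> (norm d + 1) * (1 - r)"
          by (rule eventually_at_leftI[of r]) (use step r in auto)
      qed simp
      also have "\<dots> \<le> M * (1 - r)" using r by (intro mult_right_mono) (auto simp: M_def)
      finally show ?thesis .
    qed
  qed
qed

lemma julia_caratheodory:
  assumes "holo_self_map f"
  shows "caratheodory_set f = {\<zeta> \<in> unit_circle.
    \<exists>M. \<forall>r. 0 \<le> r \<longrightarrow> r < 1 \<longrightarrow> 1 - norm (f (of_real r * \<zeta>)) \<le> M * (1 - r)}" (is "_ = ?R")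
proof (intro equalityI subsetI)
  fix \<zeta> assume \<zeta>: "\<zeta> \<in> caratheodory_set f"
  then have "\<zeta> \<in> unit_circle" by (simp add: caratheodory_set_def)
  then show "\<zeta> \<in> ?R" using bound_if_angular_derivative[OF assms \<zeta>] by blast
next
  fix \<zeta> assume "\<zeta> \<in> ?R"
  then show "\<zeta> \<in> caratheodory_set f" using angular_derivative_if_bound[OF assms] by auto
qed

section \<open>Integration over the circle and the Poisson kernel\<close>

text \<open>Angles replace points of the circle: \<open>circle_measure\<close> lives on a completed,
  restricted sigma-algebra, whereas Borel integrands on the line can be shifted, cut and compared
  with \<open>lborel\<close>.\<close>

abbreviation circ :: "real measure" where
  "circ \<equiv> uniform_measure lborel {0..<2*pi}"

lemma prob_space_circ: "prob_space circ"
  by (intro prob_space_uniform_measure) auto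

interpretation circ: prob_space circ by (rule prob_space_circ)

lemma nn_integral_circ:
  assumes [measurable]: "f \<in> borel_measurable borel"
  shows "(\<integral>\<^sup>+t. f t \<partial>circ) = (\<integral>\<^sup>+t\<in>{0..<2*pi}. f t \<partial>lborel) / ennreal (2 * pi)"
  by (simp add: nn_integral_uniform_measure)

lemma cis_borel [measurable]: "cis \<in> borel_measurable borel"
  by (intro borel_measurable_continuous_onI continuous_on_cis continuous_on_id)

lemma nn_integral_circle_measure:
  assumes [measurable]: "f \<in> borel_measurable borel"
  shows "(\<integral>\<^sup>+\<zeta>. f \<zeta> \<partial>circle_measure) = (\<integral>\<^sup>+t. f (cis t) \<partial>circ)"
proof -
  have "f \<in> borel_measurable (restrict_space borel unit_circle)"
    by (rule measurable_restrict_space1) simp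
  then show ?thesis unfolding circle_measure_def nn_integral_completion
    by (subst nn_integral_distr[OF cis_measurable_circle]) simp_all
qed

lemma sets_circle_measureI:
  assumes "A \<in> sets borel"
  shows "A \<inter> unit_circle \<in> sets circle_measure"
proof -
  have "A \<inter> unit_circle \<in> sets (restrict_space borel unit_circle)"
    using assms by (auto simp: sets_restrict_space)
  then show ?thesis unfolding circle_measure_def by (intro sets_completionI_sets) simp
qed

lemma emeasure_circle_measure:
  assumes [measurable]: "A \<in> sets borel" and sub: "A \<subseteq> unit_circle"
  shows "emeasure circle_measure A = (\<integral>\<^sup>+t. indicator A (cis t) \<partial>circ)"
proof -
  have "A \<in> sets circle_measure" using sets_circle_measureI[OF assms(1)] sub by (simp add: inf_absorb1)
  then have "emeasure circle_measure A = (\<integral>\<^sup>+\<zeta>. indicator A \<zeta> \<partial>circle_measure)" by simp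
  also have "\<dots> = (\<integral>\<^sup>+t. indicator A (cis t) \<partial>circ)"
    by (rule nn_integral_circle_measure) simp
  finally show ?thesis .
qed

lemma AE_circle_measure:
  assumes [measurable]: "{\<zeta>. P \<zeta>} \<in> sets borel" and "AE t in circ. P (cis t)"
  shows "AE \<zeta> in circle_measure. P \<zeta>"
  unfolding circle_measure_def
proof (rule AE_completion)
  have "{x \<in> space (restrict_space borel unit_circle). P x} \<in> sets (restrict_space borel unit_circle)"
    using assms(1) by (auto simp: sets_restrict_space space_restrict_space)
  then show "AE \<zeta> in distr circ (restrict_space borel unit_circle) cis. P \<zeta>"
    using assms(2) by (subst AE_distr_iff[OF cis_measurable_circle]) auto
qed

lemma AE_circD:
  assumes "AE \<zeta> in circle_measure. P \<zeta>"
  shows "AE t in circ. P (cis t)"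
proof -
  have "AE \<zeta> in distr circ (restrict_space borel unit_circle) cis. P \<zeta>"
    using assms unfolding circle_measure_def by (simp add: AE_completion_iff)
  then show ?thesis by (rule AE_distrD[OF cis_measurable_circle])
qed

lemma nn_integral_shift:
  fixes f :: "real \<Rightarrow> ennreal"
  assumes [measurable]: "f \<in> borel_measurable borel"
  shows "(\<integral>\<^sup>+t. f (t + c) \<partial>lborel) = (\<integral>\<^sup>+t. f t \<partial>lborel)"
  using nn_integral_real_affine[OF assms, of 1 c] by (simp add: add.commute)

text \<open>Translation by multiples of \<open>p\<close> reduces the claim to a starting point
  within one period of such a multiple; there the piece left behind is moved over by one period.
  Everything is phrased with sums, as the integrals may be infinite.\<close>

lemma nn_integral_periodic:
  fixes f :: "real \<Rightarrow> ennreal"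
  assumes [measurable]: "f \<in> borel_measurable borel" and per: "\<And>t. f (t + p) = f t" and p: "p > 0"
  shows "(\<integral>\<^sup>+t\<in>{c..<c+p}. f t \<partial>lborel) = (\<integral>\<^sup>+t\<in>{0..<p}. f t \<partial>lborel)"
proof -
  have shift1: "(\<integral>\<^sup>+t\<in>{a+p..<b+p}. f t \<partial>lborel) = (\<integral>\<^sup>+t\<in>{a..<b}. f t \<partial>lborel)" for a b
  proof -
    have "(\<integral>\<^sup>+t\<in>{a+p..<b+p}. f t \<partial>lborel) = (\<integral>\<^sup>+t. f (t + p) * indicator {a+p..<b+p} (t + p) \<partial>lborel)"
      by (rule nn_integral_shift[symmetric, where f = "\<lambda>t. f t * indicator {a+p..<b+p} t"]) simp
    also have "\<dots> = (\<integral>\<^sup>+t\<in>{a..<b}. f t \<partial>lborel)"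
      by (intro nn_integral_cong) (auto simp: per indicator_def)
    finally show ?thesis .
  qed
  have split: "(\<integral>\<^sup>+t\<in>{a..<c}. f t \<partial>lborel) = (\<integral>\<^sup>+t\<in>{a..<b}. f t \<partial>lborel) + (\<integral>\<^sup>+t\<in>{b..<c}. f t \<partial>lborel)"
    if "a \<le> b" "b \<le> c" for a b c
    by (subst nn_integral_add[symmetric]) (auto intro!: nn_integral_cong simp: indicator_def, use that in auto)
  have small: "(\<integral>\<^sup>+t\<in>{c..<c+p}. f t \<partial>lborel) = (\<integral>\<^sup>+t\<in>{b..<b+p}. f t \<partial>lborel)"
    if "b \<le> c" "c \<le> b + p" for b c
    using split[of c "b+p" "c+p"] split[of b c "b+p"] shift1[of b c] that by (simp add: add.commute)
  have int: "(\<integral>\<^sup>+t\<in>{real n * p..<real n * p + p}. f t \<partial>lborel) = (\<integral>\<^sup>+t\<in>{0..<p}. f t \<partial>lborel)" for n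
    by (induction n) (use shift1[of "real _ * p" "real _ * p + p"] in \<open>simp_all add: algebra_simps\<close>)
  have int': "(\<integral>\<^sup>+t\<in>{- real n * p..<- real n * p + p}. f t \<partial>lborel) = (\<integral>\<^sup>+t\<in>{0..<p}. f t \<partial>lborel)" for n
  proof (induction n)
    case (Suc n)
    have "- real (Suc n) * p + p = - real n * p" by (simp add: algebra_simps)
    then show ?case using shift1[of "- real (Suc n) * p" "- real (Suc n) * p + p"] Suc by simp
  qed simp
  have "(\<integral>\<^sup>+t\<in>{of_int k * p..<of_int k * p + p}. f t \<partial>lborel) = (\<integral>\<^sup>+t\<in>{0..<p}. f t \<partial>lborel)" for k :: int
    using int[of "nat k"] int'[of "nat (- k)"] by (cases "k \<ge> 0") auto
  moreover have "of_int \<lfloor>c / p\<rfloor> * p \<le> c" "c \<le> of_int \<lfloor>c / p\<rfloor> * p + p"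
  proof -
    show "of_int \<lfloor>c / p\<rfloor> * p \<le> c" using p by (rule floor_divide_lower)
    show "c \<le> of_int \<lfloor>c / p\<rfloor> * p + p" using floor_divide_upper[OF p, of c] by (simp add: algebra_simps)
  qed
  ultimately show ?thesis using small[of "of_int \<lfloor>c / p\<rfloor> * p" c] by simp
qed

text \<open>The circle may be cut at any angle, so that a given arc or the neighbourhood of a given
  point becomes an interval.\<close>

lemma nn_integral_circ_from:
  assumes [measurable]: "f \<in> borel_measurable borel"
  shows "(\<integral>\<^sup>+t. f (cis t) \<partial>circ) = (\<integral>\<^sup>+t\<in>{c..<c+2*pi}. f (cis t) \<partial>lborel) / ennreal (2 * pi)"
proof -
  have "(\<integral>\<^sup>+t\<in>{c..<c+2*pi}. f (cis t) \<partial>lborel) = (\<integral>\<^sup>+t\<in>{0..<2*pi}. f (cis t) \<partial>lborel)"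
  proof (rule nn_integral_periodic[where f = "\<lambda>t. f (cis t)"])
    have "cis (t + 2 * pi) = cis t" for t by (simp add: complex_eq_iff)
    then show "f (cis (t + 2 * pi)) = f (cis t)" for t by simp
  qed simp_all
  then show ?thesis by (simp add: nn_integral_circ)
qed

lemma integral_circ:
  fixes g :: "real \<Rightarrow> complex"
  assumes cont: "continuous_on UNIV g"
  shows "(\<integral>t. g t \<partial>circ) = integral {0..2*pi} g / of_real (2 * pi)"
proof -
  have [measurable]: "g \<in> borel_measurable borel" using cont by (rule borel_measurable_continuous_onI)
  have eq: "circ = density lborel (\<lambda>t. ennreal (indicator {0..<2*pi} t / (2 * pi)))"
    unfolding uniform_measure_def by (intro density_cong) (auto simp: indicator_def divide_ennreal ennreal_1[symmetric] simp del: ennreal_1)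
  have "(\<integral>t. g t \<partial>circ) = (\<integral>t. (indicator {0..<2*pi} t / (2 * pi)) *\<^sub>R g t \<partial>lborel)"
    unfolding eq by (rule integral_density) auto
  also have "\<dots> = (\<integral>t. (1 / (2 * pi)) *\<^sub>R (indicator {0..2*pi} t *\<^sub>R g t) \<partial>lborel)"
  proof (rule integral_cong_AE)
    show "AE t in lborel. (indicator {0..<2*pi} t / (2 * pi)) *\<^sub>R g t = (1 / (2 * pi)) *\<^sub>R (indicator {0..2*pi} t *\<^sub>R g t)"
      using AE_lborel_singleton[of "2 * pi"] by eventually_elim (auto simp: indicator_def)
  qed auto
  also have "\<dots> = (1 / (2 * pi)) *\<^sub>R (LINT t:{0..2*pi}|lborel. g t)"
    by (simp only: set_lebesgue_integral_def integral_scaleR_right)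
  also have "(LINT t:{0..2*pi}|lborel. g t) = integral {0..2*pi} g"
  proof (rule set_borel_integral_eq_integral)
    show "set_integrable lborel {0..2*pi} g"
      unfolding set_integrable_def
      by (rule borel_integrable_compact) (use cont continuous_on_subset in auto)
  qed
  finally show ?thesis by (simp add: scaleR_conv_of_real divide_simps)
qed

section \<open>The Poisson kernel on the unit circle\<close>

definition poisson :: "complex \<Rightarrow> complex \<Rightarrow> real" where
  "poisson z \<xi> = (1 - (norm z)\<^sup>2) / (norm (\<xi> - z))\<^sup>2"

lemma poisson_measurable [measurable]: "poisson z \<in> borel_measurable borel"
  unfolding poisson_def by measurable

lemma poisson_nonneg: "norm z \<le> 1 \<Longrightarrow> poisson z \<xi> \<ge> 0"
  unfolding poisson_def by (simp add: power_le_one)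

text \<open>On the circle \<open>\<eta> - r \<xi>\<close> and \<open>\<xi> - r \<eta>\<close> have
  the same modulus. This serves to average a Poisson integral over a circle by exchanging the
  integrals.\<close>

lemma poisson_radial_sym:
  assumes "norm \<xi> = 1" "norm \<eta> = 1"
  shows "poisson (of_real r * \<xi>) \<eta> = poisson (of_real r * \<eta>) \<xi>"
proof -
  have n: "\<xi> * cnj \<xi> = 1" "\<eta> * cnj \<eta> = 1" using assms by (simp_all add: complex_norm_square[symmetric])
  have "\<eta> * \<xi> * cnj (\<xi> - of_real r * \<eta>) = \<eta> * (\<xi> * cnj \<xi>) - of_real r * \<xi> * (\<eta> * cnj \<eta>)"
    by (simp add: algebra_simps)
  also have "\<dots> = \<eta> - of_real r * \<xi>" by (simp only: n mult_1_right)
  finally have "norm (\<eta> - of_real r * \<xi>) = norm (\<eta> * \<xi> * cnj (\<xi> - of_real r * \<eta>))" by simp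
  also have "\<dots> = norm (\<xi> - of_real r * \<eta>)" using assms by (simp only: norm_mult complex_mod_cnj)
  finally show ?thesis unfolding poisson_def using assms by (simp add: norm_mult)
qed

lemma poisson_continuous:
  assumes "norm z < 1"
  shows "continuous_on UNIV (\<lambda>t. poisson z (cis t))"
  unfolding poisson_def
  by (intro continuous_intros continuous_on_cis) (use assms in auto)

lemma poisson_formula:
  assumes hol: "f holomorphic_on ball 0 R" and R: "R > 1" and z: "norm z < 1"
  shows "(\<integral>t. f (cis t) * of_real (poisson z (cis t)) \<partial>circ) = f z"
proof -
  \<comment> \<open>On the circle Cauchy's kernel for \<open>h\<close> is the Poisson kernel for \<open>f\<close>, and \<open>h z = f z\<close>.\<close>
  define h where "h u = f u * ((1 - (norm z)\<^sup>2) / (1 - cnj z * u))" for u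
  have ne: "1 - cnj z * u \<noteq> 0" if "u \<in> cball 0 1" for u
  proof -
    have "norm (cnj z * u) < 1"
      using z that mult_left_mono[of "norm u" 1 "norm z"] by (simp add: norm_mult)
    then show ?thesis by auto
  qed
  have cont: "continuous_on (cball 0 1) h" unfolding h_def
    by (intro continuous_intros holomorphic_on_imp_continuous_on holomorphic_on_subset[OF hol])
      (use R ne in auto)
  have holh: "h holomorphic_on ball 0 1" unfolding h_def
    by (intro holomorphic_intros holomorphic_on_subset[OF hol]) (use R ne in auto)
  have "((\<lambda>u. h u / (u - z)) has_contour_integral (2 * of_real pi * \<i> * h z)) (circlepath 0 1)"
    by (rule Cauchy_integral_circlepath) (use cont holh z in auto)
  then have "((\<lambda>t. h (0 + of_real 1 * cis t) / (0 + of_real 1 * cis t - z) * of_real 1 * \<i> * cis t)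
      has_integral (2 * of_real pi * \<i> * h z)) {0..2*pi}"
    unfolding circlepath_def by (subst (asm) has_contour_integral_part_circlepath_iff) auto
  then have int: "((\<lambda>t. h (cis t) / (cis t - z) * \<i> * cis t) has_integral (2 * of_real pi * \<i> * h z)) {0..2*pi}"
    by simp
  have "1 - cnj z * z = of_real (1 - (norm z)\<^sup>2)" by (simp only: of_real_diff complex_norm_square) (simp add: mult.commute)
  then have hz: "h z = f z" unfolding h_def using ne[of z] z by simp
  have point: "h (cis t) / (cis t - z) * \<i> * cis t = \<i> * (f (cis t) * of_real (poisson z (cis t)))" for t
  proof -
    have "1 - cnj z * cis t = cis t * cnj (cis t - z)"
      by (simp add: algebra_simps complex_norm_square[symmetric])
    moreover have "of_real (poisson z (cis t)) = of_real (1 - (norm z)\<^sup>2) / ((cis t - z) * cnj (cis t - z))"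
      by (simp only: poisson_def of_real_divide complex_norm_square)
    moreover have "cis t - z \<noteq> 0" "cis t \<noteq> 0" using z by auto
    ultimately show ?thesis by (simp add: h_def mult_ac del: complex_cnj_diff)
  qed
  have "((\<lambda>t. \<i> * (f (cis t) * of_real (poisson z (cis t)))) has_integral (2 * of_real pi * \<i> * f z)) {0..2*pi}"
    using int unfolding point hz .
  then have "((\<lambda>t. - \<i> * (\<i> * (f (cis t) * of_real (poisson z (cis t))))) has_integral (- \<i> * (2 * of_real pi * \<i> * f z))) {0..2*pi}"
    by (rule has_integral_mult_right)
  moreover have "- \<i> * (\<i> * x) = x" for x by simp
  moreover have "- \<i> * (2 * of_real pi * \<i> * f z) = 2 * of_real pi * f z" by (simp add: algebra_simps)
  ultimately have "integral {0..2*pi} (\<lambda>t. f (cis t) * of_real (poisson z (cis t))) = 2 * of_real pi * f z"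
    by (intro integral_unique) (simp only:)
  moreover have "continuous_on UNIV (\<lambda>t. f (cis t) * of_real (poisson z (cis t)))"
    by (intro continuous_intros poisson_continuous z
      continuous_on_compose2[OF holomorphic_on_imp_continuous_on[OF hol]] continuous_on_cis) (use R in auto)
  ultimately show ?thesis by (simp add: integral_circ)
qed

lemma integral_poisson:
  assumes "norm z < 1"
  shows "(\<integral>t. poisson z (cis t) \<partial>circ) = 1"
proof -
  have "(\<integral>t. 1 * complex_of_real (poisson z (cis t)) \<partial>circ) = 1"
    by (rule poisson_formula[of _ 2]) (use assms in auto)
  then have "complex_of_real (\<integral>t. poisson z (cis t) \<partial>circ) = 1" by simp
  then show ?thesis by (metis of_real_eq_1_iff)
qed

lemma poisson_bounded:
  assumes "norm z < 1"
  shows "poisson z (cis t) \<le> (1 - (norm z)\<^sup>2) / (1 - norm z)\<^sup>2"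
proof -
  have "1 - norm z \<le> norm (cis t - z)" using norm_triangle_ineq2[of "cis t" z] by simp
  then have "(1 - norm z)\<^sup>2 \<le> (norm (cis t - z))\<^sup>2" using assms by (intro power_mono) auto
  moreover have "(norm z)\<^sup>2 \<le> 1" using assms by (simp add: power_le_one)
  ultimately show ?thesis unfolding poisson_def using assms
    by (intro divide_left_mono) (auto intro!: mult_pos_pos)
qed

lemma nn_integral_poisson:
  assumes "norm z < 1"
  shows "(\<integral>\<^sup>+t. ennreal (poisson z (cis t)) \<partial>circ) = 1"
proof -
  have "integrable circ (\<lambda>t. poisson z (cis t))"
    by (rule circ.integrable_const_bound[of _ "(1 - (norm z)\<^sup>2) / (1 - norm z)\<^sup>2"])
      (use assms poisson_bounded poisson_nonneg in auto)
  then show ?thesis using integral_poisson[OF assms] assms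
    by (subst nn_integral_eq_integral) (auto intro!: AE_I2 poisson_nonneg)
qed

text \<open>The triangle inequality in the Poisson formula. Without integrability the Bochner
  integral is 0 and the bound is trivial. Functions on the open disc enter through their
  dilations.\<close>

lemma subharmonic_poisson:
  assumes hol: "f holomorphic_on ball 0 R" and R: "R > 1" and z: "norm z < 1"
  shows "ennreal (norm (f z)) \<le> (\<integral>\<^sup>+t. ennreal (norm (f (cis t)) * poisson z (cis t)) \<partial>circ)"
proof -
  have "ennreal (norm (f z)) = ennreal (norm (\<integral>t. f (cis t) * of_real (poisson z (cis t)) \<partial>circ))"
    using poisson_formula[OF assms] by simp
  also have "\<dots> \<le> (\<integral>\<^sup>+t. norm (f (cis t) * of_real (poisson z (cis t))) \<partial>circ)"
  proof (cases "integrable circ (\<lambda>t. f (cis t) * of_real (poisson z (cis t)))")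
    case True
    then show ?thesis by (rule integral_norm_bound_ennreal)
  qed (simp add: not_integrable_integral_eq)
  also have "\<dots> = (\<integral>\<^sup>+t. ennreal (norm (f (cis t)) * poisson z (cis t)) \<partial>circ)"
    using poisson_nonneg z by (intro nn_integral_cong) (simp add: norm_mult)
  finally show ?thesis .
qed

section \<open>Fatou's theorem on non-tangential limits\<close>

text \<open>The Hardy-Littlewood maximal inequality. A ball with too much mass has radius at most
  the total mass divided by \<open>A\<close>, so Vitali's lemma yields disjoint balls whose fivefold
  enlargements cover all such balls; enlarged, a ball has length \<open>10 * s\<close>, less than
  \<open>10 / A\<close> times its mass. Open enlargements make the exceptional set \<open>W\<close>
  open, hence measurable.\<close>

lemma weak_type_maximal:
  fixes u :: "real \<Rightarrow> ennreal" and A :: real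
  assumes [measurable]: "u \<in> borel_measurable borel" and A: "A > 0" and fin: "(\<integral>\<^sup>+x. u x \<partial>lborel) < \<infinity>"
  obtains W where "open W" "emeasure lborel W \<le> ennreal (10 / A) * (\<integral>\<^sup>+x. u x \<partial>lborel)"
    "\<And>t s. s > 0 \<Longrightarrow> t \<notin> W \<Longrightarrow> (\<integral>\<^sup>+x\<in>cball t s. u x \<partial>lborel) \<le> ennreal (A * s)"
proof -
  have [measurable]: "cball t s \<in> sets borel" for t s :: real by simp
  define K where "K = {(t, s). s > 0 \<and> ennreal (A * s) < (\<integral>\<^sup>+x\<in>cball t s. u x \<partial>lborel)}"
  obtain I where I: "(\<integral>\<^sup>+x. u x \<partial>lborel) = ennreal I" "I \<ge> 0"
    using fin by (cases "\<integral>\<^sup>+x. u x \<partial>lborel") auto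
  have rad: "0 < snd i \<and> snd i \<le> I / A" if "i \<in> K" for i
  proof -
    obtain t s where i: "i = (t, s)" by (cases i)
    have "ennreal (A * s) < (\<integral>\<^sup>+x\<in>cball t s. u x \<partial>lborel)" and "s > 0" using that i by (auto simp: K_def)
    note this(1)
    also have "(\<integral>\<^sup>+x\<in>cball t s. u x \<partial>lborel) \<le> ennreal I"
      unfolding I(1)[symmetric] by (intro nn_integral_mono) (auto simp: indicator_def)
    finally have "A * s < I" using A \<open>s > 0\<close> by (simp add: ennreal_less_iff)
    then show ?thesis using A \<open>s > 0\<close> i by (simp add: field_simps)
  qed
  obtain C where C: "countable C" "C \<subseteq> K"
    "pairwise (\<lambda>i j. disjnt (cball (fst i) (snd i)) (cball (fst j) (snd j))) C"
    "\<And>i. i \<in> K \<Longrightarrow> \<exists>j. j \<in> C \<and> \<not> disjnt (cball (fst i) (snd i)) (cball (fst j) (snd j)) \<and>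
       cball (fst i) (snd i) \<subseteq> ball (fst j) (5 * snd j)"
    by (rule Vitali_covering_lemma_cballs_balls[of K snd "I / A" fst, OF rad]) (blast intro: that)+
  define W where "W = (\<Union>j\<in>C. ball (fst j) (5 * snd j))"
  show thesis
  proof (rule that[of W])
    show "open W" by (auto simp: W_def)
    have disj: "(\<integral>\<^sup>+j. indicator (cball (fst j) (snd j)) x \<partial>count_space C) \<le> (1::ennreal)" for x :: real
    proof (cases "\<exists>j\<in>C. x \<in> cball (fst j) (snd j)")
      case True
      then obtain j where j: "j \<in> C" "x \<in> cball (fst j) (snd j)" by blast
      have "(\<integral>\<^sup>+i. indicator (cball (fst i) (snd i)) x \<partial>count_space C) \<le> (\<integral>\<^sup>+i. indicator {j} i \<partial>count_space C)"
      proof (rule nn_integral_mono)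
        fix i assume "i \<in> space (count_space C)"
        then have i: "i \<in> C" by simp
        have "i = j" if "x \<in> cball (fst i) (snd i)"
          using pairwiseD[OF C(3) i j(1)] j(2) that by (auto simp: disjnt_iff)
        then show "indicator (cball (fst i) (snd i)) x \<le> (indicator {j} i :: ennreal)"
          by (auto simp: indicator_def)
      qed
      also have "\<dots> \<le> 1" using j by (subst nn_integral_indicator) auto
      finally show ?thesis .
    next
      case False
      then have "(\<integral>\<^sup>+j. indicator (cball (fst j) (snd j)) x \<partial>count_space C) = (\<integral>\<^sup>+j. 0 \<partial>count_space C)"
        by (intro nn_integral_cong) (auto simp: indicator_def)
      then show ?thesis by simp
    qed
    have "emeasure lborel W = (\<integral>\<^sup>+x. indicator W x \<partial>lborel)"
      using \<open>open W\<close> by simp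
    also have "\<dots> \<le> (\<integral>\<^sup>+x. \<integral>\<^sup>+j. indicator (ball (fst j) (5 * snd j)) x \<partial>count_space C \<partial>lborel)"
    proof (rule nn_integral_mono)
      fix x :: real
      show "indicator W x \<le> (\<integral>\<^sup>+j. indicator (ball (fst j) (5 * snd j)) x \<partial>count_space C)"
      proof (cases "x \<in> W")
        case True
        then obtain j where j: "j \<in> C" "x \<in> ball (fst j) (5 * snd j)" by (auto simp: W_def)
        then have "indicator W x \<le> (\<integral>\<^sup>+i. indicator {j} i \<partial>count_space C)" using True by simp
        also have "\<dots> \<le> (\<integral>\<^sup>+j. indicator (ball (fst j) (5 * snd j)) x \<partial>count_space C)"
          using j by (intro nn_integral_mono) (auto simp: indicator_def)
        finally show ?thesis .
      qed simp
    qed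
    also have "\<dots> = (\<integral>\<^sup>+j. \<integral>\<^sup>+x. indicator (ball (fst j) (5 * snd j)) x \<partial>lborel \<partial>count_space C)"
      by (subst nn_integral_count_space_nn_integral[OF C(1)]) (auto intro!: borel_measurable_indicator)
    also have "\<dots> \<le> (\<integral>\<^sup>+j. \<integral>\<^sup>+x. ennreal (10 / A) * (u x * indicator (cball (fst j) (snd j)) x) \<partial>lborel \<partial>count_space C)"
    proof (rule nn_integral_mono)
      fix j assume "j \<in> space (count_space C)"
      then have j: "j \<in> K" using C by auto
      then have pos: "snd j > 0" using rad by auto
      have "(\<integral>\<^sup>+x. indicator (ball (fst j) (5 * snd j)) x \<partial>lborel) = ennreal (10 * snd j)"
        using pos by (simp add: ball_eq_greaterThanLessThan)
      also have "10 * snd j = 10 / A * (A * snd j)" using A by simp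
      also have "ennreal \<dots> = ennreal (10 / A) * ennreal (A * snd j)" using A pos by (intro ennreal_mult) auto
      also have "\<dots> \<le> ennreal (10 / A) * (\<integral>\<^sup>+x\<in>cball (fst j) (snd j). u x \<partial>lborel)"
        using j by (intro mult_left_mono) (auto simp: K_def)
      also have "\<dots> = (\<integral>\<^sup>+x. ennreal (10 / A) * (u x * indicator (cball (fst j) (snd j)) x) \<partial>lborel)"
        by (rule nn_integral_cmult[symmetric]) simp
      finally show "(\<integral>\<^sup>+x. indicator (ball (fst j) (5 * snd j)) x \<partial>lborel) \<le> \<dots>" .
    qed
    also have "\<dots> = (\<integral>\<^sup>+x. \<integral>\<^sup>+j. ennreal (10 / A) * (u x * indicator (cball (fst j) (snd j)) x) \<partial>count_space C \<partial>lborel)"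
      by (rule nn_integral_count_space_nn_integral[OF C(1), symmetric]) simp
    also have "\<dots> = (\<integral>\<^sup>+x. ennreal (10 / A) * (u x * (\<integral>\<^sup>+j. indicator (cball (fst j) (snd j)) x \<partial>count_space C)) \<partial>lborel)"
      by (simp add: nn_integral_cmult)
    also have "\<dots> \<le> (\<integral>\<^sup>+x. ennreal (10 / A) * (u x * 1) \<partial>lborel)"
      by (intro nn_integral_mono mult_left_mono disj) auto
    also have "\<dots> = ennreal (10 / A) * (\<integral>\<^sup>+x. u x \<partial>lborel)" by (simp add: nn_integral_cmult)
    finally show "emeasure lborel W \<le> \<dots>" .
    fix t s :: real assume s: "s > 0" and t: "t \<notin> W"
    show "(\<integral>\<^sup>+x\<in>cball t s. u x \<partial>lborel) \<le> ennreal (A * s)"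
    proof (rule ccontr)
      assume "\<not> ?thesis"
      then have "(t, s) \<in> K" using s by (auto simp: K_def)
      then obtain j where "j \<in> C" "cball t s \<subseteq> ball (fst j) (5 * snd j)" using C(4) by fastforce
      moreover have "t \<in> cball t s" using s by simp
      ultimately have "t \<in> W" unfolding W_def by blast
      with t show False by blast
    qed
  qed
qed

section \<open>Poisson integrals in Stolz regions against averages over intervals\<close>

lemma norm_cis_diff: "(norm (cis s - cis t))\<^sup>2 = (2 * sin ((s - t) / 2))\<^sup>2"
proof -
  have "(norm (cis s - cis t))\<^sup>2 = 2 - 2 * cos (s - t)"
    by (simp add: cmod_power2 power2_diff cos_diff)
      (use sin_cos_squared_add[of s] sin_cos_squared_add[of t] in linarith)
  also have "cos (s - t) = 1 - 2 * (sin ((s - t) / 2))\<^sup>2"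
  proof -
    have "2 * ((s - t) / 2) = s - t" by simp
    then show ?thesis using cos_double_sin[of "(s - t) / 2"] by (simp only:)
  qed
  finally show ?thesis by (simp add: power_mult_distrib)
qed

text \<open>The best constant is pi / 2. The constant 3 is what sin x >= x - x^3 / 6 gives with x^2
  <= 4, that is with pi < 4.\<close>

lemma jordan_chord:
  assumes "\<bar>s - t\<bar> \<le> pi"
  shows "\<bar>s - t\<bar> \<le> 3 * norm (cis s - cis t)"
proof -
  define x where "x = \<bar>s - t\<bar> / 2"
  have x: "0 \<le> x" "x \<le> pi / 2" using assms by (auto simp: x_def)
  have sq: "(norm (cis s - cis t))\<^sup>2 = (2 * sin x)\<^sup>2"
  proof (cases "s \<ge> t")
    case False
    then have "(s - t) / 2 = - x" by (simp add: x_def field_simps)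
    then show ?thesis unfolding norm_cis_diff by simp
  qed (simp add: norm_cis_diff x_def)
  have "sin x \<ge> 0" using x by (intro sin_ge_zero) auto
  then have n: "norm (cis s - cis t) = 2 * sin x" by (intro power2_eq_imp_eq[OF sq]) auto
  have "(\<Sum>m<3. sin_coeff m * x ^ m) = x" by (simp add: numeral_3_eq_3 sin_coeff_def)
  moreover have "inverse (fact 3) * \<bar>x\<bar> ^ 3 = x ^ 3 / 6" using x by (simp add: fact_numeral)
  ultimately have "\<bar>sin x - x\<bar> \<le> x ^ 3 / 6"
    using Maclaurin_sin_bound[of x 3] by metis
  moreover have "x ^ 3 \<le> 4 * x"
  proof -
    have "x * x \<le> 2 * 2" using x pi_less_4 by (intro mult_mono) auto
    then have "x * x * x \<le> 4 * x" using x by (intro mult_right_mono) auto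
    then show ?thesis by (simp add: power3_eq_cube)
  qed
  ultimately have "x \<le> 3 * sin x" by linarith
  then show ?thesis using n by (simp add: x_def)
qed


text \<open>In a Stolz region the distance from \<open>z\<close> to \<open>cis s\<close> is at least
  a fixed fraction of both \<open>\<delta>\<close> and \<open>\<bar>s - t\<bar>\<close>. Take the
  least \<open>k\<close> whose dyadic interval reaches \<open>s\<close>: as \<open>s\<close> lies
  outside the previous interval, the distance is at least \<open>2 ^ k * \<delta> / 2\<close>, and
  the kernel is at most \<open>2 * \<delta>\<close> over its square.\<close>

lemma poisson_le_dyadic:
  assumes z: "z \<in> stolz \<alpha> (cis t)" and st: "\<bar>s - t\<bar> \<le> pi" and \<alpha>: "\<alpha> > 1"
  defines "\<delta> \<equiv> 1 - norm z"
  obtains k :: nat where "\<bar>s - t\<bar> \<le> 2 ^ k * (3 * (1 + \<alpha>) * \<delta>)" "poisson z (cis s) \<le> 8 / (\<delta> * 4 ^ k)"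
proof -
  define B where "B = 3 * (1 + \<alpha>)"
  define n where "n = norm (cis s - z)"
  have \<delta>: "\<delta> > 0" and zn: "norm z < 1" and zt: "norm (z - cis t) < \<alpha> * \<delta>"
    using z by (auto simp: stolz_def \<delta>_def dist_norm)
  have B: "B > 0" using \<alpha> by (simp add: B_def)
  have n1: "\<delta> \<le> n" unfolding \<delta>_def n_def using norm_triangle_ineq2[of "cis s" z] by simp
  have "norm (cis s - cis t) \<le> n + norm (z - cis t)"
    unfolding n_def using norm_triangle_ineq[of "cis s - z" "z - cis t"] by simp
  also have "\<dots> \<le> n + \<alpha> * n"
  proof -
    have "\<alpha> * \<delta> \<le> \<alpha> * n" using n1 \<alpha> by (intro mult_left_mono) auto
    then show ?thesis using zt by linarith
  qed
  finally have "3 * norm (cis s - cis t) \<le> B * n" by (simp add: B_def algebra_simps)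
  with jordan_chord[OF st] have n2: "\<bar>s - t\<bar> \<le> B * n" by linarith
  have P: "poisson z (cis s) \<le> 2 * \<delta> / n\<^sup>2"
  proof -
    have "1 - (norm z)\<^sup>2 = \<delta> * (1 + norm z)" by (simp add: \<delta>_def power2_eq_square algebra_simps)
    also have "\<dots> \<le> \<delta> * 2" using zn \<delta> by (intro mult_left_mono) auto
    finally show ?thesis unfolding poisson_def n_def by (intro divide_right_mono) auto
  qed
  have ex: "\<exists>k::nat. \<bar>s - t\<bar> \<le> 2 ^ k * (B * \<delta>)"
  proof -
    obtain k :: nat where "\<bar>s - t\<bar> / (B * \<delta>) < 2 ^ k" using real_arch_pow[of 2] by auto
    then show ?thesis using B \<delta> by (intro exI[of _ k]) (simp add: field_simps)
  qed
  define k where "k = (LEAST k::nat. \<bar>s - t\<bar> \<le> 2 ^ k * (B * \<delta>))"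
  have k: "\<bar>s - t\<bar> \<le> 2 ^ k * (B * \<delta>)" unfolding k_def by (rule LeastI_ex[OF ex])
  have low: "2 ^ k * \<delta> \<le> 2 * n"
  proof (cases k)
    case 0
    then show ?thesis using n1 \<delta> by simp
  next
    case (Suc j)
    then have "\<not> \<bar>s - t\<bar> \<le> 2 ^ j * (B * \<delta>)" using not_less_Least[of j "\<lambda>k. \<bar>s - t\<bar> \<le> 2 ^ k * (B * \<delta>)"] unfolding k_def[symmetric] by simp
    then have "B * (2 ^ j * \<delta>) < B * n" using n2 by (simp add: mult_ac)
    then show ?thesis using B Suc by simp
  qed
  have "2 * \<delta> / n\<^sup>2 \<le> 2 * \<delta> / (2 ^ k * \<delta> / 2)\<^sup>2"
    using low \<delta> n1 by (intro divide_left_mono power_mono) (auto intro!: mult_pos_pos)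
  also have "\<dots> = 8 / (\<delta> * 4 ^ k)"
  proof -
    have "(2 ^ k)\<^sup>2 = (4::real) ^ k" by (simp add: power2_eq_square power_mult_distrib[symmetric])
    then show ?thesis using \<delta> by (simp add: power_mult_distrib power_divide power2_eq_square field_simps)
  qed
  finally show thesis using that[of k] k P by (simp add: B_def)
qed

text \<open>The Poisson kernel is dominated by a sum of multiples of indicators of dyadic intervals
  about \<open>t\<close>. The heights decay like 4^-k while the lengths grow like 2^k, so the
  averages are summed with geometric weights: 24 (1 + \<alpha>) A times the sum 2.\<close>

lemma poisson_integral_le_maximal:
  fixes u :: "real \<Rightarrow> ennreal"
  assumes [measurable]: "u \<in> borel_measurable borel" and A: "A \<ge> 0" and \<alpha>: "\<alpha> > 1"
    and max: "\<And>s. s > 0 \<Longrightarrow> (\<integral>\<^sup>+x\<in>cball t s. u x \<partial>lborel) \<le> ennreal (A * s)"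
    and z: "z \<in> stolz \<alpha> (cis t)"
  shows "(\<integral>\<^sup>+s\<in>{t-pi..<t+pi}. u s * ennreal (poisson z (cis s)) \<partial>lborel) \<le> ennreal (48 * (1 + \<alpha>) * A)"
proof -
  define \<delta> where "\<delta> = 1 - norm z"
  have [measurable]: "cball t s \<in> sets borel" for s by simp
  define \<rho> where "\<rho> k = 2 ^ k * (3 * (1 + \<alpha>) * \<delta>)" for k :: nat
  have \<delta>: "\<delta> > 0" using z by (auto simp: stolz_def \<delta>_def)
  have \<rho>: "\<rho> k > 0" for k using \<delta> \<alpha> by (simp add: \<rho>_def)
  have "(\<integral>\<^sup>+s\<in>{t-pi..<t+pi}. u s * ennreal (poisson z (cis s)) \<partial>lborel)
     \<le> (\<integral>\<^sup>+s. (\<Sum>k. ennreal (8 / (\<delta> * 4 ^ k)) * (u s * indicator (cball t (\<rho> k)) s)) \<partial>lborel)"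
  proof (rule nn_integral_mono)
    fix s :: real
    show "u s * ennreal (poisson z (cis s)) * indicator {t - pi..<t + pi} s
       \<le> (\<Sum>k. ennreal (8 / (\<delta> * 4 ^ k)) * (u s * indicator (cball t (\<rho> k)) s))"
    proof (cases "s \<in> {t - pi..<t + pi}")
      case True
      then have "\<bar>s - t\<bar> \<le> pi" by auto
      then obtain k where k: "\<bar>s - t\<bar> \<le> \<rho> k" "poisson z (cis s) \<le> 8 / (\<delta> * 4 ^ k)"
        using poisson_le_dyadic[OF z _ \<alpha>] unfolding \<rho>_def \<delta>_def by blast
      have "u s * ennreal (poisson z (cis s)) * indicator {t - pi..<t + pi} s
         \<le> ennreal (8 / (\<delta> * 4 ^ k)) * u s"
        using True k(2) by (subst mult.commute) (auto simp: mult.commute[of "u s"] intro!: mult_right_mono ennreal_leI)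
      also have "\<dots> = ennreal (8 / (\<delta> * 4 ^ k)) * (u s * indicator (cball t (\<rho> k)) s)"
        using k(1) by (simp add: dist_real_def abs_minus_commute)
      also have "\<dots> = (\<Sum>j\<in>{k}. ennreal (8 / (\<delta> * 4 ^ j)) * (u s * indicator (cball t (\<rho> j)) s))" by simp
      also have "\<dots> \<le> (\<Sum>j. ennreal (8 / (\<delta> * 4 ^ j)) * (u s * indicator (cball t (\<rho> j)) s))"
        by (rule sum_le_suminf) auto
      finally show ?thesis .
    qed simp
  qed
  also have "\<dots> = (\<Sum>k. ennreal (8 / (\<delta> * 4 ^ k)) * (\<integral>\<^sup>+s\<in>cball t (\<rho> k). u s \<partial>lborel))"
    by (subst nn_integral_suminf) (auto simp: nn_integral_cmult)
  also have "\<dots> \<le> (\<Sum>k. ennreal (8 / (\<delta> * 4 ^ k)) * ennreal (A * \<rho> k))"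
    by (intro suminf_le mult_left_mono max \<rho>) auto
  also have "\<dots> = (\<Sum>k. ennreal (24 * (1 + \<alpha>) * A * (1 / 2) ^ k))"
  proof (intro suminf_cong)
    fix k :: nat
    have "8 / (\<delta> * 4 ^ k) * (A * \<rho> k) = 24 * (1 + \<alpha>) * A * (1 / 2) ^ k"
    proof -
      have "(4::real) ^ k = 2 ^ k * 2 ^ k" by (simp add: power_mult_distrib[symmetric])
      then show ?thesis using \<delta> by (simp add: \<rho>_def field_simps)
    qed
    then show "ennreal (8 / (\<delta> * 4 ^ k)) * ennreal (A * \<rho> k) = ennreal (24 * (1 + \<alpha>) * A * (1 / 2) ^ k)"
      using \<delta> A \<rho>[of k] by (subst ennreal_mult[symmetric]) auto
  qed
  also have "\<dots> = ennreal (\<Sum>k. 24 * (1 + \<alpha>) * A * (1 / 2) ^ k)"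
    by (rule suminf_ennreal2) (use A \<alpha> in \<open>auto intro!: summable_mult summable_geometric\<close>)
  also have "(\<Sum>k. 24 * (1 + \<alpha>) * A * (1 / 2) ^ k) = 24 * (1 + \<alpha>) * A * (\<Sum>k. (1 / 2) ^ k)"
    by (rule suminf_mult) (auto intro!: summable_geometric)
  also have "(\<Sum>k. (1 / 2 :: real) ^ k) = 2" by (subst suminf_geometric) auto
  finally show ?thesis by (simp add: mult_ac)
qed

text \<open>For fixed \<open>z\<close> the condition on \<open>\<zeta>\<close> is an open one,
  whatever \<open>P\<close> is. The measurability of the sets of bad boundary points rests on
  this.\<close>

lemma open_stolz_set:
  "open {\<zeta>. \<exists>z\<in>stolz \<alpha> \<zeta>. P z}"
proof -
  have "{\<zeta>. \<exists>z\<in>stolz \<alpha> \<zeta>. P z} = (\<Union>z\<in>{z \<in> unit_disc. P z}. {\<zeta>. dist z \<zeta> < \<alpha> * (1 - norm z)})"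
    by (auto simp: stolz_def)
  also have "open \<dots>" by (intro open_UN ballI open_Collect_less continuous_intros)
  finally show ?thesis .
qed

text \<open>|h|^2 is subharmonic, hence below the Poisson integral of its boundary values, which in
  turn is controlled by averages over intervals. \<open>A\<close> is chosen such that this Poisson
  integral is at most \<open>l\<close> in the Stolz regions at points off \<open>W\<close>.\<close>

lemma nontangential_maximal_weak_type:
  assumes hol: "h holomorphic_on ball 0 R" and R: "R > 1" and \<alpha>: "\<alpha> > 1" and l: "l > 0"
  shows "emeasure circ {t. \<exists>z\<in>stolz \<alpha> (cis t). l < (norm (h z))\<^sup>2}
    \<le> ennreal (960 * (1 + \<alpha>) / l) * (\<integral>\<^sup>+t. ennreal ((norm (h (cis t)))\<^sup>2) \<partial>circ)"
proof (cases "(\<integral>\<^sup>+t. ennreal ((norm (h (cis t)))\<^sup>2) \<partial>circ) = \<infinity>")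
  case True
  have "ennreal (960 * (1 + \<alpha>) / l) * \<infinity> = \<infinity>" using \<alpha> l by (simp add: ennreal_mult_eq_top_iff)
  then show ?thesis unfolding True by simp
next
  case False
  define G where "G = {t. \<exists>z\<in>stolz \<alpha> (cis t). l < (norm (h z))\<^sup>2}"
  \<comment> \<open>Extended by 0 off the circle, the square becomes a Borel function on the whole
    plane, as the transfer to angles requires.\<close>
  define v where "v \<xi> = (if norm \<xi> = 1 then ennreal ((norm (h \<xi>))\<^sup>2) else 0)" for \<xi>
  have hcont: "continuous_on (sphere 0 1) (\<lambda>\<xi>. (norm (h \<xi>))\<^sup>2)"
    by (intro continuous_intros holomorphic_on_imp_continuous_on holomorphic_on_subset[OF hol]) (use R in auto)
  have [measurable]: "(\<lambda>\<xi>. if norm \<xi> = 1 then (norm (h \<xi>))\<^sup>2 else 0) \<in> borel_measurable borel"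
  proof -
    have "(\<lambda>\<xi>. if \<xi> \<in> sphere 0 1 then (norm (h \<xi>))\<^sup>2 else 0) \<in> borel_measurable borel"
      using hcont by (intro borel_measurable_continuous_on_if) auto
    then show ?thesis by simp
  qed
  have veq: "v = (\<lambda>\<xi>. ennreal (if norm \<xi> = 1 then (norm (h \<xi>))\<^sup>2 else 0))" by (auto simp: v_def)
  have vm [measurable]: "v \<in> borel_measurable borel" unfolding veq by measurable
  define I where "I = (\<integral>\<^sup>+t. v (cis t) \<partial>circ)"
  have Ieq: "I = (\<integral>\<^sup>+t. ennreal ((norm (h (cis t)))\<^sup>2) \<partial>circ)" by (simp add: I_def v_def)
  have I: "I < \<infinity>" using False Ieq by (simp add: top.not_eq_extremum)
  have per: "(\<integral>\<^sup>+s\<in>{c..<c+2*pi}. v (cis s) \<partial>lborel) = ennreal (2 * pi) * I" for c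
  proof -
    let ?X = "\<integral>\<^sup>+s\<in>{c..<c+2*pi}. v (cis s) \<partial>lborel"
    have "ennreal (2 * pi) * (?X / ennreal (2 * pi)) = ?X * ennreal (2 * pi) / ennreal (2 * pi)"
      by (simp only: ennreal_times_divide mult.commute)
    also have "\<dots> = ?X" by (rule mult_divide_eq_ennreal) auto
    finally show ?thesis by (simp only: I_def nn_integral_circ_from[OF vm, of c])
  qed
  \<comment> \<open>Two periods: every \<open>t\<close> in \<open>{0..<2*pi}\<close> sees its whole
    interval from \<open>t - pi\<close> to \<open>t + pi\<close>, and the total mass stays
    finite.\<close>
  define u where "u s = v (cis s) * indicator {-pi..<3*pi} s" for s
  have [measurable]: "u \<in> borel_measurable borel" unfolding u_def by measurable
  have "(\<integral>\<^sup>+s. u s \<partial>lborel) = (\<integral>\<^sup>+s. v (cis s) * indicator {-pi..<-pi+2*pi} s + v (cis s) * indicator {pi..<pi+2*pi} s \<partial>lborel)"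
    unfolding u_def by (intro nn_integral_cong) (auto simp: indicator_def)
  also have "\<dots> = (\<integral>\<^sup>+s\<in>{-pi..<-pi+2*pi}. v (cis s) \<partial>lborel) + (\<integral>\<^sup>+s\<in>{pi..<pi+2*pi}. v (cis s) \<partial>lborel)"
    by (rule nn_integral_add) measurable
  also have "\<dots> = ennreal (2 * pi) * I + ennreal (2 * pi) * I" by (simp only: per)
  also have "\<dots> = ennreal (4 * pi) * I"
    by (simp add: distrib_right[symmetric] ennreal_plus[symmetric] del: ennreal_plus)
  finally have uI: "(\<integral>\<^sup>+s. u s \<partial>lborel) = ennreal (4 * pi) * I" .
  define A where "A = 2 * pi * l / (48 * (1 + \<alpha>))"
  have A: "A > 0" using l \<alpha> by (simp add: A_def)
  have "(\<integral>\<^sup>+s. u s \<partial>lborel) < \<infinity>" unfolding uI using I by (simp add: ennreal_mult_less_top)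
  then obtain W where W: "open W" "emeasure lborel W \<le> ennreal (10 / A) * (\<integral>\<^sup>+x. u x \<partial>lborel)"
    and Wmax: "\<And>t s. s > 0 \<Longrightarrow> t \<notin> W \<Longrightarrow> (\<integral>\<^sup>+x\<in>cball t s. u x \<partial>lborel) \<le> ennreal (A * s)"
    using weak_type_maximal[of u A] A by auto
  have GW: "t \<in> W" if t: "t \<in> {0..<2*pi}" "t \<in> G" for t
  proof (rule ccontr)
    assume tW: "t \<notin> W"
    obtain z where z: "z \<in> stolz \<alpha> (cis t)" and big: "l < (norm (h z))\<^sup>2" using t by (auto simp: G_def)
    have zn: "norm z < 1" using z by (simp add: stolz_def)
    have "ennreal ((norm (h z))\<^sup>2) = ennreal (norm ((h z)\<^sup>2))" by (simp add: norm_power)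
    also have "\<dots> \<le> (\<integral>\<^sup>+s. ennreal (norm ((h (cis s))\<^sup>2) * poisson z (cis s)) \<partial>circ)"
      by (rule subharmonic_poisson[OF _ R zn]) (intro holomorphic_intros hol)
    also have "\<dots> = (\<integral>\<^sup>+s. v (cis s) * ennreal (poisson z (cis s)) \<partial>circ)"
      using poisson_nonneg[of z] zn by (intro nn_integral_cong) (auto simp: v_def norm_power ennreal_mult)
    also have "\<dots> = (\<integral>\<^sup>+s\<in>{t-pi..<(t-pi)+2*pi}. v (cis s) * ennreal (poisson z (cis s)) \<partial>lborel) / ennreal (2 * pi)"
      by (rule nn_integral_circ_from[where f = "\<lambda>\<xi>. v \<xi> * ennreal (poisson z \<xi>)"]) simp
    also have "(\<integral>\<^sup>+s\<in>{t-pi..<(t-pi)+2*pi}. v (cis s) * ennreal (poisson z (cis s)) \<partial>lborel)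
        = (\<integral>\<^sup>+s\<in>{t-pi..<t+pi}. u s * ennreal (poisson z (cis s)) \<partial>lborel)"
      using t by (intro nn_integral_cong) (auto simp: u_def indicator_def)
    also have "\<dots> \<le> ennreal (48 * (1 + \<alpha>) * A)"
      by (rule poisson_integral_le_maximal[OF _ _ \<alpha> Wmax z]) (use A tW in auto)
    finally have "ennreal ((norm (h z))\<^sup>2) \<le> ennreal (48 * (1 + \<alpha>) * A) / ennreal (2 * pi)"
      by (simp add: divide_right_mono_ennreal)
    also have "\<dots> = ennreal (48 * (1 + \<alpha>) * A / (2 * pi))"
      using A \<alpha> by (intro divide_ennreal) auto
    also have "48 * (1 + \<alpha>) * A / (2 * pi) = l" using \<alpha> by (simp add: A_def)
    finally show False using big l by (simp add: ennreal_le_iff)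
  qed
  have "open G"
  proof -
    have "G = cis -` {\<zeta>. \<exists>z\<in>stolz \<alpha> \<zeta>. l < (norm (h z))\<^sup>2}" by (auto simp: G_def)
    also have "open \<dots>" by (intro open_vimage open_stolz_set continuous_on_cis continuous_on_id)
    finally show ?thesis .
  qed
  then have [measurable]: "G \<in> sets borel" "W \<in> sets borel" using W by auto
  have "emeasure circ G = (\<integral>\<^sup>+t. indicator G t \<partial>circ)" by simp
  also have "\<dots> = (\<integral>\<^sup>+t\<in>{0..<2*pi}. indicator G t \<partial>lborel) / ennreal (2 * pi)"
    by (rule nn_integral_circ) simp
  also have "\<dots> \<le> (\<integral>\<^sup>+t. indicator W t \<partial>lborel) / ennreal (2 * pi)"
    by (intro divide_right_mono_ennreal nn_integral_mono) (use GW in \<open>auto simp: indicator_def\<close>)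
  also have "\<dots> = emeasure lborel W / ennreal (2 * pi)" by simp
  also have "\<dots> \<le> (ennreal (10 / A) * (ennreal (4 * pi) * I)) / ennreal (2 * pi)"
    using W(2) unfolding uI by (rule divide_right_mono_ennreal)
  also have "\<dots> = (ennreal (10 / A) * ennreal (4 * pi) / ennreal (2 * pi)) * I"
    by (simp add: ennreal_times_divide mult_ac)
  also have "ennreal (10 / A) * ennreal (4 * pi) / ennreal (2 * pi) = ennreal (10 / A * (4 * pi) / (2 * pi))"
    using A by (simp add: divide_ennreal ennreal_mult[symmetric])
  also have "10 / A * (4 * pi) / (2 * pi) = 480 * (1 + \<alpha>) / (pi * l)" using \<alpha> l by (simp add: A_def field_simps)
  also have "ennreal (480 * (1 + \<alpha>) / (pi * l)) * I \<le> ennreal (960 * (1 + \<alpha>) / l) * I"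
  proof (intro mult_right_mono ennreal_leI)
    have "480 * (1 + \<alpha>) / (pi * l) \<le> 480 * (1 + \<alpha>) / (1 * l)"
      using pi_ge_two \<alpha> l by (intro divide_left_mono mult_right_mono) auto
    also have "\<dots> \<le> 960 * (1 + \<alpha>) / l" using \<alpha> l by (simp add: divide_right_mono)
    finally show "480 * (1 + \<alpha>) / (pi * l) \<le> 960 * (1 + \<alpha>) / l" .
  qed auto
  finally show ?thesis unfolding Ieq G_def .
qed


section \<open>Parseval's identity and the tails of Taylor series\<close>

lemma integral_cis_power:
  "(\<integral>t. cis t ^ n * cnj (cis t ^ m) \<partial>circ) = (if n = m then 1 else 0)"
proof -
  have eq: "cis t ^ n * cnj (cis t ^ m) = cis ((real n - real m) * t)" for t
  proof -
    have "cis t ^ n * cnj (cis t ^ m) = cis (real n * t + real m * (- t))"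
      by (simp only: complex_cnj_power cis_cnj Complex.DeMoivre cis_mult mult_minus_right)
    also have "real n * t + real m * (- t) = (real n - real m) * t" by (simp add: algebra_simps)
    finally show ?thesis .
  qed
  have "integral {0..2*pi} (\<lambda>t. cis ((real n - real m) * t)) = (if n = m then 2 * pi else 0)"
  proof (cases "n = m")
    case True
    then show ?thesis by (simp add: scaleR_conv_of_real)
  next
    case False
    define k where "k = real n - real m"
    have k: "k \<noteq> 0" using False by (simp add: k_def)
    have "((\<lambda>t. cis (k * t)) has_integral cis (k * (2 * pi)) / (\<i> * of_real k) - cis (k * 0) / (\<i> * of_real k)) {0..2*pi}"
    proof (rule fundamental_theorem_of_calculus)
      fix t :: real
      have "((\<lambda>z. exp (\<i> * of_real k * z) / (\<i> * of_real k)) has_field_derivative exp (\<i> * of_real k * of_real t)) (at (of_real t))"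
        using k by (auto intro!: derivative_eq_intros)
      from has_vector_derivative_real_field[OF this]
      show "((\<lambda>t. cis (k * t) / (\<i> * of_real k)) has_vector_derivative cis (k * t)) (at t within {0..2*pi})"
        by (simp add: cis_conv_exp mult.assoc)
    qed simp
    moreover have "cis (k * (2 * pi)) = 1"
    proof -
      have "cis (k * (2 * pi)) = cis (2 * pi * real_of_int (int n - int m))" by (simp add: k_def mult_ac)
      also have "\<dots> = 1" by (rule cis_multiple_2pi) simp
      finally show ?thesis .
    qed
    ultimately have "((\<lambda>t. cis (k * t)) has_integral 0) {0..2*pi}" by simp
    then show ?thesis using False by (simp add: k_def integral_unique)
  qed
  then show ?thesis unfolding eq
    by (subst integral_circ) (auto intro!: continuous_intros continuous_on_cis)
qed

lemma parseval_finite: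
  assumes "finite S"
  shows "(\<integral>\<^sup>+t. ennreal ((norm (\<Sum>n\<in>S. b n * cis t ^ n))\<^sup>2) \<partial>circ) = ennreal (\<Sum>n\<in>S. (norm (b n))\<^sup>2)"
proof -
  let ?p = "\<lambda>t. \<Sum>n\<in>S. b n * cis t ^ n"
  have intg: "integrable circ (\<lambda>t. cis t ^ n * cnj (cis t ^ m))" for n m
  proof (rule circ.integrable_const_bound[of _ 1])
    have "(\<lambda>t. cis t ^ n * cnj (cis t ^ m)) \<in> borel_measurable borel"
      by (intro borel_measurable_continuous_onI continuous_intros continuous_on_cis)
    then show "(\<lambda>t. cis t ^ n * cnj (cis t ^ m)) \<in> borel_measurable circ" by simp
  qed (simp add: norm_mult norm_power)
  have "complex_of_real (\<integral>t. (norm (?p t))\<^sup>2 \<partial>circ) = (\<integral>t. complex_of_real ((norm (?p t))\<^sup>2) \<partial>circ)"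
    by (rule integral_complex_of_real[symmetric])
  also have "\<dots> = (\<integral>t. (\<Sum>n\<in>S. \<Sum>m\<in>S. b n * cnj (b m) * (cis t ^ n * cnj (cis t ^ m))) \<partial>circ)"
    by (intro Bochner_Integration.integral_cong) (auto simp only: complex_norm_square cnj_sum sum_product complex_cnj_mult mult_ac)
  also have "\<dots> = (\<Sum>n\<in>S. \<Sum>m\<in>S. b n * cnj (b m) * (if n = m then 1 else 0))"
    by (simp add: Bochner_Integration.integral_sum intg integral_cis_power del: complex_cnj_power)
  also have "\<dots> = (\<Sum>n\<in>S. b n * cnj (b n))"
    using assms by (intro sum.cong) (auto simp: if_distrib[of "\<lambda>x. _ * x"] cong: if_cong)
  also have "\<dots> = complex_of_real (\<Sum>n\<in>S. (norm (b n))\<^sup>2)" by (simp only: of_real_sum complex_norm_square)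
  finally have eq: "(\<integral>t. (norm (?p t))\<^sup>2 \<partial>circ) = (\<Sum>n\<in>S. (norm (b n))\<^sup>2)" by (simp only: of_real_eq_iff)
  have bd: "norm (?p t) \<le> (\<Sum>n\<in>S. norm (b n))" for t
    by (rule order_trans[OF norm_sum]) (simp add: norm_mult norm_power)
  have "integrable circ (\<lambda>t. (norm (?p t))\<^sup>2)"
    by (rule circ.integrable_const_bound[of _ "(\<Sum>n\<in>S. norm (b n))\<^sup>2"]) (auto intro!: AE_I2 power_mono bd)
  then show ?thesis using eq by (subst nn_integral_eq_integral) auto
qed

text \<open>Parseval on the circle of radius \<open>r\<close>, followed by \<open>r\<close> tending
  to 1, shows that the squared Taylor coefficients are summable; \<open>p\<close> is a Taylor
  polynomial beyond which their sum is below \<open>e\<close>. The point is that one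
  \<open>p\<close> serves all \<open>r < 1\<close> at once.\<close>

lemma taylor_tail_L2:
  assumes hol: "f holomorphic_on unit_disc" and bd: "\<And>z. z \<in> unit_disc \<Longrightarrow> norm (f z) \<le> 1" and e: "e > 0"
  obtains p where "p holomorphic_on UNIV"
    "\<And>r. 0 \<le> r \<Longrightarrow> r < 1 \<Longrightarrow> (\<integral>\<^sup>+t. ennreal ((norm (f (of_real r * cis t) - p (of_real r * cis t)))\<^sup>2) \<partial>circ) \<le> ennreal e"
proof -
  define a where "a n = (deriv ^^ n) f 0 / fact n" for n
  have sums: "(\<lambda>n. a n * z ^ n) sums f z" if "norm z < 1" for z
    using holomorphic_power_series[OF hol, of z] that by (simp add: a_def)
  have abs: "summable (\<lambda>n. norm (a n) * r ^ n)" if "0 \<le> r" "r < 1" for r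
  proof -
    define x where "x = (r + 1) / 2"
    have "summable (\<lambda>n. norm (a n * of_real r ^ n))"
      using sums[of "of_real x"] that by (intro powser_insidea[of _ "of_real x"]) (auto simp: x_def sums_iff)
    then show ?thesis using that by (simp add: norm_mult norm_power)
  qed
  have norm_part: "norm (\<Sum>n\<in>{..<M}. a n * of_real r ^ n * cis t ^ n) \<le> (\<Sum>n. norm (a n) * r ^ n)"
    if r: "0 \<le> r" "r < 1" for M r t
  proof -
    have "norm (\<Sum>n\<in>{..<M}. a n * of_real r ^ n * cis t ^ n) \<le> (\<Sum>n\<in>{..<M}. norm (a n) * r ^ n)"
      by (rule order_trans[OF norm_sum]) (use r in \<open>simp add: norm_mult norm_power\<close>)
    also have "\<dots> \<le> (\<Sum>n. norm (a n) * r ^ n)"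
      by (rule sum_le_suminf[OF abs[OF r]]) (use r in auto)
    finally show ?thesis .
  qed
  have part_lim: "(\<lambda>M. \<Sum>n\<in>{..<M}. a n * of_real r ^ n * cis t ^ n) \<longlonglongrightarrow> f (of_real r * cis t)"
    if r: "0 \<le> r" "r < 1" for r t
    using sums[of "of_real r * cis t"] r by (simp add: sums_def norm_mult power_mult_distrib mult_ac)
  have bessel_r: "(\<Sum>n<M. (norm (a n))\<^sup>2 * r ^ (2 * n)) \<le> 1" if r: "0 \<le> r" "r < 1" for M r
  proof -
    have pars: "(\<integral>\<^sup>+t. ennreal ((norm (\<Sum>n\<in>{..<M}. a n * of_real r ^ n * cis t ^ n))\<^sup>2) \<partial>circ)
       = ennreal (\<Sum>n<M. (norm (a n))\<^sup>2 * r ^ (2 * n))" for M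
      using r by (subst parseval_finite) (auto simp: norm_mult norm_power power_mult_distrib power_mult[symmetric] mult.commute)
    define B where "B = (\<Sum>n. norm (a n) * r ^ n)"
    have "(\<lambda>M. \<integral>\<^sup>+t. ennreal ((norm (\<Sum>n\<in>{..<M}. a n * of_real r ^ n * cis t ^ n))\<^sup>2) \<partial>circ)
       \<longlonglongrightarrow> (\<integral>\<^sup>+t. ennreal ((norm (f (of_real r * cis t)))\<^sup>2) \<partial>circ)"
    proof (rule nn_integral_dominated_convergence[where w = "\<lambda>_. ennreal (B\<^sup>2)"])
      show "(\<lambda>t. ennreal ((norm (f (of_real r * cis t)))\<^sup>2)) \<in> borel_measurable circ"
      proof -
        have "continuous_on UNIV (\<lambda>t. f (of_real r * cis t))"
          by (intro continuous_on_compose2[OF holomorphic_on_imp_continuous_on[OF hol]] continuous_intros continuous_on_cis)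
            (use r in \<open>auto simp: norm_mult\<close>)
        then have [measurable]: "(\<lambda>t. f (of_real r * cis t)) \<in> borel_measurable borel" by (rule borel_measurable_continuous_onI)
        show ?thesis by measurable
      qed
      show "AE t in circ. ennreal ((norm (\<Sum>n\<in>{..<M}. a n * of_real r ^ n * cis t ^ n))\<^sup>2) \<le> ennreal (B\<^sup>2)" for M
        using norm_part[OF r] by (intro AE_I2 ennreal_leI power_mono) (auto simp: B_def)
      show "AE t in circ. (\<lambda>M. ennreal ((norm (\<Sum>n\<in>{..<M}. a n * of_real r ^ n * cis t ^ n))\<^sup>2)) \<longlonglongrightarrow> ennreal ((norm (f (of_real r * cis t)))\<^sup>2)"
        by (intro AE_I2 tendsto_intros part_lim r)
      show "(\<integral>\<^sup>+t. ennreal (B\<^sup>2) \<partial>circ) < \<infinity>" by (simp add: circ.emeasure_space_1)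
    qed auto
    then have lim: "(\<lambda>M. ennreal (\<Sum>n<M. (norm (a n))\<^sup>2 * r ^ (2 * n))) \<longlonglongrightarrow> (\<integral>\<^sup>+t. ennreal ((norm (f (of_real r * cis t)))\<^sup>2) \<partial>circ)"
      unfolding pars .
    have "ennreal (\<Sum>n<M. (norm (a n))\<^sup>2 * r ^ (2 * n)) \<le> (\<integral>\<^sup>+t. ennreal ((norm (f (of_real r * cis t)))\<^sup>2) \<partial>circ)"
      by (rule incseq_le[OF _ lim]) (use r in \<open>auto intro!: incseq_SucI ennreal_leI\<close>)
    also have "\<dots> \<le> (\<integral>\<^sup>+t. 1 \<partial>circ)"
    proof (rule nn_integral_mono)
      fix t
      have "norm (f (of_real r * cis t)) \<le> 1" using bd[of "of_real r * cis t"] r by (simp add: norm_mult)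
      then show "ennreal ((norm (f (of_real r * cis t)))\<^sup>2) \<le> 1" by (simp add: power_le_one ennreal_le_1)
    qed
    finally show ?thesis by (simp add: circ.emeasure_space_1 ennreal_le_1)
  qed
  have bessel: "(\<Sum>n<M. (norm (a n))\<^sup>2) \<le> 1" for M
  proof (rule tendsto_upperbound)
    have "((\<lambda>r. \<Sum>n<M. (norm (a n))\<^sup>2 * r ^ (2 * n)) \<longlongrightarrow> (\<Sum>n<M. (norm (a n))\<^sup>2 * 1 ^ (2 * n))) (at_left (1::real))"
      by (intro tendsto_intros)
    then show "((\<lambda>r. \<Sum>n<M. (norm (a n))\<^sup>2 * r ^ (2 * n)) \<longlongrightarrow> (\<Sum>n<M. (norm (a n))\<^sup>2)) (at_left (1::real))" by simp
    show "\<forall>\<^sub>F r in at_left (1::real). (\<Sum>n<M. (norm (a n))\<^sup>2 * r ^ (2 * n)) \<le> 1"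
      by (rule eventually_at_leftI[of 0]) (use bessel_r in auto)
  qed simp
  have sq: "summable (\<lambda>n. (norm (a n))\<^sup>2)"
    by (rule summableI_nonneg_bounded[of _ 1]) (use bessel in auto)
  obtain N where N: "(\<Sum>n. (norm (a (n + N)))\<^sup>2) < e"
  proof -
    obtain N where "norm (\<Sum>n. (norm (a (n + N)))\<^sup>2) < e"
      using suminf_exist_split[OF e sq] by blast
    then show thesis using that[of N] by simp
  qed
  define p where "p z = (\<Sum>n<N. a n * z ^ n)" for z
  show thesis
  proof (rule that[of p])
    show "p holomorphic_on UNIV" unfolding p_def by (intro holomorphic_intros)
    fix r :: real assume r: "0 \<le> r" "r < 1"
    let ?q = "\<lambda>M t. \<Sum>n\<in>{N..<M}. a n * of_real r ^ n * cis t ^ n"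
    have lim: "(\<lambda>M. ?q M t) \<longlonglongrightarrow> f (of_real r * cis t) - p (of_real r * cis t)" for t
    proof -
      have "(\<lambda>M. (\<Sum>n\<in>{..<M}. a n * of_real r ^ n * cis t ^ n) - p (of_real r * cis t))
          \<longlonglongrightarrow> f (of_real r * cis t) - p (of_real r * cis t)"
        by (intro tendsto_intros part_lim r)
      moreover have "\<forall>\<^sub>F M in sequentially. (\<Sum>n\<in>{..<M}. a n * of_real r ^ n * cis t ^ n) - p (of_real r * cis t) = ?q M t"
        using eventually_ge_at_top[of N]
      proof eventually_elim
        case (elim M)
        have "{..<M} = {..<N} \<union> {N..<M}" using elim by auto
        then have "(\<Sum>n\<in>{..<M}. a n * of_real r ^ n * cis t ^ n)
           = (\<Sum>n\<in>{..<N}. a n * of_real r ^ n * cis t ^ n) + ?q M t"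
          by (simp add: sum.union_disjoint ivl_disj_int)
        then show ?case by (simp add: p_def power_mult_distrib mult_ac)
      qed
      ultimately show ?thesis by (rule Lim_transform_eventually)
    qed
    have "(\<integral>\<^sup>+t. ennreal ((norm (f (of_real r * cis t) - p (of_real r * cis t)))\<^sup>2) \<partial>circ)
       = (\<integral>\<^sup>+t. liminf (\<lambda>M. ennreal ((norm (?q M t))\<^sup>2)) \<partial>circ)"
      by (intro nn_integral_cong lim_imp_Liminf[symmetric] tendsto_intros lim) simp
    also have "\<dots> \<le> liminf (\<lambda>M. \<integral>\<^sup>+t. ennreal ((norm (?q M t))\<^sup>2) \<partial>circ)"
      by (rule nn_integral_liminf) simp
    also have "\<dots> \<le> liminf (\<lambda>M. ennreal e)"
    proof (intro Liminf_mono always_eventually allI)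
      fix M
      have "(\<integral>\<^sup>+t. ennreal ((norm (?q M t))\<^sup>2) \<partial>circ) = ennreal (\<Sum>n\<in>{N..<M}. (norm (a n * of_real r ^ n))\<^sup>2)"
        by (rule parseval_finite) simp
      also have "\<dots> \<le> ennreal e"
      proof (rule ennreal_leI)
        have "(\<Sum>n\<in>{N..<M}. (norm (a n * of_real r ^ n))\<^sup>2) \<le> (\<Sum>n\<in>{N..<M}. (norm (a n))\<^sup>2)"
        proof (rule sum_mono)
          fix n
          have "norm (a n * of_real r ^ n) \<le> norm (a n) * 1"
            unfolding norm_mult norm_power using r by (intro mult_left_mono) (auto simp: power_le_one)
          then show "(norm (a n * of_real r ^ n))\<^sup>2 \<le> (norm (a n))\<^sup>2" by (intro power_mono) auto
        qed
        also have "\<dots> = (\<Sum>n\<in>{..<M-N}. (norm (a (n + N)))\<^sup>2)"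
          by (rule sum.reindex_bij_witness[of _ "\<lambda>n. n + N" "\<lambda>n. n - N"]) auto
        also have "\<dots> \<le> (\<Sum>n. (norm (a (n + N)))\<^sup>2)"
          by (rule sum_le_suminf) (use sq summable_iff_shift[of "\<lambda>n. (norm (a n))\<^sup>2" N] in auto)
        also have "\<dots> \<le> e" using N by simp
        finally show "(\<Sum>n\<in>{N..<M}. (norm (a n * of_real r ^ n))\<^sup>2) \<le> e" .
      qed
      finally show "(\<integral>\<^sup>+t. ennreal ((norm (?q M t))\<^sup>2) \<partial>circ) \<le> ennreal e" .
    qed
    also have "\<dots> = ennreal e" by (simp add: Liminf_const)
    finally show "(\<integral>\<^sup>+t. ennreal ((norm (f (of_real r * cis t) - p (of_real r * cis t)))\<^sup>2) \<partial>circ) \<le> ennreal e" .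
  qed
qed


lemma holomorphic_on_dilation:
  assumes "f holomorphic_on unit_disc" "0 < r"
  shows "(\<lambda>z. f (of_real r * z)) holomorphic_on ball 0 (1 / r)"
proof -
  have "(f \<circ> (\<lambda>z. of_real r * z)) holomorphic_on ball 0 (1 / r)"
    by (rule holomorphic_on_compose_gen[OF _ assms(1)])
      (use assms in \<open>auto intro!: holomorphic_intros simp: norm_mult field_simps\<close>)
  then show ?thesis by (simp add: o_def)
qed

lemma holomorphic_dilation_tendsto:
  assumes "f holomorphic_on unit_disc" "norm z < 1"
  shows "(\<lambda>n. f (of_real (approach n) * z)) \<longlonglongrightarrow> f z"
proof -
  have "isCont f z"
    using assms by (metis holomorphic_on_imp_continuous_on continuous_on_eq_continuous_at open_ball mem_ball_0)
  moreover have "(\<lambda>n. of_real (approach n) * z) \<longlonglongrightarrow> of_real 1 * z" by (intro tendsto_intros approach_lim)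
  ultimately show ?thesis using isCont_tendsto_compose[of z f] by simp
qed

text \<open>The previous bound is applied to the dilations by \<open>approach n\<close>. The
  inequality at a point \<open>z\<close> is strict, so it holds for all but finitely many dilations;
  the exceptional set therefore lies in the lower limit of the sets \<open>G n\<close>, an
  increasing union of intersections.\<close>

lemma nontangential_maximal_disc:
  assumes hol: "h holomorphic_on unit_disc" and \<alpha>: "\<alpha> > 1" and l: "l > 0"
    and L2: "\<And>r. 0 \<le> r \<Longrightarrow> r < 1 \<Longrightarrow> (\<integral>\<^sup>+t. ennreal ((norm (h (of_real r * cis t)))\<^sup>2) \<partial>circ) \<le> e"
  shows "emeasure circ {t. \<exists>z\<in>stolz \<alpha> (cis t). l < (norm (h z))\<^sup>2} \<le> ennreal (960 * (1 + \<alpha>) / l) * e"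
proof -
  define G where "G n = {t. \<exists>z\<in>stolz \<alpha> (cis t). l < (norm (h (of_real (approach n) * z)))\<^sup>2}" for n
  have opG: "open {t. \<exists>z\<in>stolz \<alpha> (cis t). P z}" for P :: "complex \<Rightarrow> bool"
  proof -
    have "{t. \<exists>z\<in>stolz \<alpha> (cis t). P z} = cis -` {\<zeta>. \<exists>z\<in>stolz \<alpha> \<zeta>. P z}" by auto
    also have "open \<dots>" by (intro open_vimage open_stolz_set continuous_on_cis continuous_on_id)
    finally show ?thesis .
  qed
  have Gm: "G n \<in> sets circ" for n using opG unfolding G_def by simp
  have Gle: "emeasure circ (G n) \<le> ennreal (960 * (1 + \<alpha>) / l) * e" for n
  proof -
    have "(\<lambda>z. h (of_real (approach n) * z)) holomorphic_on ball 0 (1 / approach n)"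
      by (rule holomorphic_on_dilation[OF hol approach(1)])
    then have "emeasure circ (G n) \<le> ennreal (960 * (1 + \<alpha>) / l) * (\<integral>\<^sup>+t. ennreal ((norm (h (of_real (approach n) * cis t)))\<^sup>2) \<partial>circ)"
      unfolding G_def by (rule nontangential_maximal_weak_type[OF _ _ \<alpha> l]) (use approach[of n] in simp)
    also have "\<dots> \<le> ennreal (960 * (1 + \<alpha>) / l) * e"
      using L2[of "approach n"] approach[of n] by (intro mult_left_mono) auto
    finally show ?thesis .
  qed
  define B where "B m = (\<Inter>n\<in>{m..}. G n)" for m
  have Bm: "B m \<in> sets circ" for m unfolding B_def by (intro sets.countable_INT'') (use Gm in auto)
  have "{t. \<exists>z\<in>stolz \<alpha> (cis t). l < (norm (h z))\<^sup>2} \<subseteq> (\<Union>m. B m)"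
  proof
    fix t assume "t \<in> {t. \<exists>z\<in>stolz \<alpha> (cis t). l < (norm (h z))\<^sup>2}"
    then obtain z where z: "z \<in> stolz \<alpha> (cis t)" "l < (norm (h z))\<^sup>2" by blast
    have "(\<lambda>n. h (of_real (approach n) * z)) \<longlonglongrightarrow> h z"
      by (rule holomorphic_dilation_tendsto[OF hol]) (use z(1) in \<open>simp add: stolz_def\<close>)
    then have "(\<lambda>n. (norm (h (of_real (approach n) * z)))\<^sup>2) \<longlonglongrightarrow> (norm (h z))\<^sup>2" by (intro tendsto_intros)
    then have "\<forall>\<^sub>F n in sequentially. l < (norm (h (of_real (approach n) * z)))\<^sup>2" by (rule order_tendstoD) (rule z)
    then obtain m where "\<And>n. n \<ge> m \<Longrightarrow> l < (norm (h (of_real (approach n) * z)))\<^sup>2" by (auto simp: eventually_sequentially)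
    then have "t \<in> B m" using z(1) by (auto simp: B_def G_def)
    then show "t \<in> (\<Union>m. B m)" by blast
  qed
  then have "emeasure circ {t. \<exists>z\<in>stolz \<alpha> (cis t). l < (norm (h z))\<^sup>2} \<le> emeasure circ (\<Union>m. B m)"
    by (rule emeasure_mono) (use Bm in auto)
  also have "\<dots> = (SUP m. emeasure circ (B m))"
    by (rule SUP_emeasure_incseq[symmetric]) (use Bm in \<open>auto simp: incseq_def B_def\<close>)
  also have "\<dots> \<le> ennreal (960 * (1 + \<alpha>) / l) * e"
  proof (rule SUP_least)
    fix m
    have "emeasure circ (B m) \<le> emeasure circ (G m)" by (rule emeasure_mono) (use Gm in \<open>auto simp: B_def\<close>)
    with Gle[of m] show "emeasure circ (B m) \<le> ennreal (960 * (1 + \<alpha>) / l) * e" by (rule order_trans[rotated])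
  qed
  finally show ?thesis .
qed

text \<open>Polynomials have limits everywhere, and the weak type bound applied to the tails of the Taylor series
  makes the oscillation of the remainder small off a set of small measure.\<close>

lemma fatou_theorem:
  assumes hol: "f holomorphic_on unit_disc" and bd: "\<And>z. z \<in> unit_disc \<Longrightarrow> norm (f z) \<le> 1"
  shows "AE \<zeta> in circle_measure. \<exists>w. has_nt_limit f w \<zeta>"
proof -
  define eps where "eps N = 1 / (real N + 1)" for N :: nat
  have eps: "eps N > 0" for N by (simp add: eps_def)
  have "\<exists>p. p holomorphic_on UNIV \<and> (\<forall>r. 0 \<le> r \<longrightarrow> r < 1 \<longrightarrow>
     (\<integral>\<^sup>+t. ennreal ((norm (f (of_real r * cis t) - p (of_real r * cis t)))\<^sup>2) \<partial>circ) \<le> ennreal (eps N))" for N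
    by (rule taylor_tail_L2[OF hol bd eps[of N]]) blast+
  then have "\<forall>N. \<exists>p. p holomorphic_on UNIV \<and> (\<forall>r. 0 \<le> r \<longrightarrow> r < 1 \<longrightarrow>
     (\<integral>\<^sup>+t. ennreal ((norm (f (of_real r * cis t) - p (of_real r * cis t)))\<^sup>2) \<partial>circ) \<le> ennreal (eps N))"
    by blast
  from choice[OF this] obtain p where
    pp: "\<forall>N. p N holomorphic_on UNIV \<and> (\<forall>r. 0 \<le> r \<longrightarrow> r < 1 \<longrightarrow>
     (\<integral>\<^sup>+t. ennreal ((norm (f (of_real r * cis t) - p N (of_real r * cis t)))\<^sup>2) \<partial>circ) \<le> ennreal (eps N))" ..
  have p: "p N holomorphic_on UNIV" for N using pp by blast
  have pL2: "(\<integral>\<^sup>+t. ennreal ((norm (f (of_real r * cis t) - p N (of_real r * cis t)))\<^sup>2) \<partial>circ) \<le> ennreal (eps N)"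
    if "0 \<le> r" "r < 1" for N r using pp that by blast
  define bad where "bad \<alpha> l N = {\<zeta>. \<exists>z\<in>stolz \<alpha> \<zeta>. l < (norm (f z - p N z))\<^sup>2}" for \<alpha> l N
  have opb: "open (bad \<alpha> l N)" for \<alpha> l N unfolding bad_def by (rule open_stolz_set)
  \<comment> \<open>Integer apertures \<open>k + 2\<close> and thresholds \<open>1 / (m + 1)\<close>
    are enough, because Stolz regions grow with the aperture; the exceptional set stays a countable
    union.\<close>
  define good where "good \<zeta> \<longleftrightarrow> (\<forall>k m. \<exists>N. \<zeta> \<notin> bad (real k + 2) (1 / (real m + 1)) N)" for \<zeta>
  have "AE t in circ. good (cis t)"
    unfolding good_def AE_all_countable
  proof (intro allI)
    fix k m :: nat
    define \<alpha> l where "\<alpha> = real k + 2" and "l = 1 / (real m + 1)"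
    have \<alpha>: "\<alpha> > 1" and l: "l > 0" by (auto simp: \<alpha>_def l_def)
    define Z where "Z N = {t. cis t \<in> bad \<alpha> l N}" for N
    have "open (Z N)" for N
    proof -
      have "Z N = cis -` bad \<alpha> l N" by (auto simp: Z_def)
      also have "open \<dots>" by (intro open_vimage opb continuous_on_cis continuous_on_id)
      finally show ?thesis .
    qed
    then have Zm: "Z N \<in> sets circ" for N by simp
    \<comment> \<open>A point is exceptional only if every polynomial fails there, and the one with
      index \<open>N\<close> fails on a set of measure O(\<open>eps N\<close>).\<close>
    have le: "emeasure circ (\<Inter>N. Z N) \<le> ennreal (960 * (1 + \<alpha>) / l) * ennreal (eps N)" for N
    proof -
      have "emeasure circ (\<Inter>N. Z N) \<le> emeasure circ (Z N)" by (rule emeasure_mono) (use Zm in auto)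
      also have "Z N = {t. \<exists>z\<in>stolz \<alpha> (cis t). l < (norm (f z - p N z))\<^sup>2}" by (auto simp: Z_def bad_def)
      also have "emeasure circ \<dots> \<le> ennreal (960 * (1 + \<alpha>) / l) * ennreal (eps N)"
        by (rule nontangential_maximal_disc[OF _ \<alpha> l pL2])
          (intro holomorphic_intros hol holomorphic_on_subset[OF p], auto)
      finally show ?thesis .
    qed
    have "emeasure circ (\<Inter>N. Z N) \<le> 0"
    proof (rule LIMSEQ_le_const)
      have "(\<lambda>N. ennreal (960 * (1 + \<alpha>) / l * eps N)) \<longlonglongrightarrow> ennreal (960 * (1 + \<alpha>) / l * 0)"
        by (intro tendsto_intros) (unfold eps_def, real_asymp)
      then show "(\<lambda>N. ennreal (960 * (1 + \<alpha>) / l) * ennreal (eps N)) \<longlonglongrightarrow> 0"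
        using \<alpha> l eps by (simp add: ennreal_mult[symmetric] less_imp_le)
    qed (use le in blast)
    then have "(\<Inter>N. Z N) \<in> null_sets circ" by (intro null_setsI) (use Zm in \<open>auto intro!: sets.countable_INT\<close>)
    then have "AE t in circ. t \<notin> (\<Inter>N. Z N)" by (rule AE_not_in)
    then show "AE t in circ. \<exists>N. cis t \<notin> bad (real k + 2) (1 / (real m + 1)) N"
      by (simp add: Z_def \<alpha>_def l_def)
  qed
  moreover have "{\<zeta>. good \<zeta>} \<in> sets borel"
  proof -
    have "{\<zeta>. good \<zeta>} = (\<Inter>k. \<Inter>m. \<Union>N. - bad (real k + 2) (1 / (real m + 1)) N)" by (auto simp: good_def)
    also have "\<dots> \<in> sets borel"
      by (intro sets.countable_INT'' sets.countable_UN'' borel_closed closed_Compl opb) auto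
    finally show ?thesis .
  qed
  ultimately have "AE \<zeta> in circle_measure. good \<zeta>" by (rule AE_circle_measure[rotated])
  moreover have "AE \<zeta> in circle_measure. norm \<zeta> = 1"
    by (rule AE_I2) (simp add: space_circle_measure)
  ultimately show ?thesis
  proof eventually_elim
    case (elim \<zeta>)
    \<comment> \<open>The candidate \<open>w\<close> is a limit point along the radius. The radius
      lies in every Stolz region, so \<open>w\<close> does not depend on the aperture, and the small
      oscillation makes it the full limit.\<close>
    define x where "x j = of_real (approach j) * \<zeta>" for j :: nat
    have xin: "x j \<in> stolz \<alpha> \<zeta>" if "\<alpha> > 1" for j \<alpha>
      unfolding x_def using elim(2) that approach[of j] by (intro radial_mem_stolz) auto
    have xlim: "x \<longlonglongrightarrow> \<zeta>"
      using tendsto_mult[OF tendsto_of_real[OF approach_lim] tendsto_const[of \<zeta>]] by (simp add: x_def[abs_def])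
    have xn: "norm (f (x j)) \<le> 1" for j using bd[of "x j"] xin[of 2 j] by (simp add: stolz_def)
    have "seq_compact (cball 0 1 :: complex set)" by (simp add: compact_imp_seq_compact)
    then obtain w s where s: "strict_mono s" and wlim: "(\<lambda>j. f (x (s j))) \<longlonglongrightarrow> w"
      using xn by (elim seq_compactE[where f = "\<lambda>j. f (x j)"]) (auto simp: o_def)
    have xs: "(\<lambda>j. x (s j)) \<longlonglongrightarrow> \<zeta>" using LIMSEQ_subseq_LIMSEQ[OF xlim s] by (simp add: o_def)
    have "(f \<longlongrightarrow> w) (at \<zeta> within stolz \<alpha> \<zeta>)" if \<alpha>: "\<alpha> > 1" for \<alpha>
    proof (rule tendstoI)
      fix e :: real assume e: "e > 0"
      obtain k :: nat where k: "\<alpha> \<le> real k" using real_arch_simple by blast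
      obtain m :: nat where "1 / (e / 4)\<^sup>2 \<le> real m" using real_arch_simple by blast
      then have m: "1 / (real m + 1) \<le> (e / 4)\<^sup>2"
        using e by (simp add: field_simps) (use zero_le_power2[of e] in linarith)
      obtain N where N: "\<zeta> \<notin> bad (real k + 2) (1 / (real m + 1)) N" using elim(1) by (auto simp: good_def)
      have close: "norm (f z - p N z) \<le> e / 4" if z: "z \<in> stolz \<alpha> \<zeta>" for z
      proof -
        have "z \<in> stolz (real k + 2) \<zeta>"
        proof -
          have "norm z < 1" "dist z \<zeta> < \<alpha> * (1 - norm z)" using z by (auto simp: stolz_def)
          moreover have "\<alpha> * (1 - norm z) \<le> (real k + 2) * (1 - norm z)"
            using k \<open>norm z < 1\<close> by (intro mult_right_mono) auto
          ultimately have "norm z < 1" "dist z \<zeta> < (real k + 2) * (1 - norm z)" by linarith+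
          then show ?thesis by (simp add: stolz_def)
        qed
        then have "(norm (f z - p N z))\<^sup>2 \<le> 1 / (real m + 1)" using N by (auto simp: bad_def not_less)
        also have "\<dots> \<le> (e / 4)\<^sup>2" by (rule m)
        finally show ?thesis by (rule power2_le_imp_le) (use e in simp)
      qed
      have pc: "isCont (p N) \<zeta>"
        using p[of N] holomorphic_on_imp_continuous_on continuous_on_eq_continuous_at by blast
      have "(p N \<longlongrightarrow> p N \<zeta>) (at \<zeta> within stolz \<alpha> \<zeta>)"
        using pc unfolding isCont_def by (rule tendsto_within_subset) simp
      then have ev: "\<forall>\<^sub>F z in at \<zeta> within stolz \<alpha> \<zeta>. dist (p N z) (p N \<zeta>) < e / 4"
        by (rule tendstoD) (use e in simp)
      have "norm (w - p N \<zeta>) \<le> e / 4"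
      proof (rule LIMSEQ_le_const2)
        show "(\<lambda>j. norm (f (x (s j)) - p N (x (s j)))) \<longlonglongrightarrow> norm (w - p N \<zeta>)"
          by (intro tendsto_intros wlim isCont_tendsto_compose[OF pc] xs)
      qed (use close xin \<alpha> in blast)
      then have wd: "dist (p N \<zeta>) w \<le> e / 4" by (simp add: dist_norm norm_minus_commute)
      have "\<forall>\<^sub>F z in at \<zeta> within stolz \<alpha> \<zeta>. z \<in> stolz \<alpha> \<zeta>" by (auto simp: eventually_at_filter)
      with ev show "\<forall>\<^sub>F z in at \<zeta> within stolz \<alpha> \<zeta>. dist (f z) w < e"
      proof eventually_elim
        case (elim z)
        have "dist (f z) (p N z) \<le> e / 4" using close[OF elim(2)] by (simp add: dist_norm)
        then show ?case using elim(1) wd e dist_triangle[of "f z" w "p N z"] dist_triangle[of "p N z" w "p N \<zeta>"]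
          by linarith
      qed
    qed
    then show ?case by (auto simp: has_nt_limit_def)
  qed
qed

section \<open>Entropy of angular derivative sets\<close>

text \<open>The boundary values of \<open>1 - |f|\<close>; unlike \<open>nt_value\<close>, a Borel function without exceptional set.\<close>

definition defect :: "(complex \<Rightarrow> complex) \<Rightarrow> complex \<Rightarrow> ennreal" where
  "defect f \<zeta> = liminf (\<lambda>n. if norm \<zeta> = 1 then ennreal (1 - norm (f (of_real (approach n) * \<zeta>))) else 0)"

text \<open>\<open>- log\<close> on \<open>[0, \<infinity>]\<close>, truncated to \<open>0\<close> at arguments above \<open>1\<close>.\<close>

definition nlog :: "ennreal \<Rightarrow> ennreal" where
  "nlog x = (if x = 0 then \<infinity> else ennreal (- ln (enn2real x)))"

lemma nlog_measurable [measurable]: "nlog \<in> borel_measurable borel"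
  unfolding nlog_def by measurable

lemma radial_continuous:
  assumes "f holomorphic_on unit_disc" "0 \<le> r" "r < 1"
  shows "continuous_on (sphere 0 1) (\<lambda>\<zeta>. f (of_real r * \<zeta>))"
  by (intro continuous_on_compose2[OF holomorphic_on_imp_continuous_on[OF assms(1)]] continuous_intros)
    (use assms in \<open>auto simp: norm_mult\<close>)

lemma radial_measurable:
  assumes "f holomorphic_on unit_disc" "0 \<le> r" "r < 1"
  shows "(\<lambda>\<zeta>. if norm \<zeta> = 1 then ennreal (1 - norm (f (of_real r * \<zeta>))) else 0) \<in> borel_measurable borel"
proof -
  have "(\<lambda>\<zeta>. if \<zeta> \<in> sphere 0 1 then 1 - norm (f (of_real r * \<zeta>)) else 0) \<in> borel_measurable borel"
    by (intro borel_measurable_continuous_on_if continuous_intros radial_continuous assms) auto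
  then have "(\<lambda>\<zeta>. ennreal (if \<zeta> \<in> sphere 0 1 then 1 - norm (f (of_real r * \<zeta>)) else 0)) \<in> borel_measurable borel"
    by simp
  also have "(\<lambda>\<zeta>. ennreal (if \<zeta> \<in> sphere 0 1 then 1 - norm (f (of_real r * \<zeta>)) else 0)) =
     (\<lambda>\<zeta>. if norm \<zeta> = 1 then ennreal (1 - norm (f (of_real r * \<zeta>))) else 0)" by auto
  finally show ?thesis .
qed

lemma defect_measurable:
  assumes "holo_self_map f"
  shows "defect f \<in> borel_measurable borel"
  unfolding defect_def using assms approach
  by (intro borel_measurable_liminf radial_measurable) (auto simp: holo_self_map_def less_imp_le)

lemma nt_limit_norm_le:
  assumes f: "holo_self_map f" and "has_nt_limit f w \<zeta>" "norm \<zeta> = 1"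
  shows "norm w \<le> 1" "defect f \<zeta> = ennreal (1 - norm w)"
proof -
  have lim: "(\<lambda>n. f (of_real (approach n) * \<zeta>)) \<longlonglongrightarrow> w"
    by (rule filterlim_compose[OF has_nt_limit_radial[OF assms(2,3)] approach_at_left])
  have "norm (f (of_real (approach n) * \<zeta>)) \<le> 1" for n
    using holo_self_map_norm_less[OF f, of "of_real (approach n) * \<zeta>"] approach[of n] assms by (simp add: norm_mult)
  then show "norm w \<le> 1" using LIMSEQ_le_const2[OF tendsto_norm[OF lim]] by blast
  have "(\<lambda>n. ennreal (1 - norm (f (of_real (approach n) * \<zeta>)))) \<longlonglongrightarrow> ennreal (1 - norm w)"
    by (intro tendsto_intros lim)
  then show "defect f \<zeta> = ennreal (1 - norm w)"
    unfolding defect_def using assms(3) by (simp add: lim_imp_Liminf)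
qed

lemma AE_nt_value:
  assumes "holo_self_map f"
  shows "AE \<zeta> in circle_measure. norm \<zeta> = 1 \<and> has_nt_limit f (nt_value f \<zeta>) \<zeta>"
proof -
  have "f holomorphic_on unit_disc" using assms by (simp add: holo_self_map_def)
  moreover have "norm (f z) \<le> 1" if "z \<in> unit_disc" for z
    using holo_self_map_norm_less[OF assms, of z] that by simp
  ultimately have "AE \<zeta> in circle_measure. \<exists>w. has_nt_limit f w \<zeta>" by (rule fatou_theorem)
  moreover have "AE \<zeta> in circle_measure. norm \<zeta> = 1"
    by (rule AE_I2) (simp add: space_circle_measure)
  ultimately show ?thesis by eventually_elim (use nt_value_eq in auto)
qed

text \<open>By Fatou's theorem \<open>nt_value f\<close> is almost everywhere a true limit, of
  modulus at most 1. Hence the positive part drops out, and a nonnegative Borel integrand over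
  angles remains; the later estimates work with this form.\<close>

lemma log_integral_eq:
  assumes f: "holo_self_map f" and O: "open U"
  shows "log_integral f (unit_circle \<inter> U) = - enn2ereal (\<integral>\<^sup>+t. indicator U (cis t) * nlog (defect f (cis t)) \<partial>circ)"
proof -
  have [measurable]: "defect f \<in> borel_measurable borel" by (rule defect_measurable[OF f])
  have [measurable]: "U \<in> sets borel" using O by simp
  have "(\<integral>\<^sup>+\<zeta>\<in>unit_circle \<inter> U. e2ennreal (elog (1 - norm (nt_value f \<zeta>))) \<partial>circle_measure) = (\<integral>\<^sup>+\<zeta>. 0 \<partial>circle_measure)"
  proof (rule nn_integral_cong_AE)
    show "AE \<zeta> in circle_measure. e2ennreal (elog (1 - norm (nt_value f \<zeta>))) * indicator (unit_circle \<inter> U) \<zeta> = 0"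
      using AE_nt_value[OF f]
    proof eventually_elim
      case (elim \<zeta>)
      then have "norm (nt_value f \<zeta>) \<le> 1" using nt_limit_norm_le[OF f] by blast
      then have "elog (1 - norm (nt_value f \<zeta>)) \<le> 0" by (simp add: elog_def)
      then show ?case by (simp add: e2ennreal_neg)
    qed
  qed
  moreover have "(\<integral>\<^sup>+\<zeta>\<in>unit_circle \<inter> U. e2ennreal (- elog (1 - norm (nt_value f \<zeta>))) \<partial>circle_measure)
      = (\<integral>\<^sup>+\<zeta>. indicator U \<zeta> * nlog (defect f \<zeta>) \<partial>circle_measure)"
  proof (rule nn_integral_cong_AE)
    show "AE \<zeta> in circle_measure. e2ennreal (- elog (1 - norm (nt_value f \<zeta>))) * indicator (unit_circle \<inter> U) \<zeta> = indicator U \<zeta> * nlog (defect f \<zeta>)"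
      using AE_nt_value[OF f]
    proof eventually_elim
      case (elim \<zeta>)
      then have "norm (nt_value f \<zeta>) \<le> 1" "defect f \<zeta> = ennreal (1 - norm (nt_value f \<zeta>))"
        using nt_limit_norm_le[OF f] by blast+
      then show ?case using elim by (auto simp: elog_def nlog_def indicator_def ennreal_eq_0_iff)
    qed
  qed
  moreover have "(\<integral>\<^sup>+\<zeta>. indicator U \<zeta> * nlog (defect f \<zeta>) \<partial>circle_measure) = (\<integral>\<^sup>+t. indicator U (cis t) * nlog (defect f (cis t)) \<partial>circ)"
    by (rule nn_integral_circle_measure) measurable
  ultimately show ?thesis by (simp add: log_integral_def ext_integral_def zero_ennreal.rep_eq)
qed

text \<open>Superharmonicity of 1 - |f| up to the boundary. For a dilation it is the subharmonicity
  of |f|, in additive form because subtraction in \<open>ennreal\<close> is truncated; Fatou's lemma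
  then passes to the boundary and preserves this direction of the inequality.\<close>

lemma defect_poisson_le:
  assumes f: "holo_self_map f" and z: "norm z < 1"
  shows "(\<integral>\<^sup>+t. defect f (cis t) * ennreal (poisson z (cis t)) \<partial>circ) \<le> ennreal (1 - norm (f z))"
proof -
  have hol: "f holomorphic_on unit_disc" using f by (simp add: holo_self_map_def)
  have lt: "norm (f v) < 1" if "norm v < 1" for v using holo_self_map_norm_less[OF f that] .
  define g where "g n t = ennreal (1 - norm (f (of_real (approach n) * cis t))) * ennreal (poisson z (cis t))" for n t
  have radm: "(\<lambda>t. norm (f (of_real r * cis t))) \<in> borel_measurable borel" if "0 \<le> r" "r < 1" for r
  proof -
    have "continuous_on UNIV (\<lambda>t. f (of_real r * cis t))"
      by (rule continuous_on_compose2[OF radial_continuous[OF hol that]]) (auto intro!: continuous_on_cis continuous_intros)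
    then show ?thesis by (intro borel_measurable_continuous_onI continuous_intros)
  qed
  have gm: "g n \<in> borel_measurable circ" for n
  proof -
    have "(\<lambda>t. norm (f (of_real (approach n) * cis t))) \<in> borel_measurable borel"
      using approach[of n] by (intro radm) auto
    then show ?thesis unfolding g_def by simp
  qed
  have le: "(\<integral>\<^sup>+t. g n t \<partial>circ) \<le> ennreal (1 - norm (f (of_real (approach n) * z)))" for n
  proof -
    let ?r = "approach n"
    let ?h = "\<lambda>z. f (of_real ?r * z)"
    have holh: "?h holomorphic_on ball 0 (1 / ?r)" by (rule holomorphic_on_dilation[OF hol approach(1)])
    have m: "(\<lambda>t. norm (?h (cis t))) \<in> borel_measurable borel"
      using approach[of n] by (intro radm) auto
    have b1: "norm (?h (cis t)) \<le> 1" for t using lt[of "of_real ?r * cis t"] approach[of n] by (simp add: norm_mult)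
    have P0: "poisson z (cis t) \<ge> 0" for t using poisson_nonneg z by simp
    have "(\<integral>\<^sup>+t. g n t \<partial>circ) + ennreal (norm (?h z))
        \<le> (\<integral>\<^sup>+t. g n t \<partial>circ) + (\<integral>\<^sup>+t. ennreal (norm (?h (cis t)) * poisson z (cis t)) \<partial>circ)"
      by (intro add_left_mono subharmonic_poisson[OF holh _ z]) (use approach[of n] in simp)
    also have "\<dots> = (\<integral>\<^sup>+t. g n t + ennreal (norm (?h (cis t)) * poisson z (cis t)) \<partial>circ)"
      by (rule nn_integral_add[symmetric]) (use gm m in auto)
    also have "\<dots> = (\<integral>\<^sup>+t. ennreal (poisson z (cis t)) \<partial>circ)"
    proof (intro nn_integral_cong)
      fix t
      have "g n t + ennreal (norm (?h (cis t)) * poisson z (cis t)) =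
        ennreal ((1 - norm (?h (cis t))) * poisson z (cis t) + norm (?h (cis t)) * poisson z (cis t))"
        using b1[of t] P0[of t] by (simp add: g_def ennreal_mult[symmetric] del: ennreal_plus add: ennreal_plus[symmetric])
      then show "g n t + ennreal (norm (?h (cis t)) * poisson z (cis t)) = ennreal (poisson z (cis t))"
        by (simp add: algebra_simps)
    qed
    also have "\<dots> = ennreal (1 - norm (?h z)) + ennreal (norm (?h z))"
    proof -
      have "norm (?h z) \<le> 1"
      proof -
        have "norm (of_real ?r * z) < 1" using approach[of n] z mult_strict_mono[of ?r 1 "norm z" 1] by (simp add: norm_mult)
        then show ?thesis using lt less_imp_le by blast
      qed
      then show ?thesis by (simp add: nn_integral_poisson[OF z] ennreal_plus[symmetric] del: ennreal_plus)
    qed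
    finally show ?thesis by (simp add: ennreal_add_left_cancel_le add.commute[of _ "ennreal (norm (?h z))"])
  qed
  have "(\<integral>\<^sup>+t. defect f (cis t) * ennreal (poisson z (cis t)) \<partial>circ) \<le> (\<integral>\<^sup>+t. liminf (\<lambda>n. g n t) \<partial>circ)"
  proof (intro nn_integral_mono)
    fix t
    have "defect f (cis t) * ennreal (poisson z (cis t)) = ennreal (poisson z (cis t)) * liminf (\<lambda>n. ennreal (1 - norm (f (of_real (approach n) * cis t))))"
      by (simp add: defect_def mult.commute)
    also have "\<dots> \<le> liminf (\<lambda>n. ennreal (poisson z (cis t)) * ennreal (1 - norm (f (of_real (approach n) * cis t))))"
      unfolding liminf_SUP_INF SUP_mult_left_ennreal
      by (intro SUP_mono' INF_greatest mult_left_mono INF_lower) auto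
    finally show "defect f (cis t) * ennreal (poisson z (cis t)) \<le> liminf (\<lambda>n. g n t)" by (simp add: g_def mult.commute)
  qed
  also have "\<dots> \<le> liminf (\<lambda>n. \<integral>\<^sup>+t. g n t \<partial>circ)" by (rule nn_integral_liminf[OF gm])
  also have "\<dots> \<le> liminf (\<lambda>n. ennreal (1 - norm (f (of_real (approach n) * z))))"
    by (intro Liminf_mono always_eventually allI le)
  also have "\<dots> = ennreal (1 - norm (f z))"
  proof (rule lim_imp_Liminf)
    show "(\<lambda>n. ennreal (1 - norm (f (of_real (approach n) * z)))) \<longlonglongrightarrow> ennreal (1 - norm (f z))"
      by (intro tendsto_intros holomorphic_dilation_tendsto hol z)
  qed simp
  finally show ?thesis .
qed


section \<open>Arcs as images of intervals of angles\<close>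

lemma cis_inj_lt:
  assumes "cis s = cis t" "\<bar>s - t\<bar> < 2 * pi"
  shows "s = t"
proof -
  have "cos (s - t) = 1"
    using assms(1) by (simp add: cos_diff complex_eq_iff flip: power2_eq_square)
  then obtain n :: int where n: "s - t = n * 2 * pi" by (auto simp: cos_one_2pi_int)
  then have "\<bar>real_of_int n\<bar> * (2 * pi) < 1 * (2 * pi)" using assms(2) by (simp add: abs_mult)
  then have "\<bar>real_of_int n\<bar> < 1" by (subst (asm) mult_less_cancel_right) auto
  then have "n = 0" by linarith
  then show ?thesis using n by simp
qed

lemma cis_mem_image:
  assumes "X \<subseteq> {a..<a+2*pi}" "t \<in> {a..<a+2*pi}"
  shows "cis t \<in> cis ` X \<longleftrightarrow> t \<in> X"
proof
  assume "cis t \<in> cis ` X"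
  then obtain s where s: "s \<in> X" "cis t = cis s" by auto
  then have "t = s" using assms by (intro cis_inj_lt) force+
  then show "t \<in> X" using s by simp
qed auto

text \<open>An open interval is a countable union of compact ones, whose images are compact.\<close>

lemma borel_cis_image [measurable]: "cis ` {a<..<b} \<in> sets borel" "cis ` {a..<b} \<in> sets borel"
proof -
  have "{a<..<b} = (\<Union>n. {a + 1 / real (Suc n)..b - 1 / real (Suc n)})"
  proof (intro equalityI subsetI)
    fix x assume x: "x \<in> {a<..<b}"
    then have "0 < min (x - a) (b - x)" by auto
    then obtain n where "inverse (real (Suc n)) < min (x - a) (b - x)" using reals_Archimedean by blast
    then have "x \<in> {a + 1 / real (Suc n)..b - 1 / real (Suc n)}" by (auto simp: inverse_eq_divide)
    then show "x \<in> (\<Union>n. {a + 1 / real (Suc n)..b - 1 / real (Suc n)})" by blast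
  next
    fix x assume "x \<in> (\<Union>n. {a + 1 / real (Suc n)..b - 1 / real (Suc n)})"
    then obtain n where n: "a + 1 / real (Suc n) \<le> x" "x \<le> b - 1 / real (Suc n)" by auto
    have "1 / real (Suc n) > 0" by simp
    then show "x \<in> {a<..<b}" using n by (simp only: greaterThanLessThan_iff) linarith
  qed
  then have "cis ` {a<..<b} = (\<Union>n. cis ` {a + 1 / real (Suc n)..b - 1 / real (Suc n)})" by (simp only: image_UN)
  also have "\<dots> \<in> sets borel"
    by (intro sets.countable_UN'' borel_closed compact_imp_closed compact_continuous_image continuous_on_cis continuous_on_id) auto
  finally show *: "cis ` {a<..<b} \<in> sets borel" .
  show "cis ` {a..<b} \<in> sets borel"
  proof (cases "a < b")
    case True
    then have "{a..<b} = insert a {a<..<b}" by auto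
    then have "cis ` {a..<b} = insert (cis a) (cis ` {a<..<b})" by (simp only: image_insert)
    then show ?thesis using * by simp
  qed simp
qed

lemma nn_integral_cis_image:
  assumes X: "X \<subseteq> {a..<a+2*pi}" "X \<in> sets borel" "cis ` X \<in> sets borel"
  shows "(\<integral>\<^sup>+t. indicator (cis ` X) (cis t) \<partial>circ) = emeasure lborel X / ennreal (2 * pi)"
proof -
  have "(\<integral>\<^sup>+t. indicator (cis ` X) (cis t) \<partial>circ) = (\<integral>\<^sup>+t\<in>{a..<a+2*pi}. indicator (cis ` X) (cis t) \<partial>lborel) / ennreal (2 * pi)"
    by (rule nn_integral_circ_from) (use X in simp)
  also have "(\<integral>\<^sup>+t\<in>{a..<a+2*pi}. indicator (cis ` X) (cis t) \<partial>lborel) = (\<integral>\<^sup>+t. indicator X t \<partial>lborel)"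
    by (intro nn_integral_cong) (use X cis_mem_image[OF X(1)] in \<open>auto simp: indicator_def\<close>)
  also have "\<dots> = emeasure lborel X" using X by simp
  finally show ?thesis .
qed

lemma nn_integral_arc:
  assumes "a \<le> b" "b \<le> a + 2 * pi"
  shows "(\<integral>\<^sup>+t. indicator (cis ` {a<..<b}) (cis t) \<partial>circ) = ennreal ((b - a) / (2 * pi))"
    "(\<integral>\<^sup>+t. indicator (cis ` {a..<b}) (cis t) \<partial>circ) = ennreal ((b - a) / (2 * pi))"
  using assms by (subst nn_integral_cis_image[where a = a]; auto simp: divide_ennreal)+

lemma measure_arc:
  assumes "a \<le> b" "b \<le> a + 2 * pi"
  shows "measure circle_measure (cis ` {a<..<b}) = (b - a) / (2 * pi)"
proof -
  have "emeasure circle_measure (cis ` {a<..<b}) = ennreal ((b - a) / (2 * pi))"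
    using nn_integral_arc(1)[OF assms] by (subst emeasure_circle_measure) auto
  then show ?thesis using assms by (simp add: measure_def)
qed

lemma norm_cis_diff_le: "norm (cis s - cis t) \<le> \<bar>s - t\<bar>"
proof -
  have "(norm (cis s - cis t))\<^sup>2 = (2 * \<bar>sin ((s - t) / 2)\<bar>)\<^sup>2" by (simp add: norm_cis_diff power_mult_distrib)
  also have "\<dots> \<le> (2 * \<bar>(s - t) / 2\<bar>)\<^sup>2" by (intro power_mono mult_left_mono abs_sin_x_le_abs_x) auto
  also have "\<dots> = \<bar>s - t\<bar>\<^sup>2" by (simp add: power_divide)
  finally show ?thesis by (rule power2_le_imp_le) simp
qed

text \<open>The defect is tested against the Poisson kernel at a point \<open>z\<close> on the
  radius to \<open>cis c\<close>, at a height proportional to the arc. There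
  \<open>1 - norm (f z)\<close> is at most \<open>M\<close> times the height, and the kernel is at
  least a multiple of 1 / height on the whole arc.\<close>

lemma arc_defect_le:
  assumes f: "holo_self_map f" and ab: "a < b" "b \<le> a + 2 * pi" and c: "c \<in> {a..b}"
    and A: "A \<subseteq> cis ` {a..b}" and [measurable]: "A \<in> sets borel"
    and bound: "\<And>r. 0 \<le> r \<Longrightarrow> r < 1 \<Longrightarrow> 1 - norm (f (of_real r * cis c)) \<le> M * (1 - r)"
  shows "(\<integral>\<^sup>+t. indicator A (cis t) * defect f (cis t) \<partial>circ) \<le> ennreal (2 * M * (b - a)\<^sup>2)"
proof -
  have [measurable]: "defect f \<in> borel_measurable borel" by (rule defect_measurable[OF f])
  define L where "L = b - a"
  \<comment> \<open>The divisor exceeds 2 pi, so \<open>\<delta> < 1\<close> even for the full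
    circle. Every point of the arc is within \<open>L + \<delta> = 8 * \<delta>\<close> of
    \<open>z\<close>, hence the factor 64, and 64 / 49 <= 2 gives the final constant.\<close>
  define \<delta> where "\<delta> = L / 7"
  have L: "L > 0" "L \<le> 2 * pi" using ab by (auto simp: L_def)
  have "2 * pi < 7" using pi_approx by simp
  then have \<delta>: "\<delta> > 0" "\<delta> < 1" using L by (auto simp: \<delta>_def)
  define z where "z = of_real (1 - \<delta>) * cis c"
  have nz: "norm z = 1 - \<delta>" unfolding z_def norm_mult norm_of_real using \<delta> by simp
  then have z: "norm z < 1" using \<delta> by simp
  have low: "1 \<le> 64 * \<delta> * poisson z \<xi>" if "\<xi> \<in> A" for \<xi>
  proof -
    have "\<xi> \<in> cis ` {a..b}" using that A by blast
    then obtain s where s: "s \<in> {a..b}" "\<xi> = cis s" by blast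
    have "norm (cis s - z) \<le> norm (cis s - cis c) + norm (cis c - z)"
      using norm_triangle_ineq[of "cis s - cis c" "cis c - z"] by simp
    also have "norm (cis s - cis c) \<le> L" using norm_cis_diff_le[of s c] s c by (auto simp: L_def)
    also have "cis c - z = of_real \<delta> * cis c" by (simp add: z_def algebra_simps)
    also have "norm (of_real \<delta> * cis c) = \<delta>" using \<delta> by (simp add: norm_mult)
    finally have "norm (\<xi> - z) \<le> 8 * \<delta>" using s by (simp add: \<delta>_def)
    then have n: "(norm (\<xi> - z))\<^sup>2 \<le> (8 * \<delta>)\<^sup>2" by (intro power_mono) auto
    have "\<xi> \<noteq> z" using z s by auto
    then have pos: "(norm (\<xi> - z))\<^sup>2 > 0" by simp
    have "1 - (norm z)\<^sup>2 = \<delta> * (2 - \<delta>)" by (simp add: nz power2_eq_square algebra_simps)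
    also have "\<dots> \<ge> \<delta> * 1" using \<delta> by (intro mult_left_mono) auto
    finally have P: "1 - (norm z)\<^sup>2 \<ge> \<delta>" by simp
    have "(norm (\<xi> - z))\<^sup>2 \<le> 64 * \<delta> * \<delta>" using n by (simp add: power2_eq_square)
    also have "\<dots> \<le> 64 * \<delta> * (1 - (norm z)\<^sup>2)" using P \<delta> by (intro mult_left_mono) auto
    finally show ?thesis using pos by (simp add: poisson_def pos_le_divide_eq)
  qed
  have "(\<integral>\<^sup>+t. indicator A (cis t) * defect f (cis t) \<partial>circ) \<le> (\<integral>\<^sup>+t. ennreal (64 * \<delta>) * (defect f (cis t) * ennreal (poisson z (cis t))) \<partial>circ)"
  proof (rule nn_integral_mono)
    fix t
    show "indicator A (cis t) * defect f (cis t) \<le> ennreal (64 * \<delta>) * (defect f (cis t) * ennreal (poisson z (cis t)))"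
    proof (cases "cis t \<in> A")
      case True
      have "1 \<le> ennreal (64 * \<delta> * poisson z (cis t))" using low[OF True] by (simp add: ennreal_ge_1)
      also have "\<dots> = ennreal (64 * \<delta>) * ennreal (poisson z (cis t))"
        using \<delta> poisson_nonneg[of z] z by (intro ennreal_mult) auto
      finally have "1 * defect f (cis t) \<le> ennreal (64 * \<delta>) * ennreal (poisson z (cis t)) * defect f (cis t)"
        by (rule mult_right_mono) simp
      then show ?thesis using True by (simp add: mult_ac)
    qed simp
  qed
  also have "\<dots> = ennreal (64 * \<delta>) * (\<integral>\<^sup>+t. defect f (cis t) * ennreal (poisson z (cis t)) \<partial>circ)"
    by (rule nn_integral_cmult) simp
  also have "\<dots> \<le> ennreal (64 * \<delta>) * ennreal (1 - norm (f z))"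
    by (intro mult_left_mono defect_poisson_le f z) simp
  also have "\<dots> \<le> ennreal (64 * \<delta>) * ennreal (M * \<delta>)"
    using bound[of "1 - \<delta>"] \<delta> by (intro mult_left_mono ennreal_leI) (auto simp: z_def)
  also have "\<dots> = ennreal (64 * \<delta> * (M * \<delta>))"
    using \<delta> by (simp add: ennreal_mult')
  also have "\<dots> \<le> ennreal (2 * M * L\<^sup>2)"
  proof (rule ennreal_leI)
    have "norm (f 0) < 1" using holo_self_map_norm_less[OF f, of 0] by simp
    then have "M \<ge> 0" using bound[of 0] by simp
    then have "0 \<le> M * L\<^sup>2" by simp
    then show "64 * \<delta> * (M * \<delta>) \<le> 2 * M * L\<^sup>2" by (simp add: \<delta>_def power2_eq_square mult_ac)
  qed
  finally show ?thesis by (simp add: L_def)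
qed

text \<open>The tangent to -log at \<open>l\<close>, written with sums only. Integrating it amounts
  to Jensen's inequality without normalising the measure, and the point of tangency stays
  free.\<close>

lemma nlog_ge:
  assumes "l > 0"
  shows "ennreal (ln (1 / l) + 1) \<le> nlog x + ennreal (1 / l) * x"
proof (cases x)
  case (real y)
  show ?thesis
  proof (cases "y = 0")
    case False
    then have y: "y > 0" using real by simp
    have "ln (y / l) \<le> y / l - 1" using y assms by (intro ln_le_minus_one) simp
    then have "ln (1 / l) + 1 \<le> - ln y + y / l" using y assms by (simp add: ln_div)
    then have "ennreal (ln (1 / l) + 1) \<le> ennreal (- ln y + y / l)" by (rule ennreal_leI)
    also have "\<dots> \<le> ennreal (- ln y) + ennreal (y / l)"
    proof (cases "- ln y \<ge> 0")
      case False
      then have "ennreal (- ln y + y / l) \<le> ennreal (y / l)" by (intro ennreal_leI) simp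
      also have "\<dots> \<le> ennreal (- ln y) + ennreal (y / l)" by simp
      finally show ?thesis .
    next
      case True
      then show ?thesis using y assms by (simp add: ennreal_plus[symmetric] del: ennreal_plus)
    qed
    also have "\<dots> = nlog x + ennreal (1 / l) * x"
      using y assms real by (simp add: nlog_def ennreal_mult[symmetric] ennreal_eq_0_iff)
    finally show ?thesis .
  qed (use real in \<open>simp add: nlog_def\<close>)
next
  case top
  then show ?thesis using assms by (simp add: ennreal_mult_top)
qed

text \<open>The tangent is taken at the normalised length \<open>l\<close>, since the mean of the
  defect over the arc is O(M l); the error is then linear in \<open>l\<close> and sums to O(M) over
  disjoint arcs. \<open>A\<close> is any Borel set of full length in the closed arc, which covers
  the half-open arcs of a partition as well as open components.\<close>

lemma arc_entropy_le:
  assumes f: "holo_self_map f" and ab: "a < b" "b \<le> a + 2 * pi" and c: "c \<in> {a..b}"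
    and A: "A \<subseteq> cis ` {a..b}" and [measurable]: "A \<in> sets borel"
    and l: "l = (b - a) / (2 * pi)" "(\<integral>\<^sup>+t. indicator A (cis t) \<partial>circ) = ennreal l"
    and bound: "\<And>r. 0 \<le> r \<Longrightarrow> r < 1 \<Longrightarrow> 1 - norm (f (of_real r * cis c)) \<le> M * (1 - r)"
  shows "ennreal (l * ln (1 / l)) \<le> (\<integral>\<^sup>+t. indicator A (cis t) * nlog (defect f (cis t)) \<partial>circ) + ennreal (8 * pi\<^sup>2 * M * l)"
proof -
  have [measurable]: "defect f \<in> borel_measurable borel" by (rule defect_measurable[OF f])
  have l0: "l > 0" "l \<le> 1" unfolding l(1) using ab by simp_all
  then have "ln (1 / l) \<ge> 0" by simp
  have "ennreal (l * ln (1 / l)) \<le> ennreal ((ln (1 / l) + 1) * l)"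
    using l0 by (intro ennreal_leI) (simp add: algebra_simps)
  also have "\<dots> = ennreal (ln (1 / l) + 1) * ennreal l"
    using l0 \<open>ln (1 / l) \<ge> 0\<close> by (intro ennreal_mult) auto
  also have "\<dots> = (\<integral>\<^sup>+t. ennreal (ln (1 / l) + 1) * indicator A (cis t) \<partial>circ)"
    unfolding l(2)[symmetric] by (rule nn_integral_cmult[symmetric]) simp
  also have "\<dots> \<le> (\<integral>\<^sup>+t. indicator A (cis t) * nlog (defect f (cis t)) + ennreal (1 / l) * (indicator A (cis t) * defect f (cis t)) \<partial>circ)"
    using nlog_ge[OF l0(1)] by (intro nn_integral_mono) (auto simp: indicator_def)
  also have "\<dots> = (\<integral>\<^sup>+t. indicator A (cis t) * nlog (defect f (cis t)) \<partial>circ) + ennreal (1 / l) * (\<integral>\<^sup>+t. indicator A (cis t) * defect f (cis t) \<partial>circ)"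
    by (subst nn_integral_add) (auto simp: nn_integral_cmult)
  also have "\<dots> \<le> (\<integral>\<^sup>+t. indicator A (cis t) * nlog (defect f (cis t)) \<partial>circ) + ennreal (1 / l) * ennreal (2 * M * (b - a)\<^sup>2)"
    by (intro add_left_mono mult_left_mono arc_defect_le[OF f ab c A _ bound]) auto
  also have "ennreal (1 / l) * ennreal (2 * M * (b - a)\<^sup>2) = ennreal (8 * pi\<^sup>2 * M * l)"
  proof -
    have "b - a = 2 * pi * l" using l by simp
    then have "1 / l * (2 * M * (b - a)\<^sup>2) = 8 * pi\<^sup>2 * M * l" using l0 by (simp add: power2_eq_square)
    then show ?thesis using l0 by (simp add: ennreal_mult'[symmetric])
  qed
  finally show ?thesis .
qed

text \<open>Around an angle \<open>t0\<close> of a point of \<open>J\<close>, take the nearest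
  angles of \<open>E\<close> on both sides. They exist because \<open>E\<close> is closed and
  nonempty and its set of angles is periodic; \<open>a + 2 * pi\<close> is again such an angle,
  whence the bound on \<open>b\<close>. If \<open>E\<close> is a single point, \<open>cis a\<close>
  and \<open>cis b\<close> coincide.\<close>

lemma component_arc:
  assumes E: "closed E" "E \<subseteq> unit_circle" "E \<noteq> {}" and J: "J \<in> components (unit_circle - E)"
  obtains a b where "a < b" "b \<le> a + 2 * pi" "J = cis ` {a<..<b}" "cis a \<in> E" "cis b \<in> E"
proof -
  obtain \<xi> where \<xi>: "\<xi> \<in> J" using J in_components_nonempty by blast
  have Jsub: "J \<subseteq> unit_circle - E" using J in_components_subset by blast
  have circ: "\<exists>t. v = cis t" if "norm v = 1" for v
    using that by (metis cis_Arg_unique complex_norm_eq_1_exp cis_conv_exp)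
  have "norm \<xi> = 1" using \<xi> Jsub by auto
  then obtain t0 where t0: "\<xi> = cis t0" by (blast dest: circ)
  obtain e where e: "e \<in> E" using E by blast
  then have "norm e = 1" using E by auto
  then obtain c where c: "e = cis c" by (blast dest: circ)
  have per: "cis (t + 2 * pi * of_int n) = cis t" for t and n :: int
    by (simp flip: cis_mult)
  obtain c1 where c1: "c1 \<in> {t0 - 2*pi<..t0}" "cis c1 = e"
  proof -
    define n where "n = \<lfloor>(t0 - c) / (2 * pi)\<rfloor>"
    have "real_of_int n \<le> (t0 - c) / (2 * pi)" "(t0 - c) / (2 * pi) < real_of_int n + 1" by (auto simp: n_def)
    then have "c + 2 * pi * of_int n \<in> {t0 - 2*pi<..t0}" by (simp add: field_simps)
    then show thesis using that per c by metis
  qed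
  define S where "S = {t. cis t \<in> E}"
  have "S = cis -` E" by (auto simp: S_def)
  also have "closed \<dots>" using E by (intro closed_vimage continuous_on_cis continuous_on_id) auto
  finally have clS: "closed S" .
  have t0S: "t0 \<notin> S" using \<xi> Jsub t0 by (auto simp: S_def)
  define a where "a = Sup (S \<inter> {..t0})"
  define b where "b = Inf (S \<inter> {t0..})"
  have c1S: "c1 \<in> S \<inter> {..t0}" using c1 e by (auto simp: S_def)
  have c2S: "c1 + 2 * pi \<in> S \<inter> {t0..}" using c1 e per[of c1 1] by (auto simp: S_def)
  have a: "a \<in> S \<inter> {..t0}" unfolding a_def
    by (intro closed_contains_Sup) (use c1S clS in \<open>auto intro!: bdd_aboveI[of _ t0] closed_Int\<close>)
  have b: "b \<in> S \<inter> {t0..}" unfolding b_def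
    by (intro closed_contains_Inf) (use c2S clS in \<open>auto intro!: bdd_belowI[of _ t0] closed_Int\<close>)
  have amax: "t \<le> a" if "t \<in> S" "t \<le> t0" for t unfolding a_def
    by (rule cSup_upper) (use that in \<open>auto intro!: bdd_aboveI[of _ t0]\<close>)
  have bmin: "b \<le> t" if "t \<in> S" "t0 \<le> t" for t unfolding b_def
    by (rule cInf_lower) (use that in \<open>auto intro!: bdd_belowI[of _ t0]\<close>)
  have lt: "a < t0" "t0 < b" using a b t0S by (auto simp: le_less)
  have "a + 2 * pi \<in> S" using a per[of a 1] by (auto simp: S_def)
  moreover have "t0 \<le> a + 2 * pi" using amax[of c1] c1 c1S by auto
  ultimately have ba: "b \<le> a + 2 * pi" using bmin by blast
  define A where "A = cis ` {a<..<b}"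
  have notS: "t \<notin> S" if "t \<in> {a<..<b}" for t
    using amax[of t] bmin[of t] that by (cases "t \<le> t0") auto
  have AE: "A \<subseteq> unit_circle - E" using notS by (auto simp: A_def S_def)
  have "connected A" unfolding A_def
    by (intro connected_continuous_image continuous_on_cis continuous_on_id) auto
  moreover have "\<xi> \<in> A" using t0 lt by (auto simp: A_def)
  ultimately have AJ: "A \<subseteq> J" using components_maximal[OF J] AE \<xi> by blast
  have JA: "J \<subseteq> A"
  proof -
    \<comment> \<open>The two closed arcs meet in points of \<open>E\<close> only and cover the rest
      of the circle, so a connected set off \<open>E\<close> lies in one of them.\<close>
    let ?C = "cis ` {b..a+2*pi}" and ?D = "cis ` {a..b}"
    have cl: "closed ?C" "closed ?D"
      by (auto intro!: compact_imp_closed compact_continuous_image continuous_on_cis continuous_on_id)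
    have cover: "unit_circle \<subseteq> ?C \<union> A \<union> E"
    proof
      fix v :: complex assume "v \<in> unit_circle"
      then have "norm v = 1" by simp
      then obtain t where t: "v = cis t" by (blast dest: circ)
      define n where "n = \<lfloor>(t - a) / (2 * pi)\<rfloor>"
      have "real_of_int n \<le> (t - a) / (2 * pi)" "(t - a) / (2 * pi) < real_of_int n + 1" by (auto simp: n_def)
      then have tn: "a \<le> t + 2 * pi * of_int (- n)" "t + 2 * pi * of_int (- n) < a + 2 * pi" by (simp_all add: field_simps)
      define u where "u = t + 2 * pi * of_int (- n)"
      have u: "v = cis u" "a \<le> u" "u < a + 2 * pi" using tn per[of t "- n"] t by (auto simp: u_def)
      show "v \<in> ?C \<union> A \<union> E"
      proof (cases "u = a")
        case True then show ?thesis using a u by (auto simp: S_def)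
      next
        case False
        then have "u \<in> {a<..<b} \<or> u \<in> {b..a+2*pi}" using u by auto
        then show ?thesis using u(1) unfolding A_def by blast
      qed
    qed
    have disj: "?C \<inter> A = {}"
    proof -
      have "cis s \<noteq> cis t" if "s \<in> {b..a+2*pi}" "t \<in> {a<..<b}" for s t
        using cis_inj_lt[of s t] that by force
      then show ?thesis by (auto simp: A_def)
    qed
    have AD: "A \<subseteq> ?D" "?D \<subseteq> A \<union> E" using a b
      by (auto simp: A_def S_def) (metis greaterThanLessThan_iff image_eqI order_le_less)
    have "connected J" using J in_components_connected by blast
    then have "- ?D \<inter> J = {} \<or> - ?C \<inter> J = {}"
    proof (rule connectedD)
      show "open (- ?D)" "open (- ?C)" using cl by (auto simp: open_Compl)
      show "- ?D \<inter> - ?C \<inter> J = {}" using cover Jsub AD(1) by blast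
      show "J \<subseteq> - ?D \<union> - ?C" using AD(2) disj Jsub by blast
    qed
    moreover have "\<xi> \<in> J \<inter> - ?C" using \<xi> \<open>\<xi> \<in> A\<close> disj by blast
    ultimately have "J \<subseteq> ?D" by blast
    then show "J \<subseteq> A" using AD(2) Jsub by blast
  qed
  show thesis
    by (rule that[of a b]) (use lt ba a b AJ JA in \<open>auto simp: A_def S_def\<close>)
qed


lemma sum_measure_components_le:
  assumes F: "finite F" "F \<subseteq> components (unit_circle - E)" and m: "\<And>J. J \<in> F \<Longrightarrow> J \<in> sets borel"
  shows "(\<Sum>J\<in>F. measure circle_measure J) \<le> 1"
proof -
  interpret cm: prob_space circle_measure by (rule prob_space_circle_measure)
  have "(\<Sum>J\<in>F. measure circle_measure J) = measure circle_measure (\<Union>J\<in>F. J)"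
  proof (rule cm.finite_measure_finite_Union[symmetric])
    show "(\<lambda>J. J) ` F \<subseteq> sets circle_measure"
    proof
      fix J assume J: "J \<in> (\<lambda>J. J) ` F"
      then have "J \<subseteq> unit_circle" using F in_components_subset[of J "unit_circle - E"] by auto
      then show "J \<in> sets circle_measure" using sets_circle_measureI[OF m[of J]] J by (simp add: inf_absorb1)
    qed
    show "disjoint_family_on (\<lambda>J. J) F"
      using F components_nonoverlap[of _ "unit_circle - E"] unfolding disjoint_family_on_def by blast
  qed (use F in auto)
  also have "\<dots> \<le> 1" by (rule cm.prob_le_1)
  finally show ?thesis .
qed

lemma sum_indicator_le:
  assumes "finite K" "disjoint_family_on A K" "\<And>i. i \<in> K \<Longrightarrow> A i \<subseteq> U"
  shows "(\<Sum>i\<in>K. indicator (A i) x) \<le> (indicator U x :: ennreal)"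
proof -
  have "(\<Sum>i\<in>K. indicator (A i) x) = (indicator (\<Union>i\<in>K. A i) x :: ennreal)"
    using assms by (intro indicator_UN_disjoint[symmetric]) auto
  also have "\<dots> \<le> indicator U x" using assms by (auto simp: indicator_def)
  finally show ?thesis .
qed

lemma sum_nlog_le:
  assumes f: "holo_self_map f" and K: "finite K" "disjoint_family_on A K"
    and A: "\<And>i. i \<in> K \<Longrightarrow> A i \<subseteq> U" "\<And>i. i \<in> K \<Longrightarrow> A i \<in> sets borel"
  shows "(\<Sum>i\<in>K. \<integral>\<^sup>+t. indicator (A i) (cis t) * nlog (defect f (cis t)) \<partial>circ)
    \<le> (\<integral>\<^sup>+t. indicator U (cis t) * nlog (defect f (cis t)) \<partial>circ)"
proof -
  have [measurable]: "defect f \<in> borel_measurable borel" by (rule defect_measurable[OF f])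
  have "(\<Sum>i\<in>K. \<integral>\<^sup>+t. indicator (A i) (cis t) * nlog (defect f (cis t)) \<partial>circ)
     = (\<integral>\<^sup>+t. (\<Sum>i\<in>K. indicator (A i) (cis t) * nlog (defect f (cis t))) \<partial>circ)"
    by (rule nn_integral_sum[symmetric]) (use A in measurable)
  also have "\<dots> \<le> (\<integral>\<^sup>+t. indicator U (cis t) * nlog (defect f (cis t)) \<partial>circ)"
    by (intro nn_integral_mono) (simp add: sum_distrib_right[symmetric] mult_right_mono sum_indicator_le K A)
  finally show ?thesis .
qed

context
  fixes f :: "complex \<Rightarrow> complex" and E U :: "complex set" and M \<rho> s :: real
  assumes f: "holo_self_map f" and E: "closed E" "E \<subseteq> unit_circle"
    and bound: "\<And>\<zeta> r. \<zeta> \<in> E \<Longrightarrow> 0 \<le> r \<Longrightarrow> r < 1 \<Longrightarrow> 1 - norm (f (of_real r * \<zeta>)) \<le> M * (1 - r)"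
    and fin: "(\<integral>\<^sup>+t. indicator U (cis t) * nlog (defect f (cis t)) \<partial>circ) \<le> ennreal s" and s: "s \<ge> 0"
begin

lemma bound_nonneg: "E \<noteq> {} \<Longrightarrow> M \<ge> 0"
proof -
  assume "E \<noteq> {}"
  then obtain \<zeta> where "\<zeta> \<in> E" by blast
  moreover have "norm (f 0) < 1" using holo_self_map_norm_less[OF f, of 0] by simp
  ultimately show ?thesis using bound[of \<zeta> 0] by simp
qed

text \<open>Cut the circle into \<open>n\<close> equal arcs, k of which meet \<open>E\<close>. Each
  of these accounts for log n / n in the entropy estimate, with an error of order 1 / n, so k / n
  times log n stays bounded, while k / n is at least the measure of \<open>E\<close>. For large
  \<open>n\<close> the arcs that meet \<open>E\<close> lie in \<open>U\<close>, where the
  logarithmic integral is under control.\<close>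

lemma null_of_entropy:
  assumes \<rho>: "\<rho> > 0" and near: "\<And>\<zeta> \<xi>. \<zeta> \<in> E \<Longrightarrow> norm \<xi> = 1 \<Longrightarrow> dist \<zeta> \<xi> < \<rho> \<Longrightarrow> \<xi> \<in> U"
  shows "measure circle_measure E = 0"
proof (cases "E = {}")
  case False
  have M: "M \<ge> 0" using bound_nonneg[OF False] .
  interpret cm: prob_space circle_measure by (rule prob_space_circle_measure)
  define C where "C = 8 * pi\<^sup>2 * M"
  have C: "C \<ge> 0" using M by (simp add: C_def)
  define \<mu> where "\<mu> = measure circle_measure E"
  have Em: "E \<in> sets borel" using E by simp
  have main: "\<mu> * ln (real n) \<le> s + C" if n: "real n > 2 * pi / \<rho>" "n \<ge> 1" for n :: nat
  proof -
    define a where "a i = 2 * pi * real i / real n" for i :: nat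
    define A where "A i = cis ` {a i..<a (Suc i)}" for i
    have a: "a (Suc i) = a i + 2 * pi / real n" for i by (simp add: a_def add_divide_distrib algebra_simps)
    have an: "2 * pi / real n < \<rho>" "2 * pi / real n > 0" "2 * pi / real n \<le> 2 * pi"
      using n \<rho> by (auto simp: field_simps)
    have range: "{a i..<a (Suc i)} \<subseteq> {0..<2*pi}" if "i < n" for i
    proof -
      have "a (Suc i) \<le> a n" unfolding a_def using that by (intro divide_right_mono mult_left_mono) auto
      moreover have "a n = 2 * pi" "a i \<ge> 0" using n by (auto simp: a_def)
      ultimately show ?thesis by auto
    qed
    define K where "K = {i. i < n \<and> A i \<inter> E \<noteq> {}}"
    have Kf: "finite K" by (simp add: K_def)
    have disj: "disjoint_family_on A K"
      unfolding disjoint_family_on_def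
    proof (intro ballI impI)
      fix i j assume ij: "i \<in> K" "j \<in> K" "i \<noteq> j"
      have mono: "a (Suc i) \<le> a j" if "i < j" for i j
        unfolding a_def using that by (intro divide_right_mono mult_left_mono) auto
      have "x \<noteq> y" if "x \<in> {a i..<a (Suc i)}" "y \<in> {a j..<a (Suc j)}" for x y
        using that ij(3) mono[of i j] mono[of j i] by (cases "i < j") auto
      moreover have "x = y" if "cis x = cis y" "x \<in> {0..<2*pi}" "y \<in> {0..<2*pi}" for x y
        using that by (intro cis_inj_lt) auto
      ultimately show "A i \<inter> A j = {}" using range[of i] range[of j] ij unfolding A_def K_def by blast
    qed
    have piece: "ennreal (1 / real n * ln (real n)) \<le> (\<integral>\<^sup>+t. indicator (A i) (cis t) * nlog (defect f (cis t)) \<partial>circ) + ennreal (C / real n)"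
      and AU: "A i \<subseteq> U" if i: "i \<in> K" for i
    proof -
      obtain v where "v \<in> A i" "v \<in> E" using i by (auto simp: K_def)
      then obtain c where c: "c \<in> {a i..<a (Suc i)}" "cis c \<in> E" unfolding A_def by blast
      have len: "a (Suc i) - a i = 2 * pi / real n" by (simp add: a)
      show "A i \<subseteq> U"
      proof
        fix \<xi> assume "\<xi> \<in> A i"
        then obtain x where x: "x \<in> {a i..<a (Suc i)}" "\<xi> = cis x" by (auto simp: A_def)
        have "dist (cis c) \<xi> \<le> \<bar>c - x\<bar>" using norm_cis_diff_le[of c x] x by (simp add: dist_norm)
        also have "\<dots> < \<rho>" using x c an len by auto
        finally show "\<xi> \<in> U" using near[OF c(2)] x by simp
      qed
      have "ennreal (1 / real n * ln (1 / (1 / real n))) \<le> (\<integral>\<^sup>+t. indicator (A i) (cis t) * nlog (defect f (cis t)) \<partial>circ) + ennreal (8 * pi\<^sup>2 * M * (1 / real n))"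
      proof (rule arc_entropy_le[OF f, of "a i" "a (Suc i)" c])
        show "a i < a (Suc i)" "a (Suc i) \<le> a i + 2 * pi" using an by (auto simp: a)
        show "c \<in> {a i..a (Suc i)}" using c by auto
        show "A i \<subseteq> cis ` {a i..a (Suc i)}" by (auto simp: A_def)
        show "A i \<in> sets borel" by (simp add: A_def borel_cis_image)
        show "1 / real n = (a (Suc i) - a i) / (2 * pi)" using len by simp
        show "(\<integral>\<^sup>+t. indicator (A i) (cis t) \<partial>circ) = ennreal (1 / real n)"
          unfolding A_def using an len by (subst nn_integral_arc(2)) (auto simp: a)
      qed (use bound c in auto)
      then show "ennreal (1 / real n * ln (real n)) \<le> (\<integral>\<^sup>+t. indicator (A i) (cis t) * nlog (defect f (cis t)) \<partial>circ) + ennreal (C / real n)"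
        by (simp add: C_def)
    qed
    have Asets: "A i \<in> sets borel" for i by (simp add: A_def borel_cis_image)
    have cardn: "card K \<le> n" using card_mono[of "{..<n}" K] by (auto simp: K_def)
    have cover: "E \<subseteq> (\<Union>i\<in>K. A i)"
    proof
      fix v assume v: "v \<in> E"
      then have "norm v = 1" using E by auto
      then have "v = cis (Arg2pi v)" by (simp add: complex_norm_eq_1_exp cis_conv_exp)
      then obtain t where t: "0 \<le> t" "t < 2 * pi" "v = cis t"
        using Arg2pi_ge_0[of v] Arg2pi_lt_2pi[of v] by blast
      define i where "i = nat \<lfloor>t * real n / (2 * pi)\<rfloor>"
      have i: "real i \<le> t * real n / (2 * pi)" "t * real n / (2 * pi) < real i + 1"
        using t by (auto simp: i_def)
      then have "t \<in> {a i..<a (Suc i)}" using n unfolding a_def by (simp add: field_simps)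
      then have "v \<in> A i" using t by (auto simp: A_def)
      moreover have "i < n"
      proof -
        have "t * real n / (2 * pi) < real n" using t n by (simp add: field_simps)
        then have "real i < real n" using i by linarith
        then show ?thesis by simp
      qed
      ultimately show "v \<in> (\<Union>i\<in>K. A i)" using v by (auto simp: K_def)
    qed
    have Ac: "A i \<in> sets circle_measure" for i
      using sets_circle_measureI[OF Asets[of i]] by (simp add: A_def Int_absorb2 image_subset_iff)
    have mA: "measure circle_measure (A i) = 1 / real n" for i
    proof -
      have "emeasure circle_measure (A i) = ennreal (1 / real n)"
        unfolding A_def using an by (subst emeasure_circle_measure) (auto simp: nn_integral_arc(2) a)
      then show ?thesis by (simp add: measure_def)
    qed
    have "\<mu> \<le> measure circle_measure (\<Union>i\<in>K. A i)"
      unfolding \<mu>_def using cover Ac by (intro cm.finite_measure_mono) auto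
    also have "\<dots> \<le> (\<Sum>i\<in>K. measure circle_measure (A i))"
      using Kf Ac by (intro cm.finite_measure_subadditive_finite) auto
    also have "\<dots> = real (card K) / real n" by (simp add: mA)
    finally have mu: "\<mu> \<le> real (card K) / real n" .
    have "ennreal (real (card K) * (1 / real n * ln (real n))) = (\<Sum>i\<in>K. ennreal (1 / real n * ln (real n)))"
      using n by (simp add: ennreal_of_nat_eq_real_of_nat ennreal_mult'[symmetric])
    also have "\<dots> \<le> (\<Sum>i\<in>K. (\<integral>\<^sup>+t. indicator (A i) (cis t) * nlog (defect f (cis t)) \<partial>circ) + ennreal (C / real n))"
      by (intro sum_mono piece)
    also have "\<dots> = (\<Sum>i\<in>K. (\<integral>\<^sup>+t. indicator (A i) (cis t) * nlog (defect f (cis t)) \<partial>circ)) + (\<Sum>i\<in>K. ennreal (C / real n))"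
      by (rule sum.distrib)
    also have "\<dots> \<le> ennreal s + ennreal C"
    proof (intro add_mono)
      show "(\<Sum>i\<in>K. (\<integral>\<^sup>+t. indicator (A i) (cis t) * nlog (defect f (cis t)) \<partial>circ)) \<le> ennreal s"
        using sum_nlog_le[OF f Kf disj AU Asets] fin by (rule order_trans)
      have "(\<Sum>i\<in>K. ennreal (C / real n)) = ennreal (\<Sum>i\<in>K. C / real n)" using C by (intro sum_ennreal) auto
      also have "\<dots> \<le> ennreal C"
      proof (rule ennreal_leI)
        have "real (card K) * C \<le> real n * C" using cardn C by (intro mult_right_mono) auto
        then show "(\<Sum>i\<in>K. C / real n) \<le> C" using n by (simp add: field_simps)
      qed
      finally show "(\<Sum>i\<in>K. ennreal (C / real n)) \<le> ennreal C" .
    qed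
    also have "\<dots> = ennreal (s + C)" using s C by simp
    finally have "real (card K) / real n * ln (real n) \<le> s + C"
      using s C by (subst (asm) ennreal_le_iff) auto
    moreover have "\<mu> * ln (real n) \<le> real (card K) / real n * ln (real n)"
      using mu n by (intro mult_right_mono) auto
    ultimately show ?thesis by linarith
  qed
  have "\<mu> = 0"
  proof (rule ccontr)
    assume "\<mu> \<noteq> 0"
    then have mu: "\<mu> > 0" using measure_nonneg[of circle_measure E] unfolding \<mu>_def by linarith
    obtain n :: nat where n: "real n > max (max (2 * pi / \<rho>) 1) (exp ((s + C) / \<mu>))"
      using reals_Archimedean2 by blast
    then have "exp ((s + C) / \<mu>) < real n" "real n > 1" "real n > 2 * pi / \<rho>" by auto
    then have "(s + C) / \<mu> < ln (real n)" by (metis exp_gt_zero ln_exp ln_less_cancel_iff order_less_trans)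
    then have "s + C < \<mu> * ln (real n)" using mu by (simp add: pos_divide_less_eq mult.commute)
    moreover have "n \<ge> 1" using \<open>real n > 1\<close> by linarith
    ultimately show False using main[of n] \<open>real n > 2 * pi / \<rho>\<close> by linarith
  qed
  then show ?thesis by (simp add: \<mu>_def)
qed simp

text \<open>The components are open because the circle is locally connected, and they are disjoint,
  so the compact set \<open>unit_circle - U\<close>, which misses \<open>E\<close>, meets only
  finitely many of them. The others lie where the logarithmic integral is under control.\<close>

lemma component_subset_or_finite:
  assumes Uopen: "open U" and EU: "E \<subseteq> U" and ne: "E \<noteq> {}"
  shows "finite {J \<in> components (unit_circle - E). \<not> J \<subseteq> U}"
proof -
  let ?Q = "components (unit_circle - E)"
  have op: "\<exists>V. open V \<and> J = unit_circle \<inter> V" if J: "J \<in> ?Q" for J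
  proof -
    have "openin (top_of_set (unit_circle - E)) J"
    proof (rule openin_components_locally_connected[OF _ J])
      have "openin (top_of_set unit_circle) (unit_circle - E)"
        using E by (auto intro!: openin_diff closed_subset)
      then show "locally connected (unit_circle - E)"
        using locally_connected_sphere[of "0::complex" 1] locally_open_subset by blast
    qed
    then obtain V where V: "open V" "J = (unit_circle - E) \<inter> V" by (auto simp: openin_open)
    show ?thesis by (rule exI[of _ "V \<inter> - E"]) (use V E in \<open>auto simp: open_Compl\<close>)
  qed
  then obtain V where V: "\<And>J. J \<in> ?Q \<Longrightarrow> open (V J)" "\<And>J. J \<in> ?Q \<Longrightarrow> J = unit_circle \<inter> V J" by metis
  have comp: "compact (unit_circle - U)" using Uopen by (simp add: compact_diff)
  have cov: "unit_circle - U \<subseteq> (\<Union>J\<in>?Q. V J)"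
  proof
    fix x assume x: "x \<in> unit_circle - U"
    then have "x \<in> \<Union>?Q" using EU Union_components[of "unit_circle - E"] by blast
    then show "x \<in> (\<Union>J\<in>?Q. V J)" using V(2) by blast
  qed
  obtain D where D: "D \<subseteq> ?Q" "finite D" "unit_circle - U \<subseteq> (\<Union>J\<in>D. V J)"
    by (rule compactE_image[OF comp, of ?Q V]) (use V(1) cov in auto)
  have "{J \<in> ?Q. \<not> J \<subseteq> U} \<subseteq> D"
  proof
    fix J assume J: "J \<in> {J \<in> ?Q. \<not> J \<subseteq> U}"
    then obtain x where x: "x \<in> J" "x \<notin> U" by blast
    then have "x \<in> unit_circle" using V(2)[of J] J by blast
    then obtain J' where J': "J' \<in> D" "x \<in> V J'" using D x by blast
    then have "x \<in> J'" using V(2)[of J'] D \<open>x \<in> unit_circle\<close> by blast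
    then have "J = J'" using J J' D x components_eq[of J "unit_circle - E" J'] by blast
    then show "J \<in> D" using J' by simp
  qed
  then show ?thesis using D finite_subset by blast
qed

text \<open>A complementary arc has its endpoints in \<open>E\<close>, so the estimate for one arc
  applies with \<open>c\<close> an endpoint. Over disjoint arcs inside \<open>U\<close> the
  integrals add up to at most \<open>s\<close>, and the errors to at most \<open>C\<close>, since
  the lengths sum to at most 1.\<close>

lemma entropy_summable:
  assumes Uopen: "open U" and EU: "E \<subseteq> U" and ne: "E \<noteq> {}"
  shows "(\<lambda>J. measure circle_measure J * ln (1 / measure circle_measure J)) summable_on components (unit_circle - E)"
proof -
  let ?Q = "components (unit_circle - E)"
  let ?h = "\<lambda>J. measure circle_measure J * ln (1 / measure circle_measure J)"
  define C where "C = 8 * pi\<^sup>2 * M"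
  have C: "C \<ge> 0" using bound_nonneg[OF ne] by (simp add: C_def)
  interpret cm: prob_space circle_measure by (rule prob_space_circle_measure)
  have piece: "ennreal (?h J) \<le> (\<integral>\<^sup>+t. indicator J (cis t) * nlog (defect f (cis t)) \<partial>circ) + ennreal (C * measure circle_measure J)"
    and meas: "J \<in> sets borel" "J \<subseteq> unit_circle" and nn: "?h J \<ge> 0" if J: "J \<in> ?Q" for J
  proof -
    obtain a b where ab: "a < b" "b \<le> a + 2 * pi" "J = cis ` {a<..<b}" "cis a \<in> E" "cis b \<in> E"
      using component_arc[OF E ne J] by blast
    have m: "measure circle_measure J = (b - a) / (2 * pi)" using ab by (simp add: measure_arc)
    show "ennreal (?h J) \<le> (\<integral>\<^sup>+t. indicator J (cis t) * nlog (defect f (cis t)) \<partial>circ) + ennreal (C * measure circle_measure J)"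
      unfolding C_def
    proof (rule arc_entropy_le[OF f ab(1,2), of a])
      show "(\<integral>\<^sup>+t. indicator J (cis t) \<partial>circ) = ennreal (measure circle_measure J)"
        unfolding m using ab by (simp add: nn_integral_arc(1))
    qed (use ab bound m borel_cis_image in auto)
    show "J \<in> sets borel" "J \<subseteq> unit_circle" using ab borel_cis_image by auto
    have "measure circle_measure J > 0" unfolding m using ab by simp
    moreover have "measure circle_measure J \<le> 1" by (rule cm.prob_le_1)
    ultimately show "?h J \<ge> 0" by simp
  qed
  have "?h summable_on {J \<in> ?Q. J \<subseteq> U}"
  proof (rule nonneg_bdd_above_summable_on)
    show "?h J \<ge> 0" if "J \<in> {J \<in> ?Q. J \<subseteq> U}" for J using nn that by blast
    show "bdd_above (sum ?h ` {F. F \<subseteq> {J \<in> ?Q. J \<subseteq> U} \<and> finite F})"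
    proof (rule bdd_aboveI2[of _ _ "s + C"])
      fix F assume "F \<in> {F. F \<subseteq> {J \<in> ?Q. J \<subseteq> U} \<and> finite F}"
      then have F: "finite F" "\<And>J. J \<in> F \<Longrightarrow> J \<in> ?Q" "\<And>J. J \<in> F \<Longrightarrow> J \<subseteq> U" by auto
      have disj: "disjoint_family_on (\<lambda>J. J) F"
        using F components_nonoverlap[of _ "unit_circle - E"] unfolding disjoint_family_on_def by blast
      have "ennreal (sum ?h F) = (\<Sum>J\<in>F. ennreal (?h J))"
        by (rule sum_ennreal[symmetric]) (use nn F in blast)
      also have "\<dots> \<le> (\<Sum>J\<in>F. (\<integral>\<^sup>+t. indicator J (cis t) * nlog (defect f (cis t)) \<partial>circ) + ennreal (C * measure circle_measure J))"
        by (intro sum_mono piece F)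
      also have "\<dots> = (\<Sum>J\<in>F. \<integral>\<^sup>+t. indicator J (cis t) * nlog (defect f (cis t)) \<partial>circ) + (\<Sum>J\<in>F. ennreal (C * measure circle_measure J))"
        by (rule sum.distrib)
      also have "\<dots> \<le> ennreal s + ennreal C"
      proof (intro add_mono)
        show "(\<Sum>J\<in>F. \<integral>\<^sup>+t. indicator J (cis t) * nlog (defect f (cis t)) \<partial>circ) \<le> ennreal s"
          using sum_nlog_le[OF f F(1) disj, of U] F meas fin by (meson order_trans)
        have "(\<Sum>J\<in>F. measure circle_measure J) \<le> 1"
          by (rule sum_measure_components_le) (use F meas in auto)
        then have "(\<Sum>J\<in>F. C * measure circle_measure J) \<le> C"
          using C by (simp add: sum_distrib_left[symmetric] mult_left_le)
        then show "(\<Sum>J\<in>F. ennreal (C * measure circle_measure J)) \<le> ennreal C"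
          using C by (subst sum_ennreal) (auto intro: ennreal_leI)
      qed
      also have "\<dots> = ennreal (s + C)" using s C by simp
      finally show "sum ?h F \<le> s + C" using s C by (subst (asm) ennreal_le_iff) auto
    qed
  qed
  moreover have "?h summable_on {J \<in> ?Q. \<not> J \<subseteq> U}"
    by (intro summable_on_finite component_subset_or_finite Uopen EU ne)
  ultimately have "?h summable_on ({J \<in> ?Q. J \<subseteq> U} \<union> {J \<in> ?Q. \<not> J \<subseteq> U})"
    by (rule summable_on_Un_disjoint) auto
  moreover have "{J \<in> ?Q. J \<subseteq> U} \<union> {J \<in> ?Q. \<not> J \<subseteq> U} = ?Q" by blast
  ultimately show ?thesis by simp
qed

end

lemma caratheodory_set_countable_union_BC:
  assumes f: "holo_self_map f" and I: "openin (top_of_set unit_circle) I" and li: "log_integral f I > -\<infinity>"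
  shows "countable_union_BC (caratheodory_set f \<inter> I)"
proof -
  have hol: "f holomorphic_on unit_disc" using f by (simp add: holo_self_map_def)
  obtain U where U: "open U" "I = unit_circle \<inter> U" using I by (auto simp: openin_open)
  define S where "S = (\<integral>\<^sup>+t. indicator U (cis t) * nlog (defect f (cis t)) \<partial>circ)"
  have "S \<noteq> \<infinity>" using li unfolding U(2) log_integral_eq[OF f U(1)] S_def[symmetric] by auto
  then obtain s where s: "S = ennreal s" "s \<ge> 0" by (cases S) auto
  \<comment> \<open>Besides the constant \<open>m\<close> of the linear bound, a distance
    \<open>1 / (k + 1)\<close> from the complement of \<open>U\<close> is fixed: \<open>I\<close> is
    only relatively open, and each piece has to be closed with a uniform neighbourhood inside
    \<open>U\<close>.\<close>
  define X where "X m k = {\<zeta> \<in> unit_circle. (\<forall>r\<in>{0..<1}. 1 - norm (f (of_real r * \<zeta>)) \<le> real m * (1 - r)) \<and>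
     (\<forall>\<eta>\<in>unit_circle - U. 1 / (real k + 1) \<le> dist \<zeta> \<eta>)}" for m k :: nat
  have clX: "closed (X m k)" for m k
  proof -
    have "X m k = unit_circle \<inter> (\<Inter>r\<in>{0..<1}. {\<zeta> \<in> unit_circle. 1 - norm (f (of_real r * \<zeta>)) \<le> real m * (1 - r)}) \<inter>
      (\<Inter>\<eta>\<in>unit_circle - U. {\<zeta>. 1 / (real k + 1) \<le> dist \<zeta> \<eta>})" by (auto simp: X_def)
    also have "closed \<dots>"
      by (intro closed_Int closed_INT ballI closed_Collect_le continuous_on_closed_Collect_le continuous_intros radial_continuous hol) auto
    finally show ?thesis .
  qed
  have BC: "beurling_carleson (X m k)" if ne: "X m k \<noteq> {}" for m k
    unfolding beurling_carleson_def
  proof (intro conjI clX)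
    show sub: "X m k \<subseteq> unit_circle" by (auto simp: X_def)
    have bd: "1 - norm (f (of_real r * \<zeta>)) \<le> real m * (1 - r)" if "\<zeta> \<in> X m k" "0 \<le> r" "r < 1" for \<zeta> r
      using that by (auto simp: X_def)
    have near: "\<xi> \<in> U" if "\<zeta> \<in> X m k" "norm \<xi> = 1" "dist \<zeta> \<xi> < 1 / (real k + 1)" for \<zeta> \<xi>
      using that by (force simp: X_def)
    have fin: "(\<integral>\<^sup>+t. indicator U (cis t) * nlog (defect f (cis t)) \<partial>circ) \<le> ennreal s"
      using s by (simp add: S_def)
    show "measure circle_measure (X m k) = 0"
      by (rule null_of_entropy[OF f clX sub bd fin s(2) _ near]) auto
    have XU: "X m k \<subseteq> U"
    proof
      fix \<zeta> assume z: "\<zeta> \<in> X m k"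
      then have "norm \<zeta> = 1" by (simp add: X_def)
      then show "\<zeta> \<in> U" using near[OF z, of \<zeta>] by simp
    qed
    show "(\<lambda>J. measure circle_measure J * ln (1 / measure circle_measure J)) summable_on components (unit_circle - X m k)"
      by (rule entropy_summable[OF f clX sub bd fin s(2) U(1) XU ne])
  qed
  have eq: "caratheodory_set f \<inter> I = (\<Union>m k. X m k)"
  proof (intro equalityI subsetI)
    fix \<zeta> assume z: "\<zeta> \<in> caratheodory_set f \<inter> I"
    then obtain M where M: "\<And>r. 0 \<le> r \<Longrightarrow> r < 1 \<Longrightarrow> 1 - norm (f (of_real r * \<zeta>)) \<le> M * (1 - r)"
      unfolding julia_caratheodory[OF f] by blast
    obtain m :: nat where m: "M \<le> real m" using real_arch_simple by blast
    have "\<zeta> \<in> U" "norm \<zeta> = 1" using z U by auto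
    then obtain e where e: "e > 0" "ball \<zeta> e \<subseteq> U" using U openE by blast
    obtain k :: nat where k: "1 / real (Suc k) < e" using e nat_approx_posE by blast
    have "1 - norm (f (of_real r * \<zeta>)) \<le> real m * (1 - r)" if "0 \<le> r" "r < 1" for r
    proof -
      have "M * (1 - r) \<le> real m * (1 - r)" using m that by (intro mult_right_mono) auto
      then show ?thesis using M[OF that] by linarith
    qed
    moreover have "1 / (real k + 1) \<le> dist \<zeta> \<eta>" if "\<eta> \<notin> U" for \<eta>
    proof (rule ccontr)
      assume "\<not> ?thesis"
      then have "dist \<zeta> \<eta> < 1 / (real k + 1)" by simp
      also have "\<dots> < e" using k by (simp add: add.commute)
      finally have "\<eta> \<in> ball \<zeta> e" by simp
      then show False using e that by blast
    qed
    ultimately have "\<zeta> \<in> X m k" using \<open>norm \<zeta> = 1\<close> by (auto simp: X_def)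
    then show "\<zeta> \<in> (\<Union>m k. X m k)" by blast
  next
    fix \<zeta> assume "\<zeta> \<in> (\<Union>m k. X m k)"
    then obtain m k where z: "\<zeta> \<in> X m k" by blast
    then have n: "norm \<zeta> = 1" and b: "\<forall>r\<in>{0..<1}. 1 - norm (f (of_real r * \<zeta>)) \<le> real m * (1 - r)"
      by (auto simp: X_def)
    have "\<zeta> \<in> U"
    proof (rule ccontr)
      assume "\<zeta> \<notin> U"
      then have "\<zeta> \<in> unit_circle - U" using n by simp
      moreover have "\<forall>\<eta>\<in>unit_circle - U. 1 / (real k + 1) \<le> dist \<zeta> \<eta>" using z by (simp add: X_def)
      ultimately have "1 / (real k + 1) \<le> dist \<zeta> \<zeta>" by blast
      moreover have "1 / (real k + 1) > 0" by simp
      ultimately show False by simp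
    qed
    moreover have "\<exists>M. \<forall>r. 0 \<le> r \<longrightarrow> r < 1 \<longrightarrow> 1 - norm (f (of_real r * \<zeta>)) \<le> M * (1 - r)"
      by (rule exI[of _ "real m"]) (use b in simp)
    ultimately show "\<zeta> \<in> caratheodory_set f \<inter> I" using n U(2) unfolding julia_caratheodory[OF f] by simp
  qed
  show ?thesis unfolding countable_union_BC_def
  proof (intro exI conjI)
    \<comment> \<open>Empty pieces are left out, as the description of components by arcs with
      endpoints in the set presupposes a nonempty set.\<close>
    show "countable ((\<lambda>(m, k). X m k) ` UNIV - {{}})" by (intro countable_Diff countable_image) auto
    show "\<forall>E\<in>(\<lambda>(m, k). X m k) ` UNIV - {{}}. beurling_carleson E" using BC by auto
    show "caratheodory_set f \<inter> I = \<Union> ((\<lambda>(m, k). X m k) ` UNIV - {{}})" unfolding eq by auto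
  qed
qed

section \<open>Self-maps with prescribed potentials\<close>

text \<open>For a Herglotz integral this is the classical quantity that decides about angular
  derivatives. In \<open>ennreal\<close>, \<open>inverse 0 = \<infinity>\<close>, so a point mass at
  \<open>\<zeta>\<close> makes it infinite. The measure comes with a map \<open>X\<close> into the
  circle so that it may live on angles or on an index set.\<close>

definition inverse_square_potential :: "'a measure \<Rightarrow> ('a \<Rightarrow> complex) \<Rightarrow> complex \<Rightarrow> ennreal" where
  "inverse_square_potential M X \<zeta> = (\<integral>\<^sup>+x. inverse (ennreal ((norm (X x - \<zeta>))\<^sup>2)) \<partial>M)"

text \<open>The integrand \<open>h\<close> is the Herglotz kernel, whose real part is the Poisson
  kernel. Holomorphy comes from its expansion 1 + 2 (cnj X) z + 2 (cnj X)^2 z^2 + ..., integrated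
  term by term into a power series; hence the exceptional value of \<open>c\<close> at index
  0.\<close>

lemma herglotz_integral:
  assumes "finite_measure M" and [measurable]: "X \<in> borel_measurable M"
    and X: "\<And>x. norm (X x) = 1"
  obtains g where "g holomorphic_on unit_disc"
    "\<And>z. z \<in> unit_disc \<Longrightarrow> ennreal (Re (g z)) = (\<integral>\<^sup>+x. ennreal (poisson z (X x)) \<partial>M)"
    "\<And>z. z \<in> unit_disc \<Longrightarrow> Re (g z) \<ge> 0"
proof -
  interpret finite_measure M by fact
  define h where "h z x = (X x + z) / (X x - z)" for z x
  define c where "c n x = (if n = 0 then 1 else 2 * cnj (X x) ^ n)" for n :: nat and x
  have inv: "X x * cnj (X x) = 1" for x by (simp add: complex_norm_square[symmetric] X)
  have X0: "X x \<noteq> 0" for x using X[of x] by auto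
  have [measurable]: "(\<lambda>x. cnj (X x)) \<in> borel_measurable M"
    by (rule measurable_compose[OF assms(2) borel_measurable_continuous_onI]) (intro continuous_intros)
  have sums: "(\<lambda>n. c n x * z ^ n) sums h z x" if z: "norm z < 1" for z x
  proof -
    have n: "norm (cnj (X x) * z) < 1" using z X by (simp add: norm_mult)
    then have "(\<lambda>n. (cnj (X x) * z) ^ n) sums (1 / (1 - cnj (X x) * z))" by (rule geometric_sums)
    then have "(\<lambda>n. 2 * (cnj (X x) * z) ^ n) sums (2 * (1 / (1 - cnj (X x) * z)))" by (rule sums_mult)
    moreover have "(\<lambda>n. if n = 0 then - 1 else 0) sums (- 1 :: complex)" using sums_single[of 0 "\<lambda>_. - 1 :: complex"] by (simp add: eq_commute)
    ultimately have "(\<lambda>n. 2 * (cnj (X x) * z) ^ n + (if n = 0 then - 1 else 0)) sums (2 * (1 / (1 - cnj (X x) * z)) + - 1)"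
      by (rule sums_add)
    moreover have "(\<lambda>n. 2 * (cnj (X x) * z) ^ n + (if n = 0 then - 1 else 0)) = (\<lambda>n. c n x * z ^ n)"
      by (auto simp: c_def power_mult_distrib)
    moreover have "2 * (1 / (1 - cnj (X x) * z)) + - 1 = h z x"
    proof -
      have eq: "X x - z = X x * (1 - cnj (X x) * z)" "X x + z = X x * (1 + cnj (X x) * z)"
        using inv[of x] by (simp_all add: algebra_simps)
      have "1 - cnj (X x) * z \<noteq> 0" using n by auto
      then show ?thesis unfolding h_def eq using X0[of x] by (simp add: field_simps)
    qed
    ultimately show ?thesis by simp
  qed
  have cn: "norm (c n x) \<le> 2" for n x by (simp add: c_def norm_mult norm_power X)
  have cm [measurable]: "c n \<in> borel_measurable M" for n unfolding c_def by measurable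
  have hm [measurable]: "h z \<in> borel_measurable M" for z unfolding h_def by measurable
  have hint: "integrable M (h z)" if z: "norm z < 1" for z
  proof (rule integrable_const_bound[of _ "2 / (1 - norm z)"])
    have "norm (h z x) \<le> 2 / (1 - norm z)" for x
      unfolding h_def norm_divide
    proof (rule frac_le)
      show "norm (X x + z) \<le> 2" using norm_triangle_ineq[of "X x" z] X[of x] z by simp
      show "1 - norm z \<le> norm (X x - z)" using norm_triangle_ineq2[of "X x" z] X[of x] by simp
    qed (use z in auto)
    then show "AE x in M. norm (h z x) \<le> 2 / (1 - norm z)" by simp
  qed measurable
  define g where "g z = (\<integral>x. h z x \<partial>M)" for z
  show thesis
  proof (rule that[of g])
    show "g holomorphic_on unit_disc"
    proof (rule power_series_holomorphic)
      fix z :: complex assume "z \<in> ball 0 1"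
      then have z: "norm z < 1" by simp
      have int: "integrable M (\<lambda>x. c n x * z ^ n)" for n
        by (rule integrable_const_bound[of _ "2 * norm z ^ n"])
          (auto simp: norm_mult norm_power intro!: mult_right_mono cn)
      have "(\<lambda>n. \<integral>x. c n x * z ^ n \<partial>M) sums (\<integral>x. (\<Sum>n. c n x * z ^ n) \<partial>M)"
      proof (rule sums_integral[OF int])
        have geo: "summable (\<lambda>n. 2 * norm z ^ n)" using z by (intro summable_mult summable_geometric) simp
        show "AE x in M. summable (\<lambda>n. norm (c n x * z ^ n))"
          by (intro AE_I2 summable_comparison_test'[OF geo, of 0]) (auto simp: norm_mult norm_power intro!: mult_right_mono cn)
        have "summable (\<lambda>n. 2 * norm z ^ n * measure M (space M))" using geo by (rule summable_mult2)
        then show "summable (\<lambda>n. \<integral>x. norm (c n x * z ^ n) \<partial>M)"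
        proof (rule summable_comparison_test'[of _ 0])
          fix n
          have "(\<integral>x. norm (c n x * z ^ n) \<partial>M) \<le> (\<integral>x. 2 * norm z ^ n \<partial>M)"
            by (intro integral_mono integrable_norm[OF int]) (auto simp: norm_mult norm_power intro!: mult_right_mono cn)
          then show "norm (\<integral>x. norm (c n x * z ^ n) \<partial>M) \<le> 2 * norm z ^ n * measure M (space M)"
            by (simp add: mult_ac)
        qed
      qed
      moreover have "(\<integral>x. (\<Sum>n. c n x * z ^ n) \<partial>M) = g z"
        unfolding g_def using sums[OF z] by (intro Bochner_Integration.integral_cong) (auto simp: sums_iff)
      moreover have "(\<integral>x. c n x * z ^ n \<partial>M) = (\<integral>x. c n x \<partial>M) * z ^ n" for n by simp
      ultimately show "(\<lambda>n. (\<integral>x. c n x \<partial>M) * (z - 0) ^ n) sums g z" by simp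
    qed
    fix z :: complex assume "z \<in> unit_disc"
    then have z: "norm z < 1" by simp
    have Re: "Re (h z x) = poisson z (X x)" for x
      unfolding h_def poisson_def using z X[of x] by (intro Re_cayley) auto
    have "Re (g z) = (\<integral>x. poisson z (X x) \<partial>M)"
      unfolding g_def Re[symmetric] using hint[OF z] by simp
    moreover have "integrable M (\<lambda>x. poisson z (X x))"
      unfolding Re[symmetric] using hint[OF z] by simp
    ultimately show "ennreal (Re (g z)) = (\<integral>\<^sup>+x. ennreal (poisson z (X x)) \<partial>M)" "Re (g z) \<ge> 0"
      using poisson_nonneg[of z] z by (auto simp: nn_integral_eq_integral)
  qed
qed

text \<open>By |X - \<zeta>| <= 2 |X - r \<zeta>| the Poisson kernel is at most 8 (1 - r) / |X -
  \<zeta>|^2, which settles one direction. For the other, the Poisson integrals divided by 1 - r^2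
  stay bounded, and Fatou's lemma along \<open>approach n\<close> bounds the potential.\<close>

lemma radial_bound_iff_potential_finite:
  assumes [measurable]: "X \<in> borel_measurable M" and X: "\<And>x. norm (X x) = 1"
    and g: "\<And>z. z \<in> unit_disc \<Longrightarrow> ennreal (Re (g z)) = (\<integral>\<^sup>+x. ennreal (poisson z (X x)) \<partial>M)"
      "\<And>z. z \<in> unit_disc \<Longrightarrow> Re (g z) \<ge> 0"
    and \<zeta>: "norm \<zeta> = 1"
  shows "(\<exists>B. \<forall>r. 0 \<le> r \<longrightarrow> r < 1 \<longrightarrow> Re (g (of_real r * \<zeta>)) \<le> B * (1 - r))
    \<longleftrightarrow> inverse_square_potential M X \<zeta> < \<infinity>"
proof
  assume "inverse_square_potential M X \<zeta> < \<infinity>"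
  then obtain V where V: "inverse_square_potential M X \<zeta> = ennreal V" "V \<ge> 0"
    by (cases "inverse_square_potential M X \<zeta>") auto
  have "Re (g (of_real r * \<zeta>)) \<le> 8 * V * (1 - r)" if r: "0 \<le> r" "r < 1" for r
  proof -
    have nz: "norm (of_real r * \<zeta>) = r" using r \<zeta> by (simp add: norm_mult)
    have "ennreal (Re (g (of_real r * \<zeta>))) = (\<integral>\<^sup>+x. ennreal (poisson (of_real r * \<zeta>) (X x)) \<partial>M)"
      using nz r by (intro g) simp
    also have "\<dots> \<le> (\<integral>\<^sup>+x. ennreal (8 * (1 - r)) * inverse (ennreal ((norm (X x - \<zeta>))\<^sup>2)) \<partial>M)"
    proof (rule nn_integral_mono)
      fix x
      show "ennreal (poisson (of_real r * \<zeta>) (X x)) \<le> ennreal (8 * (1 - r)) * inverse (ennreal ((norm (X x - \<zeta>))\<^sup>2))"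
      proof (cases "X x = \<zeta>")
        case True
        then show ?thesis using r by (simp add: ennreal_mult_top)
      next
        case False
        then have d: "norm (X x - \<zeta>) > 0" by simp
        define w where "w = norm (X x - of_real r * \<zeta>)"
        have "of_real r * \<zeta> - \<zeta> = of_real (r - 1) * \<zeta>" by (simp add: algebra_simps)
        also have "norm (of_real (r - 1) * \<zeta>) = 1 - r" unfolding norm_mult norm_of_real using r \<zeta> by simp
        finally have "norm (of_real r * \<zeta> - \<zeta>) = 1 - r" .
        moreover have "1 - r \<le> w" unfolding w_def using norm_triangle_ineq2[of "X x" "of_real r * \<zeta>"] X[of x] nz by simp
        moreover have "norm (X x - \<zeta>) \<le> w + norm (of_real r * \<zeta> - \<zeta>)"
          unfolding w_def using norm_triangle_ineq[of "X x - of_real r * \<zeta>" "of_real r * \<zeta> - \<zeta>"] by simp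
        ultimately have "norm (X x - \<zeta>) \<le> 2 * w" and w: "w > 0" using r by auto
        then have "(norm (X x - \<zeta>))\<^sup>2 \<le> (2 * w)\<^sup>2" by (intro power_mono) auto
        then have w2: "(norm (X x - \<zeta>))\<^sup>2 \<le> 4 * w\<^sup>2" by (simp add: power_mult_distrib)
        have "1 - r\<^sup>2 = (1 - r) * (1 + r)" by (simp add: power2_eq_square algebra_simps)
        also have "\<dots> \<le> (1 - r) * 2" using r by (intro mult_left_mono) auto
        finally have r2: "1 - r\<^sup>2 \<le> 2 * (1 - r)" by simp
        have "poisson (of_real r * \<zeta>) (X x) = (1 - r\<^sup>2) / w\<^sup>2" by (simp add: poisson_def nz w_def)
        also have "\<dots> \<le> 2 * (1 - r) / ((norm (X x - \<zeta>))\<^sup>2 / 4)"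
          using r2 w2 d r by (intro frac_le) auto
        also have "\<dots> = 8 * (1 - r) * inverse ((norm (X x - \<zeta>))\<^sup>2)" using d by (simp add: field_simps)
        finally have "ennreal (poisson (of_real r * \<zeta>) (X x)) \<le> ennreal (8 * (1 - r) * inverse ((norm (X x - \<zeta>))\<^sup>2))"
          by (rule ennreal_leI)
        also have "\<dots> = ennreal (8 * (1 - r)) * inverse (ennreal ((norm (X x - \<zeta>))\<^sup>2))"
          using r d by (subst inverse_ennreal) (auto intro!: ennreal_mult')
        finally show ?thesis .
      qed
    qed
    also have "\<dots> = ennreal (8 * (1 - r)) * ennreal V"
      unfolding V(1)[symmetric] inverse_square_potential_def by (rule nn_integral_cmult) measurable
    also have "\<dots> = ennreal (8 * V * (1 - r))" using r V by (simp add: ennreal_mult'[symmetric] mult_ac)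
    finally show ?thesis using r V by (subst (asm) ennreal_le_iff) auto
  qed
  then show "\<exists>B. \<forall>r. 0 \<le> r \<longrightarrow> r < 1 \<longrightarrow> Re (g (of_real r * \<zeta>)) \<le> B * (1 - r)" by blast
next
  assume "\<exists>B. \<forall>r. 0 \<le> r \<longrightarrow> r < 1 \<longrightarrow> Re (g (of_real r * \<zeta>)) \<le> B * (1 - r)"
  then obtain B where B: "\<And>r. 0 \<le> r \<Longrightarrow> r < 1 \<Longrightarrow> Re (g (of_real r * \<zeta>)) \<le> B * (1 - r)" by blast
  define z where "z n = of_real (approach n) * \<zeta>" for n
  have nz: "norm (z n) = approach n" for n using approach[of n] \<zeta> by (simp add: z_def norm_mult)
  have zlim: "z \<longlonglongrightarrow> \<zeta>"
    using tendsto_mult[OF tendsto_of_real[OF approach_lim] tendsto_const[of \<zeta>]] by (simp add: z_def[abs_def])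
  have le: "(\<integral>\<^sup>+x. inverse (ennreal ((norm (X x - z n))\<^sup>2)) \<partial>M) \<le> ennreal B" for n
  proof -
    have r: "0 \<le> approach n" "approach n < 1" using approach[of n] by auto
    have p: "1 - approach n \<le> 1 - (approach n)\<^sup>2" using r by (simp add: power2_eq_square mult_left_le)
    have "inverse (ennreal ((norm (X x - z n))\<^sup>2)) = ennreal (1 / (1 - (approach n)\<^sup>2)) * ennreal (poisson (z n) (X x))" for x
    proof -
      have "X x \<noteq> z n" using X[of x] nz[of n] r by auto
      then show ?thesis using p r by (subst inverse_ennreal) (auto simp: poisson_def nz ennreal_mult'[symmetric] field_simps)
    qed
    then have "(\<integral>\<^sup>+x. inverse (ennreal ((norm (X x - z n))\<^sup>2)) \<partial>M) = ennreal (1 / (1 - (approach n)\<^sup>2)) * (\<integral>\<^sup>+x. ennreal (poisson (z n) (X x)) \<partial>M)"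
      by (simp add: nn_integral_cmult)
    also have "(\<integral>\<^sup>+x. ennreal (poisson (z n) (X x)) \<partial>M) = ennreal (Re (g (z n)))"
      using nz r by (intro g(1)[symmetric]) simp
    also have "ennreal (1 / (1 - (approach n)\<^sup>2)) * ennreal (Re (g (z n))) = ennreal (Re (g (z n)) / (1 - (approach n)\<^sup>2))"
      using p r by (subst ennreal_mult'[symmetric]) auto
    also have "\<dots> \<le> ennreal B"
    proof (rule ennreal_leI)
      have "Re (g (z n)) \<le> B * (1 - approach n)" unfolding z_def by (rule B[OF r])
      moreover have "Re (g (z n)) \<ge> 0" using nz[of n] r by (intro g(2)) simp
      ultimately have "B * (1 - approach n) \<ge> 0" by linarith
      then have "B \<ge> 0" using r by (simp add: zero_le_mult_iff)
      then have "B * (1 - approach n) \<le> B * (1 - (approach n)\<^sup>2)" using p by (rule mult_left_mono[rotated])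
      then show "Re (g (z n)) / (1 - (approach n)\<^sup>2) \<le> B"
        using \<open>Re (g (z n)) \<le> B * (1 - approach n)\<close> p r by (simp add: pos_divide_le_eq)
    qed
    finally show ?thesis .
  qed
  have "inverse_square_potential M X \<zeta> = (\<integral>\<^sup>+x. liminf (\<lambda>n. inverse (ennreal ((norm (X x - z n))\<^sup>2))) \<partial>M)"
    unfolding inverse_square_potential_def
  proof (intro nn_integral_cong lim_imp_Liminf[symmetric])
    fix x
    have "(\<lambda>n. ennreal ((norm (X x - z n))\<^sup>2)) \<longlonglongrightarrow> ennreal ((norm (X x - \<zeta>))\<^sup>2)"
      by (intro tendsto_intros zlim)
    then show "(\<lambda>n. inverse (ennreal ((norm (X x - z n))\<^sup>2))) \<longlonglongrightarrow> inverse (ennreal ((norm (X x - \<zeta>))\<^sup>2))"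
      by (rule continuous_on_tendsto_compose[of UNIV inverse, OF continuous_on_inverse_ennreal[OF continuous_on_id]]) auto
  qed simp
  also have "\<dots> \<le> liminf (\<lambda>n. \<integral>\<^sup>+x. inverse (ennreal ((norm (X x - z n))\<^sup>2)) \<partial>M)"
    by (rule nn_integral_liminf) measurable
  also have "\<dots> \<le> liminf (\<lambda>n. ennreal B)" by (intro Liminf_mono always_eventually allI le)
  also have "\<dots> = ennreal B" by (simp add: Liminf_const)
  finally show "inverse_square_potential M X \<zeta> < \<infinity>" by (rule le_less_trans) simp
qed

text \<open>With u = Re g, always 1 - exp (- u) <= u, and conversely u exp (- u) <= 1 - exp (- u). A
  bound \<open>K * (1 - r)\<close> forces exp (- u) >= 1/2 once r > 1 - 1 / (2 K); before that,
  compactness of the segment bounds u by \<open>B\<close>. The constant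
  \<open>2 * K * B + 2 * K\<close> serves both ranges.\<close>

lemma caratheodory_set_exp:
  assumes hol: "g holomorphic_on unit_disc" and pos: "\<And>z. z \<in> unit_disc \<Longrightarrow> Re (g z) > 0"
  shows "holo_self_map (\<lambda>z. exp (- g z))"
    "caratheodory_set (\<lambda>z. exp (- g z)) = {\<zeta> \<in> unit_circle. \<exists>B. \<forall>r. 0 \<le> r \<longrightarrow> r < 1 \<longrightarrow> Re (g (of_real r * \<zeta>)) \<le> B * (1 - r)}"
proof -
  show self: "holo_self_map (\<lambda>z. exp (- g z))"
    unfolding holo_self_map_def using pos by (auto intro!: holomorphic_intros hol)
  show "caratheodory_set (\<lambda>z. exp (- g z)) = {\<zeta> \<in> unit_circle. \<exists>B. \<forall>r. 0 \<le> r \<longrightarrow> r < 1 \<longrightarrow> Re (g (of_real r * \<zeta>)) \<le> B * (1 - r)}"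
    unfolding julia_caratheodory[OF self] norm_exp_eq_Re
  proof (intro Collect_cong conj_cong refl iffI)
    fix \<zeta> :: complex assume "\<zeta> \<in> unit_circle"
    then have \<zeta>: "norm \<zeta> = 1" by simp
    {
      assume "\<exists>M. \<forall>r. 0 \<le> r \<longrightarrow> r < 1 \<longrightarrow> 1 - exp (Re (- g (of_real r * \<zeta>))) \<le> M * (1 - r)"
      then obtain M where M: "\<And>r. 0 \<le> r \<Longrightarrow> r < 1 \<Longrightarrow> 1 - exp (- Re (g (of_real r * \<zeta>))) \<le> M * (1 - r)" by auto
      define K where "K = max M 1"
      have K: "K \<ge> 1" "1 - exp (- Re (g (of_real r * \<zeta>))) \<le> K * (1 - r)" if "0 \<le> r" "r < 1" for r
      proof -
        have "M * (1 - r) \<le> K * (1 - r)" using that by (intro mult_right_mono) (auto simp: K_def)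
        then show "1 - exp (- Re (g (of_real r * \<zeta>))) \<le> K * (1 - r)" using M[OF that] by linarith
      qed (simp add: K_def)
      have K1: "K \<ge> 1" by (simp add: K_def)
      define \<rho> where "\<rho> = 1 - 1 / (2 * K)"
      have \<rho>: "0 \<le> \<rho>" "\<rho> < 1" using K1 by (auto simp: \<rho>_def field_simps)
      have cont: "continuous_on {0..\<rho>} (\<lambda>r. Re (g (of_real r * \<zeta>)))"
        by (intro continuous_intros continuous_on_compose2[OF holomorphic_on_imp_continuous_on[OF hol]])
          (use \<rho> \<zeta> in \<open>auto simp: norm_mult\<close>)
      obtain B where B: "\<And>r. r \<in> {0..\<rho>} \<Longrightarrow> Re (g (of_real r * \<zeta>)) \<le> B"
      proof -
        have "{0..\<rho>} \<noteq> {}" using \<rho> by simp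
        from continuous_attains_sup[OF compact_Icc this cont] show thesis using that by blast
      qed
      have "0 < B" using B[of 0] pos[of 0] \<rho> by simp
      show "\<exists>B. \<forall>r. 0 \<le> r \<longrightarrow> r < 1 \<longrightarrow> Re (g (of_real r * \<zeta>)) \<le> B * (1 - r)"
      proof (intro exI allI impI)
        fix r :: real assume r: "0 \<le> r" "r < 1"
        let ?u = "Re (g (of_real r * \<zeta>))"
        have Bp: "2 * K * B \<ge> 0" "2 * K \<ge> 0" using K1 \<open>0 < B\<close> by auto
        show "?u \<le> (2 * K * B + 2 * K) * (1 - r)"
        proof (cases "r \<le> \<rho>")
          case True
          have "1 / (2 * K) \<le> 1 - r" using True by (simp add: \<rho>_def)
          then have "1 \<le> 2 * K * (1 - r)" using K1 by (simp add: field_simps)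
          then have "B * 1 \<le> B * (2 * K * (1 - r))" using \<open>0 < B\<close> by (intro mult_left_mono) auto
          moreover have "2 * K * (1 - r) \<ge> 0" using K1 r by simp
          ultimately show ?thesis using B[of r] True r by (simp add: algebra_simps)
        next
          case False
          then have "1 - r < 1 / (2 * K)" by (simp add: \<rho>_def)
          then have half: "K * (1 - r) < 1 / 2" using K1 by (simp add: field_simps)
          have nz: "of_real r * \<zeta> \<in> unit_disc" using r \<zeta> by (simp add: norm_mult)
          have u: "?u > 0" by (rule pos[OF nz])
          have e1: "1 - exp (- ?u) \<le> K * (1 - r)" by (rule K(2)[OF r])
          then have e2: "exp (- ?u) \<ge> 1 / 2" using half by linarith
          have "?u * exp (- ?u) \<le> 1 - exp (- ?u)"
          proof -
            have "1 + ?u \<le> exp ?u" by (rule exp_ge_add_one_self)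
            then have "(1 + ?u) * exp (- ?u) \<le> exp ?u * exp (- ?u)" by (intro mult_right_mono) auto
            then show ?thesis by (simp add: algebra_simps exp_minus)
          qed
          moreover have "?u * (1 / 2) \<le> ?u * exp (- ?u)" using e2 u by (intro mult_left_mono) auto
          ultimately have "?u \<le> 2 * K * (1 - r)" using e1 by linarith
          moreover have "2 * K * B * (1 - r) \<ge> 0" using Bp r by simp
          ultimately show ?thesis by (simp add: algebra_simps)
        qed
      qed
    next
      assume "\<exists>B. \<forall>r. 0 \<le> r \<longrightarrow> r < 1 \<longrightarrow> Re (g (of_real r * \<zeta>)) \<le> B * (1 - r)"
      then obtain B where B: "\<And>r. 0 \<le> r \<Longrightarrow> r < 1 \<Longrightarrow> Re (g (of_real r * \<zeta>)) \<le> B * (1 - r)" by blast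
      have "1 - exp (Re (- g (of_real r * \<zeta>))) \<le> B * (1 - r)" if r: "0 \<le> r" "r < 1" for r
        using B[OF r] exp_ge_add_one_self[of "- Re (g (of_real r * \<zeta>))"] by simp
      then show "\<exists>M. \<forall>r. 0 \<le> r \<longrightarrow> r < 1 \<longrightarrow> 1 - exp (Re (- g (of_real r * \<zeta>))) \<le> M * (1 - r)" by blast
    }
  qed
qed

section \<open>Logarithmic distance to a Beurling-Carleson set\<close>

lemma nlog_ennreal: "y > 0 \<Longrightarrow> nlog (ennreal y) = ennreal (- ln y)"
  by (simp add: nlog_def ennreal_eq_0_iff)

lemma nlog_antimono: "x \<le> y \<Longrightarrow> nlog y \<le> nlog x"
proof (cases "x = 0 \<or> y = \<infinity>")
  case True
  \<comment> \<open>Since \<open>enn2real \<infinity> = 0\<close> and \<open>ln 0 = 0\<close>, the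
    value \<open>nlog \<infinity>\<close> is 0, the least one.\<close>
  then show ?thesis by (auto simp: nlog_def)
next
  case False
  assume le: "x \<le> y"
  obtain b where b: "y = ennreal b" "b \<ge> 0" using False by (cases y) auto
  obtain a where a: "x = ennreal a" "a \<ge> 0" using False le b by (cases x) (auto simp: top_unique)
  have "a > 0" "a \<le> b" using False le a b by (auto simp: ennreal_le_iff)
  then show ?thesis unfolding a(1) b(1) by (simp add: nlog_ennreal ennreal_leI)
qed

text \<open>Since \<open>infdist \<xi> {} = 0\<close>, this is meaningful only for nonempty \<open>E\<close>.\<close>

definition log_dist :: "complex set \<Rightarrow> complex \<Rightarrow> ennreal" where
  "log_dist E \<xi> = nlog (ennreal (infdist \<xi> E))"

lemma log_dist_measurable [measurable]: "log_dist E \<in> borel_measurable borel"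
proof -
  have "(\<lambda>\<xi>. infdist \<xi> E) \<in> borel_measurable borel"
    by (intro borel_measurable_continuous_onI continuous_intros)
  then show ?thesis unfolding log_dist_def by measurable
qed

text \<open>Splitting \<open>- ln (x / 3)\<close> as \<open>ln (1 / l) + ln (3 * l / x)\<close>
  isolates the entropy term. The rest is at most \<open>2 * sqrt (3 * l / x)\<close>, a power with
  an explicit integral. The 3 is the constant of \<open>jordan_chord\<close>.\<close>

lemma nn_integral_nlog_le:
  assumes L: "0 < L" "L \<le> 2 * pi"
  defines "l \<equiv> L / (2 * pi)"
  shows "(\<integral>\<^sup>+x\<in>{0..L}. nlog (ennreal (x / 3)) \<partial>lborel) \<le> ennreal (L * ln (1 / l) + 4 * L)"
proof -
  have l: "l > 0" "l \<le> 1" using L by (auto simp: l_def)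
  have hi: "((\<lambda>x. x powr (-1/2)) has_integral (L powr (-1/2 + 1) / (-1/2 + 1))) {0..L}"
    by (rule has_integral_powr_from_0) (use L in auto)
  have int: "(\<integral>\<^sup>+x. ennreal (indicator {0..L} x * x powr (-1/2)) \<partial>lborel) = ennreal (2 * sqrt L)"
    using nn_integral_has_integral_lebesgue[OF _ hi] L by (simp add: powr_half_sqrt)
  have "(\<integral>\<^sup>+x\<in>{0..L}. nlog (ennreal (x / 3)) \<partial>lborel)
     \<le> (\<integral>\<^sup>+x. ennreal (ln (1 / l)) * indicator {0..L} x + ennreal (2 * sqrt (3 * l)) * ennreal (indicator {0..L} x * x powr (-1/2)) \<partial>lborel)"
  proof (rule nn_integral_mono_AE)
    show "AE x in lborel. nlog (ennreal (x / 3)) * indicator {0..L} x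
      \<le> ennreal (ln (1 / l)) * indicator {0..L} x + ennreal (2 * sqrt (3 * l)) * ennreal (indicator {0..L} x * x powr (-1/2))"
      using AE_lborel_singleton[of 0]
    proof eventually_elim
      case (elim x)
      show ?case
      proof (cases "x \<in> {0..L}")
        case True
        then have x: "x > 0" using elim by simp
        have ln2: "ln y \<le> 2 * sqrt y" if "y > 0" for y :: real
        proof -
          have "ln (sqrt y) \<le> sqrt y - 1" using that by (intro ln_le_minus_one) simp
          then show ?thesis using that by (simp add: ln_sqrt)
        qed
        have "- ln (x / 3) = ln (1 / l) + ln (3 * l / x)" using x l by (simp add: ln_div ln_mult)
        also have "\<dots> \<le> ln (1 / l) + 2 * sqrt (3 * l / x)" using ln2[of "3 * l / x"] x l by simp
        also have "sqrt (3 * l / x) = sqrt (3 * l) * x powr (-1/2)"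
        proof -
          have "x powr (-1/2) = 1 / sqrt x" using x powr_minus_divide[of x "1/2"] by (simp add: powr_half_sqrt)
          then show ?thesis by (simp only: real_sqrt_divide times_divide_eq_right mult_1_right)
        qed
        finally have "- ln (x / 3) \<le> ln (1 / l) + 2 * sqrt (3 * l) * x powr (-1/2)" by simp
        then have "nlog (ennreal (x / 3)) \<le> ennreal (ln (1 / l) + 2 * sqrt (3 * l) * x powr (-1/2))"
          using x by (simp add: nlog_ennreal ennreal_leI)
        also have "\<dots> = ennreal (ln (1 / l)) + ennreal (2 * sqrt (3 * l)) * ennreal (x powr (-1/2))"
          using l by (simp add: ennreal_mult'[symmetric])
        finally show ?thesis using True by simp
      qed simp
    qed
  qed
  also have "\<dots> = ennreal (ln (1 / l)) * ennreal L + ennreal (2 * sqrt (3 * l)) * ennreal (2 * sqrt L)"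
  proof -
    have "(\<integral>\<^sup>+x. ennreal (2 * sqrt (3 * l)) * ennreal (indicator {0..L} x * x powr (-1/2)) \<partial>lborel)
       = ennreal (2 * sqrt (3 * l)) * (\<integral>\<^sup>+x. ennreal (indicator {0..L} x * x powr (-1/2)) \<partial>lborel)"
      by (rule nn_integral_cmult) measurable
    moreover have "(\<integral>\<^sup>+x. ennreal (ln (1 / l)) * indicator {0..L} x \<partial>lborel) = ennreal (ln (1 / l)) * ennreal L"
      using L by (simp add: nn_integral_cmult_indicator)
    ultimately show ?thesis unfolding int by (subst nn_integral_add) (simp_all only:, measurable)
  qed
  also have "\<dots> = ennreal (ln (1 / l) * L + 2 * sqrt (3 * l) * (2 * sqrt L))"
    using l L by (simp add: ennreal_mult'[symmetric])
  also have "\<dots> \<le> ennreal (L * ln (1 / l) + 4 * L)"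
  proof (rule ennreal_leI)
    have "3 * l \<le> L" using pi_gt3 L by (simp add: l_def field_simps)
    then have "sqrt (3 * l) * sqrt L \<le> sqrt L * sqrt L" using L by (intro mult_right_mono) auto
    also have "\<dots> = L" using L by simp
    finally show "ln (1 / l) * L + 2 * sqrt (3 * l) * (2 * sqrt L) \<le> L * ln (1 / l) + 4 * L" by (simp add: mult_ac)
  qed
  finally show ?thesis .
qed

text \<open>Every point of \<open>E\<close> has an angle \<open>s\<close> within pi of
  \<open>t\<close>, where chord and arc are comparable, and \<open>s\<close> cannot lie in the
  interval because the arc misses \<open>E\<close>.\<close>

lemma infdist_arc_ge:
  assumes E: "E \<subseteq> unit_circle" "E \<noteq> {}" and disj: "cis ` {a<..<b} \<inter> E = {}" and t: "t \<in> {a<..<b}"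
  shows "min (t - a) (b - t) / 3 \<le> infdist (cis t) E"
proof -
  have "min (t - a) (b - t) / 3 \<le> dist (cis t) e" if e: "e \<in> E" for e
  proof -
    have "norm e = 1" using e E by auto
    then have e0: "e = cis (Arg2pi e)" by (simp add: complex_norm_eq_1_exp cis_conv_exp)
    define n where "n = \<lfloor>(Arg2pi e - (t - pi)) / (2 * pi)\<rfloor>"
    define s where "s = Arg2pi e - 2 * pi * of_int n"
    have "real_of_int n \<le> (Arg2pi e - (t - pi)) / (2 * pi)" "(Arg2pi e - (t - pi)) / (2 * pi) < real_of_int n + 1"
      by (auto simp: n_def)
    then have "\<bar>t - s\<bar> \<le> pi" by (simp add: s_def field_simps abs_le_iff)
    then have "\<bar>t - s\<bar> \<le> 3 * norm (cis t - cis s)" by (rule jordan_chord)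
    moreover have "cis s = e"
    proof -
      have "cis s = cis (Arg2pi e) * cis (2 * pi * of_int (- n))" by (simp add: s_def cis_mult)
      also have "cis (2 * pi * of_int (- n)) = 1" by (rule cis_multiple_2pi) simp
      finally show ?thesis using e0 by simp
    qed
    moreover have "s \<notin> {a<..<b}" using disj e \<open>cis s = e\<close> by blast
    then have "min (t - a) (b - t) \<le> \<bar>t - s\<bar>" using t by auto
    ultimately show ?thesis by (simp add: dist_norm)
  qed
  moreover have "infdist (cis t) E = (INF e\<in>E. dist (cis t) e)" using E by (simp add: infdist_def)
  ultimately show ?thesis by (simp only:) (rule cINF_greatest[OF E(2)])
qed

text \<open>The distance to \<open>E\<close> is controlled by the distance to the nearer endpoint.
  The contributions of both endpoints are added, which doubles the entropy term.\<close>

lemma nn_integral_log_dist_arc: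
  assumes E: "E \<subseteq> unit_circle" "E \<noteq> {}" and ab: "a < b" "b \<le> a + 2 * pi" and disj: "cis ` {a<..<b} \<inter> E = {}"
  defines "l \<equiv> (b - a) / (2 * pi)"
  shows "(\<integral>\<^sup>+t. indicator (cis ` {a<..<b}) (cis t) * log_dist E (cis t) \<partial>circ) \<le> ennreal (2 * (l * ln (1 / l)) + 8 * l)"
proof -
  define L where "L = b - a"
  have L: "0 < L" "L \<le> 2 * pi" using ab by (auto simp: L_def)
  have lL: "l = L / (2 * pi)" by (simp add: l_def L_def)
  have l: "l > 0" "l \<le> 1" unfolding lL using L by auto
  define h where "h x = nlog (ennreal (x / 3)) * indicator {0..L} x" for x :: real
  have [measurable]: "h \<in> borel_measurable borel" unfolding h_def by measurable
  have "(\<integral>\<^sup>+t. indicator (cis ` {a<..<b}) (cis t) * log_dist E (cis t) \<partial>circ)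
     = (\<integral>\<^sup>+t\<in>{a..<a+2*pi}. indicator (cis ` {a<..<b}) (cis t) * log_dist E (cis t) \<partial>lborel) / ennreal (2 * pi)"
    by (rule nn_integral_circ_from) measurable
  also have "\<dots> \<le> (\<integral>\<^sup>+t. h (t - a) + h (b - t) \<partial>lborel) / ennreal (2 * pi)"
  proof (intro divide_right_mono_ennreal nn_integral_mono)
    fix t
    show "indicator (cis ` {a<..<b}) (cis t) * log_dist E (cis t) * indicator {a..<a+2*pi} t \<le> h (t - a) + h (b - t)"
    proof (cases "t \<in> {a..<a+2*pi} \<and> cis t \<in> cis ` {a<..<b}")
      case True
      have "{a<..<b} \<subseteq> {a..<a+2*pi}" using ab by auto
      then have t: "t \<in> {a<..<b}" using cis_mem_image[of "{a<..<b}" a t] True by blast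
      have "log_dist E (cis t) \<le> nlog (ennreal (min (t - a) (b - t) / 3))"
        unfolding log_dist_def by (intro nlog_antimono ennreal_leI infdist_arc_ge E disj t)
      also have "\<dots> \<le> h (t - a) + h (b - t)"
      proof (cases "t - a \<le> b - t")
        case True
        then have "nlog (ennreal (min (t - a) (b - t) / 3)) = h (t - a)" using t by (simp add: h_def min_def L_def)
        then show ?thesis by simp
      next
        case False
        then have "nlog (ennreal (min (t - a) (b - t) / 3)) = h (b - t)" using t by (simp add: h_def min_def L_def)
        then show ?thesis by simp
      qed
      finally show ?thesis using True by simp
    qed auto
  qed
  also have "(\<integral>\<^sup>+t. h (t - a) + h (b - t) \<partial>lborel) = (\<integral>\<^sup>+x. h x \<partial>lborel) + (\<integral>\<^sup>+x. h x \<partial>lborel)"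
  proof -
    have "(\<integral>\<^sup>+t. h (t - a) \<partial>lborel) = (\<integral>\<^sup>+x. h x \<partial>lborel)"
      using nn_integral_shift[of h "- a"] by simp
    moreover have "(\<integral>\<^sup>+t. h (b - t) \<partial>lborel) = (\<integral>\<^sup>+x. h x \<partial>lborel)"
      using nn_integral_real_affine[of h "-1" b] by simp
    ultimately show ?thesis by (subst nn_integral_add) auto
  qed
  also have "((\<integral>\<^sup>+x. h x \<partial>lborel) + (\<integral>\<^sup>+x. h x \<partial>lborel)) / ennreal (2 * pi)
     \<le> (ennreal (L * ln (1 / l) + 4 * L) + ennreal (L * ln (1 / l) + 4 * L)) / ennreal (2 * pi)"
    using nn_integral_nlog_le[OF L] unfolding h_def lL by (intro divide_right_mono_ennreal add_mono)
  also have "\<dots> = ennreal ((2 * (L * ln (1 / l) + 4 * L)) / (2 * pi))"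
    using L l by (simp add: ennreal_plus[symmetric] divide_ennreal del: ennreal_plus)
  also have "(2 * (L * ln (1 / l) + 4 * L)) / (2 * pi) = 2 * (l * ln (1 / l)) + 8 * l"
    by (simp add: lL field_simps)
  finally show ?thesis .
qed

text \<open>The preimage of a component under \<open>cis\<close> has nonempty interior, and these
  interiors are disjoint open sets of reals. Countability is needed to exchange the sum over
  components with an integral.\<close>

lemma countable_components_circle:
  assumes "closed E" "E \<subseteq> unit_circle" "E \<noteq> {}"
  shows "countable (components (unit_circle - E))"
proof -
  let ?Q = "components (unit_circle - E)"
  define pre where "pre J = interior (cis -` J)" for J
  have ne: "\<exists>t. t \<in> pre J" if J: "J \<in> ?Q" for J
  proof -
    obtain a b where ab: "a < b" "J = cis ` {a<..<b}"
      using component_arc[OF assms J] by blast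
    then have "{a<..<b} \<subseteq> pre J" unfolding pre_def by (intro interior_maximal) auto
    moreover have "(a + b) / 2 \<in> {a<..<b}" using ab by (auto simp: field_simps)
    ultimately show ?thesis by blast
  qed
  have disj: "J = K" if "J \<in> ?Q" "K \<in> ?Q" "t \<in> pre J" "t \<in> pre K" for J K t
  proof -
    have "cis t \<in> J" "cis t \<in> K" using that interior_subset unfolding pre_def by blast+
    then show ?thesis using components_eq[OF that(1,2)] by blast
  qed
  have inj: "inj_on pre ?Q"
  proof (rule inj_onI)
    fix J K assume JK: "J \<in> ?Q" "K \<in> ?Q" "pre J = pre K"
    obtain t where "t \<in> pre J" using ne[OF JK(1)] by blast
    then show "J = K" using disj[OF JK(1,2)] JK(3) by simp
  qed
  have "countable (pre ` ?Q)"
  proof (rule countable_disjoint_open_subsets)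
    show "open S" if "S \<in> pre ` ?Q" for S using that by (auto simp: pre_def)
    show "pairwise disjnt (pre ` ?Q)"
      unfolding pairwise_def disjnt_def using disj by blast
  qed
  then show ?thesis using inj by (rule countable_image_inj_on)
qed

text \<open>As \<open>E\<close> is null, the integral is carried by the complementary arcs, each of
  which costs at most twice its entropy plus a multiple of its length. In this form the entropy
  condition passes easily to finite unions.\<close>

lemma beurling_carleson_log_dist:
  assumes BC: "beurling_carleson E" and ne: "E \<noteq> {}"
  shows "(\<integral>\<^sup>+t. log_dist E (cis t) \<partial>circ) < \<infinity>"
proof -
  let ?Q = "components (unit_circle - E)"
  let ?h = "\<lambda>J. measure circle_measure J * ln (1 / measure circle_measure J)"
  interpret cm: prob_space circle_measure by (rule prob_space_circle_measure)
  have E: "closed E" "E \<subseteq> unit_circle" and null: "measure circle_measure E = 0" and sm: "?h summable_on ?Q"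
    using BC by (auto simp: beurling_carleson_def)
  have cnt: "countable ?Q" by (rule countable_components_circle[OF E ne])
  have [measurable]: "E \<in> sets borel" using E by simp
  have AEn: "AE t in circ. cis t \<notin> E"
  proof -
    have "E \<in> sets circle_measure" using sets_circle_measureI[of E] E by (simp add: inf_absorb1)
    then have "E \<in> null_sets circle_measure" using null by (intro null_setsI) (simp add: cm.emeasure_eq_measure)
    then have "AE \<zeta> in circle_measure. \<zeta> \<notin> E" by (rule AE_not_in)
    then show ?thesis by (rule AE_circD)
  qed
  have arc: "\<exists>a b. a < b \<and> b \<le> a + 2 * pi \<and> J = cis ` {a<..<b}" and Jdisj: "J \<inter> E = {}" if J: "J \<in> ?Q" for J
  proof -
    show "\<exists>a b. a < b \<and> b \<le> a + 2 * pi \<and> J = cis ` {a<..<b}" using component_arc[OF E ne J] by metis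
    show "J \<inter> E = {}" using in_components_subset[OF J] by blast
  qed
  have Jm: "J \<in> sets borel" "J \<subseteq> unit_circle" if J: "J \<in> ?Q" for J using arc[OF J] borel_cis_image by auto
  have piece: "(\<integral>\<^sup>+t. indicator J (cis t) * log_dist E (cis t) \<partial>circ) \<le> ennreal (2 * ?h J + 8 * measure circle_measure J)"
    and hnn: "?h J \<ge> 0" if J: "J \<in> ?Q" for J
  proof -
    obtain a b where ab: "a < b" "b \<le> a + 2 * pi" "J = cis ` {a<..<b}" using arc[OF J] by blast
    have m: "measure circle_measure J = (b - a) / (2 * pi)" using ab by (simp add: measure_arc)
    show "(\<integral>\<^sup>+t. indicator J (cis t) * log_dist E (cis t) \<partial>circ) \<le> ennreal (2 * ?h J + 8 * measure circle_measure J)"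
      unfolding m using nn_integral_log_dist_arc[OF E(2) ne ab(1,2)] Jdisj[OF J] ab(3) by simp
    have "measure circle_measure J > 0" unfolding m using ab by simp
    moreover have "measure circle_measure J \<le> 1" by (rule cm.prob_le_1)
    ultimately show "?h J \<ge> 0" by simp
  qed
  have "(\<integral>\<^sup>+t. log_dist E (cis t) \<partial>circ) \<le> (\<integral>\<^sup>+t. \<integral>\<^sup>+J. indicator J (cis t) * log_dist E (cis t) \<partial>count_space ?Q \<partial>circ)"
  proof (rule nn_integral_mono_AE)
    show "AE t in circ. log_dist E (cis t) \<le> (\<integral>\<^sup>+J. indicator J (cis t) * log_dist E (cis t) \<partial>count_space ?Q)"
      using AEn
    proof eventually_elim
      case (elim t)
      then have "cis t \<in> \<Union>?Q" using Union_components[of "unit_circle - E"] by simp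
      then obtain J where J: "J \<in> ?Q" "cis t \<in> J" by blast
      have "log_dist E (cis t) = (\<integral>\<^sup>+K. log_dist E (cis t) * indicator {J} K \<partial>count_space ?Q)"
        using J by (subst nn_integral_cmult_indicator) auto
      also have "\<dots> \<le> (\<integral>\<^sup>+K. indicator K (cis t) * log_dist E (cis t) \<partial>count_space ?Q)"
        using J by (intro nn_integral_mono) (auto simp: indicator_def)
      finally show ?case .
    qed
  qed
  also have "\<dots> = (\<integral>\<^sup>+J. \<integral>\<^sup>+t. indicator J (cis t) * log_dist E (cis t) \<partial>circ \<partial>count_space ?Q)"
    by (rule nn_integral_count_space_nn_integral[OF cnt]) (use Jm in measurable)
  also have "\<dots> \<le> (\<integral>\<^sup>+J. ennreal (2 * ?h J + 8 * measure circle_measure J) \<partial>count_space ?Q)"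
    by (intro nn_integral_mono) (use piece in simp)
  also have "\<dots> < \<infinity>"
  proof -
    have "(\<lambda>J. measure circle_measure J) summable_on ?Q"
    proof (rule nonneg_bdd_above_summable_on)
      show "bdd_above (sum (measure circle_measure) ` {F. F \<subseteq> ?Q \<and> finite F})"
      proof (rule bdd_aboveI2[of _ _ 1])
        fix F assume "F \<in> {F. F \<subseteq> ?Q \<and> finite F}"
        then show "sum (measure circle_measure) F \<le> 1"
          by (intro sum_measure_components_le[of F E]) (use Jm in auto)
      qed
    qed simp
    then have "(\<lambda>J. 2 * ?h J + 8 * measure circle_measure J) summable_on ?Q"
      by (intro summable_on_add summable_on_cmult_right sm)
    moreover have "2 * ?h J + 8 * measure circle_measure J = norm (2 * ?h J + 8 * measure circle_measure J)" if "J \<in> ?Q" for J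
      using hnn[OF that] by (simp add: abs_of_nonneg)
    ultimately have "(\<lambda>J. norm (2 * ?h J + 8 * measure circle_measure J)) summable_on ?Q"
      by (rule summable_on_cong[THEN iffD1, rotated])
    then have "Infinite_Set_Sum.abs_summable_on (\<lambda>J. 2 * ?h J + 8 * measure circle_measure J) ?Q"
      unfolding abs_summable_equivalent[symmetric] .
    then have "integrable (count_space ?Q) (\<lambda>J. 2 * ?h J + 8 * measure circle_measure J)"
      unfolding Infinite_Set_Sum.abs_summable_on_def .
    then show ?thesis
    proof (subst nn_integral_eq_integral)
      show "AE J in count_space ?Q. 0 \<le> 2 * ?h J + 8 * measure circle_measure J"
        using hnn by (auto simp: AE_count_space)
    qed simp_all
  qed
  finally show ?thesis .
qed

lemma log_dist_Un:
  assumes "A \<noteq> {}" "B \<noteq> {}"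
  shows "log_dist (A \<union> B) \<xi> \<le> log_dist A \<xi> + log_dist B \<xi>"
proof -
  have "infdist \<xi> (A \<union> B) = infdist \<xi> A \<or> infdist \<xi> (A \<union> B) = infdist \<xi> B"
    using infdist_Un_min[OF assms, of \<xi>] by (auto simp: min_def)
  then show ?thesis by (auto simp: log_dist_def)
qed

text \<open>Finite unions of the given sets, for which \<open>log_dist_Un\<close> keeps the
  logarithmic distance integrable. Empty members are discarded first, since
  \<open>log_dist {}\<close> is infinite everywhere.\<close>

lemma countable_union_BC_exhaustion:
  assumes E: "countable_union_BC E" "E \<noteq> {}"
  obtains F :: "nat \<Rightarrow> complex set" where "incseq F" "E = (\<Union>n. F n)"
    "\<And>n. closed (F n)" "\<And>n. F n \<noteq> {}" "\<And>n. F n \<subseteq> unit_circle"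
    "\<And>n. (\<integral>\<^sup>+t. log_dist (F n) (cis t) \<partial>circ) < \<infinity>"
proof -
  obtain \<E> where \<E>: "countable \<E>" "\<And>A. A \<in> \<E> \<Longrightarrow> beurling_carleson A" "E = \<Union>\<E>"
    using E by (auto simp: countable_union_BC_def)
  define \<B> where "\<B> = \<E> - {{}}"
  have B: "countable \<B>" "\<B> \<noteq> {}" using \<E> E(2) by (auto simp: \<B>_def)
  define b where "b = from_nat_into \<B>"
  have rb: "range b = \<B>" unfolding b_def by (rule range_from_nat_into[OF B(2,1)])
  have bi: "beurling_carleson (b i)" "b i \<noteq> {}" for i using rb \<E>(2) by (auto simp: \<B>_def)
  define F where "F n = (\<Union>i\<le>n. b i)" for n
  have F_Suc: "F (Suc n) = F n \<union> b (Suc n)" for n by (auto simp: F_def atMost_Suc)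
  have Fne: "F n \<noteq> {}" for n using bi(2)[of 0] by (auto simp: F_def)
  show thesis
  proof (rule that[of F])
    show "incseq F" by (rule incseq_SucI) (auto simp: F_Suc)
    have "E = \<Union>\<B>" using \<E>(3) by (auto simp: \<B>_def)
    also have "\<dots> = (\<Union>i. b i)" using rb by auto
    also have "\<dots> = (\<Union>n. F n)" by (auto simp: F_def)
    finally show "E = (\<Union>n. F n)" .
    show "closed (F n)" "F n \<subseteq> unit_circle" for n
      using bi(1) by (auto simp: F_def beurling_carleson_def intro!: closed_UN)
    show "F n \<noteq> {}" for n by (rule Fne)
    show "(\<integral>\<^sup>+t. log_dist (F n) (cis t) \<partial>circ) < \<infinity>" for n
    proof (induction n)
      case 0
      show ?case using beurling_carleson_log_dist[OF bi(1,2)[of 0]] by (simp add: F_def)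
    next
      case (Suc n)
      have "(\<integral>\<^sup>+t. log_dist (F (Suc n)) (cis t) \<partial>circ) \<le> (\<integral>\<^sup>+t. log_dist (F n) (cis t) + log_dist (b (Suc n)) (cis t) \<partial>circ)"
        unfolding F_Suc by (intro nn_integral_mono log_dist_Un Fne bi)
      also have "\<dots> = (\<integral>\<^sup>+t. log_dist (F n) (cis t) \<partial>circ) + (\<integral>\<^sup>+t. log_dist (b (Suc n)) (cis t) \<partial>circ)"
        by (rule nn_integral_add) auto
      also have "\<dots> < \<infinity>" using Suc beurling_carleson_log_dist[OF bi[of "Suc n"]] by simp
      finally show ?case .
    qed
  qed
qed

section \<open>The potential of a countable union\<close>

text \<open>\<open>nlog\<close> is cut off at 1, so at each point of positive distance the integrand
  vanishes once \<open>A\<close> is large; for \<open>A \<ge> 1\<close> it is dominated by twice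
  \<open>log_dist\<close>. Dominated convergence applies.\<close>

lemma truncated_log_small:
  assumes fin: "(\<integral>\<^sup>+t. log_dist F (cis t) \<partial>circ) < \<infinity>" and e: "e > 0"
  obtains A :: real where "A \<ge> 1" "(\<integral>\<^sup>+t. nlog (ennreal (A * (infdist (cis t) F)\<^sup>2)) \<partial>circ) \<le> ennreal e"
proof -
  define d where "d t = infdist (cis t) F" for t
  have [measurable]: "d \<in> borel_measurable borel"
    unfolding d_def by (intro borel_measurable_continuous_onI continuous_intros continuous_on_cis)
  have dn: "d t \<ge> 0" for t by (simp add: d_def infdist_nonneg)
  define q where "q m t = nlog (ennreal (real (Suc m) * (d t)\<^sup>2))" for m t
  have "(\<lambda>m. \<integral>\<^sup>+t. q m t \<partial>circ) \<longlonglongrightarrow> (\<integral>\<^sup>+t. 0 \<partial>circ)"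
  proof (rule nn_integral_dominated_convergence[where w = "\<lambda>t. 2 * log_dist F (cis t)"])
    show "q m \<in> borel_measurable circ" for m unfolding q_def by measurable
    show "AE t in circ. q m t \<le> 2 * log_dist F (cis t)" for m
    proof (rule AE_I2)
      fix t
      show "q m t \<le> 2 * log_dist F (cis t)"
      proof (cases "d t = 0")
        case True
        then show ?thesis by (simp add: log_dist_def d_def nlog_def ennreal_mult_eq_top_iff)
      next
        case False
        then have d: "d t > 0" using dn[of t] by simp
        have "1 * (d t)\<^sup>2 \<le> real (Suc m) * (d t)\<^sup>2" by (intro mult_right_mono) auto
        then have "q m t \<le> nlog (ennreal ((d t)\<^sup>2))" unfolding q_def by (intro nlog_antimono ennreal_leI) simp
        also have "\<dots> = ennreal (2 * (- ln (d t)))" using d by (simp add: nlog_ennreal ln_realpow)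
        also have "\<dots> = ennreal 2 * ennreal (- ln (d t))" by (rule ennreal_mult') simp
        also have "\<dots> = 2 * log_dist F (cis t)"
          using d by (simp add: log_dist_def nlog_ennreal d_def[symmetric])
        finally show ?thesis .
      qed
    qed
    show "AE t in circ. (\<lambda>m. q m t) \<longlonglongrightarrow> 0"
    proof -
      have "AE t in circ. log_dist F (cis t) \<noteq> \<infinity>"
        by (rule nn_integral_PInf_AE) (use fin in auto)
      then show ?thesis
      proof eventually_elim
        case (elim t)
        then have "d t \<noteq> 0" by (auto simp: log_dist_def nlog_def d_def)
        then have d: "d t > 0" using dn[of t] by simp
        obtain M :: nat where M: "1 / (d t)\<^sup>2 \<le> real M" using real_arch_simple by blast
        have "q m t = 0" if "m \<ge> M" for m
        proof -
          have "1 / (d t)\<^sup>2 \<le> real (Suc m)" using M that by simp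
          then have "1 \<le> real (Suc m) * (d t)\<^sup>2" using d by (simp add: field_simps)
          then have "q m t = ennreal (- ln (real (Suc m) * (d t)\<^sup>2))"
            unfolding q_def by (intro nlog_ennreal) linarith
          moreover have "ln (real (Suc m) * (d t)\<^sup>2) \<ge> 0"
            using \<open>1 \<le> real (Suc m) * (d t)\<^sup>2\<close> by (rule ln_ge_zero)
          ultimately show ?thesis by (simp add: ennreal_neg del: of_nat_Suc)
        qed
        then have "\<forall>\<^sub>F m in sequentially. q m t = 0" by (auto simp: eventually_sequentially)
        then show ?case by (rule tendsto_eventually)
      qed
    qed
    show "(\<integral>\<^sup>+t. 2 * log_dist F (cis t) \<partial>circ) < \<infinity>"
      using fin by (simp add: nn_integral_cmult ennreal_mult_less_top)
  qed auto
  then have "(\<lambda>m. \<integral>\<^sup>+t. q m t \<partial>circ) \<longlonglongrightarrow> 0" by simp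
  then have "\<forall>\<^sub>F m in sequentially. (\<integral>\<^sup>+t. q m t \<partial>circ) < ennreal e"
    by (rule order_tendstoD) (use e in simp)
  then obtain m where "(\<integral>\<^sup>+t. q m t \<partial>circ) < ennreal e" by (auto simp: eventually_sequentially)
  then show thesis using that[of "real (Suc m)"] by (simp add: q_def d_def less_imp_le)
qed

text \<open>A right inverse of \<open>nlog\<close> that turns sums into products: applied to a sum
  of terms \<open>nlog x\<close> it gives the product of the numbers min(1, x).\<close>

definition exp_neg :: "ennreal \<Rightarrow> real" where
  "exp_neg x = (if x = \<infinity> then 0 else exp (- enn2real x))"

lemma exp_neg_measurable [measurable]: "exp_neg \<in> borel_measurable borel"
  unfolding exp_neg_def by measurable

lemma exp_neg_bounds: "0 \<le> exp_neg x" "exp_neg x \<le> 1"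
  by (auto simp: exp_neg_def)

lemma nlog_exp_neg: "nlog (ennreal (exp_neg x)) = x"
  by (cases x) (auto simp: exp_neg_def nlog_ennreal nlog_def)

lemma exp_neg_le:
  assumes "nlog (ennreal y) \<le> x" "y \<ge> 0"
  shows "exp_neg x \<le> y"
proof (cases x)
  case (real r)
  have y: "y > 0" using assms real by (cases "y = 0") (auto simp: nlog_def top_unique)
  then have "ennreal (- ln y) \<le> ennreal r" using assms real by (simp add: nlog_ennreal)
  then have "- ln y \<le> r" using real by (cases "- ln y \<le> 0") (auto simp: ennreal_le_iff)
  then have "exp (- r) \<le> exp (ln y)" by simp
  then show ?thesis using y real by (simp add: exp_neg_def)
qed (use assms in \<open>simp add: exp_neg_def\<close>)

section \<open>Jensen's inequality and the logarithmic integral of exp (- g)\<close>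

lemma poisson_pos: "norm z < 1 \<Longrightarrow> norm \<xi> = 1 \<Longrightarrow> poisson z \<xi> > 0"
  unfolding poisson_def by (intro divide_pos_pos) (auto simp: abs_square_less_1)

text \<open>Jensen's inequality for -log and the probability density \<open>poisson z\<close>, by
  integrating the tangent of \<open>nlog_ge\<close> at \<open>l = c\<close>; the constant 1 in the
  tangent cancels against \<open>c / l\<close>. Positivity of \<open>c\<close> uses that
  \<open>S\<close> is finite almost everywhere.\<close>

lemma jensen_poisson:
  fixes S :: "complex \<Rightarrow> ennreal"
  assumes [measurable]: "S \<in> borel_measurable borel" and fin: "(\<integral>\<^sup>+t. S (cis t) \<partial>circ) < \<infinity>"
    and z: "norm z < 1"
  defines "c \<equiv> \<integral>\<^sup>+t. ennreal (exp_neg (S (cis t))) * ennreal (poisson z (cis t)) \<partial>circ"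
  shows "0 < c" "c \<le> 1" "nlog c \<le> (\<integral>\<^sup>+t. S (cis t) * ennreal (poisson z (cis t)) \<partial>circ)"
proof -
  have P: "(\<integral>\<^sup>+t. ennreal (poisson z (cis t)) \<partial>circ) = 1" by (rule nn_integral_poisson[OF z])
  have "c \<le> (\<integral>\<^sup>+t. 1 * ennreal (poisson z (cis t)) \<partial>circ)"
    unfolding c_def by (intro nn_integral_mono mult_right_mono) (auto simp: exp_neg_bounds ennreal_le_1)
  then show c1: "c \<le> 1" using P by simp
  show c0: "0 < c"
  proof (rule ccontr)
    assume "\<not> 0 < c"
    then have "c = 0" by simp
    then have "AE t in circ. ennreal (exp_neg (S (cis t))) * ennreal (poisson z (cis t)) = 0"
      unfolding c_def by (subst (asm) nn_integral_0_iff_AE) auto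
    moreover have "AE t in circ. S (cis t) \<noteq> \<infinity>" by (rule nn_integral_PInf_AE) (use fin in auto)
    ultimately have "AE t in circ. False"
    proof eventually_elim
      case (elim t)
      then have "exp_neg (S (cis t)) > 0" by (simp add: exp_neg_def)
      then show ?case using elim poisson_pos[OF z, of "cis t"] by (simp add: ennreal_eq_0_iff)
    qed
    then show False by (simp add: circ.AE_False)
  qed
  obtain l where l: "c = ennreal l" "l \<ge> 0" using c1 by (cases c) (auto simp: top_unique)
  have l0: "l > 0" "l \<le> 1" using c0 c1 l by (auto simp: ennreal_le_1)
  have ln0: "ln (1 / l) \<ge> 0" using l0 by simp
  have "ennreal (ln (1 / l)) + 1 = ennreal (ln (1 / l) + 1) * (\<integral>\<^sup>+t. ennreal (poisson z (cis t)) \<partial>circ)"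
    using ln0 unfolding P by (simp add: ennreal_plus)
  also have "\<dots> = (\<integral>\<^sup>+t. ennreal (ln (1 / l) + 1) * ennreal (poisson z (cis t)) \<partial>circ)"
    by (rule nn_integral_cmult[symmetric]) simp
  also have "\<dots> \<le> (\<integral>\<^sup>+t. S (cis t) * ennreal (poisson z (cis t)) + ennreal (1 / l) * (ennreal (exp_neg (S (cis t))) * ennreal (poisson z (cis t))) \<partial>circ)"
  proof (rule nn_integral_mono)
    fix t
    have "ennreal (ln (1 / l) + 1) * ennreal (poisson z (cis t)) \<le> (nlog (ennreal (exp_neg (S (cis t)))) + ennreal (1 / l) * ennreal (exp_neg (S (cis t)))) * ennreal (poisson z (cis t))"
      by (intro mult_right_mono nlog_ge l0) simp
    then show "ennreal (ln (1 / l) + 1) * ennreal (poisson z (cis t)) \<le> S (cis t) * ennreal (poisson z (cis t)) + ennreal (1 / l) * (ennreal (exp_neg (S (cis t))) * ennreal (poisson z (cis t)))"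
      unfolding nlog_exp_neg by (simp only: distrib_right mult.assoc)
  qed
  also have "\<dots> = (\<integral>\<^sup>+t. S (cis t) * ennreal (poisson z (cis t)) \<partial>circ) + ennreal (1 / l) * c"
    unfolding c_def by (subst nn_integral_add) (auto simp: nn_integral_cmult)
  also have "ennreal (1 / l) * c = 1" using l0 unfolding l(1) by (simp add: ennreal_mult'[symmetric])
  finally have "ennreal (ln (1 / l)) \<le> (\<integral>\<^sup>+t. S (cis t) * ennreal (poisson z (cis t)) \<partial>circ)"
    by (simp add: add.commute[of _ 1] ennreal_add_left_cancel_le)
  then show "nlog c \<le> (\<integral>\<^sup>+t. S (cis t) * ennreal (poisson z (cis t)) \<partial>circ)"
    unfolding l(1) nlog_ennreal[OF l0(1)] using l0 by (simp add: ln_div)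
qed

text \<open>After the exchange, the symmetry of the kernel turns the inner integral over
  \<open>s\<close> into that of a single Poisson kernel, which is 1.\<close>

lemma poisson_tonelli:
  fixes S :: "complex \<Rightarrow> ennreal"
  assumes [measurable]: "S \<in> borel_measurable borel" and r: "0 \<le> r" "r < 1"
  shows "(\<integral>\<^sup>+s. \<integral>\<^sup>+t. S (cis t) * ennreal (poisson (of_real r * cis s) (cis t)) \<partial>circ \<partial>circ) = (\<integral>\<^sup>+t. S (cis t) \<partial>circ)"
proof -
  interpret pair_sigma_finite circ circ ..
  have "(\<integral>\<^sup>+s. \<integral>\<^sup>+t. S (cis t) * ennreal (poisson (of_real r * cis s) (cis t)) \<partial>circ \<partial>circ)
      = (\<integral>\<^sup>+t. \<integral>\<^sup>+s. S (cis t) * ennreal (poisson (of_real r * cis s) (cis t)) \<partial>circ \<partial>circ)"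
    by (rule Fubini'[symmetric]) (unfold poisson_def, measurable)
  also have "\<dots> = (\<integral>\<^sup>+t. S (cis t) * (\<integral>\<^sup>+s. ennreal (poisson (of_real r * cis t) (cis s)) \<partial>circ) \<partial>circ)"
    by (intro nn_integral_cong, subst nn_integral_cmult[symmetric]) (auto simp: poisson_radial_sym[of "cis _" "cis _"])
  also have "\<dots> = (\<integral>\<^sup>+t. S (cis t) * 1 \<partial>circ)"
    using r by (intro nn_integral_cong) (simp add: nn_integral_poisson norm_mult)
  finally show ?thesis by simp
qed

text \<open>With \<open>l\<close> the Poisson integral of \<open>exp_neg S\<close>, one has 1 - exp
  (- Re g) >= 1 - exp (- l) >= l / 2, so by Jensen - log (1 - |f|) is at most log 2 plus the Poisson
  integral of \<open>S\<close>. The average of this over a circle does not depend on the radius, and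
  Fatou's lemma carries the bound to the boundary. Only a lower bound on \<open>Re g\<close> enters,
  so singular mass may be added freely.\<close>

lemma log_integral_exp_finite:
  fixes S :: "complex \<Rightarrow> ennreal" and g :: "complex \<Rightarrow> complex"
  assumes Sm [measurable]: "S \<in> borel_measurable borel" and fin: "(\<integral>\<^sup>+t. S (cis t) \<partial>circ) < \<infinity>"
    and self: "holo_self_map (\<lambda>z. exp (- g z))"
    and ge: "\<And>z. z \<in> unit_disc \<Longrightarrow> (\<integral>\<^sup>+t. ennreal (exp_neg (S (cis t))) * ennreal (poisson z (cis t)) \<partial>circ) \<le> ennreal (Re (g z))"
  shows "log_integral (\<lambda>z. exp (- g z)) unit_circle > -\<infinity>"
proof -
  define f where "f z = exp (- g z)" for z
  have f: "holo_self_map f" using self by (simp add: f_def[abs_def])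
  then have hol: "f holomorphic_on unit_disc" by (simp add: holo_self_map_def)
  define x where "x n t = 1 - norm (f (of_real (approach n) * cis t))" for n t
  have nz: "norm (of_real (approach n) * cis t) < 1" for n t using approach[of n] by (simp add: norm_mult)
  have x0: "x n t > 0" for n t using holo_self_map_norm_less[OF f nz[of n t]] by (simp add: x_def)
  have [measurable]: "(\<lambda>t. ennreal (x n t)) \<in> borel_measurable borel" for n
  proof -
    have "(\<lambda>t. if norm (cis t) = 1 then ennreal (1 - norm (f (of_real (approach n) * cis t))) else 0) \<in> borel_measurable borel"
      by (rule measurable_compose[OF cis_borel radial_measurable[OF hol]]) (use approach[of n] in auto)
    then show ?thesis by (simp add: x_def)
  qed
  have key: "nlog (ennreal (x n t)) \<le> ennreal (ln 2) + (\<integral>\<^sup>+s. S (cis s) * ennreal (poisson (of_real (approach n) * cis t) (cis s)) \<partial>circ)" for n t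
  proof -
    define z where "z = of_real (approach n) * cis t"
    have z: "norm z < 1" using nz by (simp add: z_def)
    define c where "c = (\<integral>\<^sup>+s. ennreal (exp_neg (S (cis s))) * ennreal (poisson z (cis s)) \<partial>circ)"
    note J = jensen_poisson[OF Sm fin z, folded c_def]
    obtain l where l: "c = ennreal l" "l \<ge> 0" using J(2) by (cases c) (auto simp: top_unique)
    have l0: "l > 0" "l \<le> 1" using J(1,2) l by (auto simp: ennreal_le_1)
    have "ennreal l \<le> ennreal (Re (g z))" using ge[of z] z l by (simp add: c_def)
    then have u: "l \<le> Re (g z)" using l0 by (auto simp: ennreal_le_iff2)
    have "norm (f z) = exp (- Re (g z))" by (simp add: f_def)
    also have "\<dots> \<le> exp (- l)" using u by simp
    also have "\<dots> \<le> 1 / (1 + l)"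
    proof -
      have "1 + l \<le> exp l" by (rule exp_ge_add_one_self)
      then show ?thesis using l0 by (simp add: exp_minus inverse_eq_divide divide_left_mono)
    qed
    also have "\<dots> \<le> 1 - l / 2"
    proof -
      have "l * l \<le> l * 1" using l0 by (intro mult_left_mono) auto
      then have "1 \<le> (1 - l / 2) * (1 + l)" by (simp add: algebra_simps)
      then show ?thesis using l0 by (simp add: pos_divide_le_eq)
    qed
    finally have "l / 2 \<le> x n t" by (simp add: x_def z_def)
    then have "nlog (ennreal (x n t)) \<le> nlog (ennreal (l / 2))" by (intro nlog_antimono ennreal_leI)
    also have "\<dots> = ennreal (ln 2 + (- ln l))" using l0 by (simp add: nlog_ennreal ln_div)
    also have "\<dots> = ennreal (ln 2) + ennreal (- ln l)" using l0 by (intro ennreal_plus) auto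
    also have "ennreal (- ln l) = nlog c" using l0 unfolding l(1) by (simp add: nlog_ennreal)
    also have "ennreal (ln 2) + nlog c \<le> ennreal (ln 2) + (\<integral>\<^sup>+s. S (cis s) * ennreal (poisson z (cis s)) \<partial>circ)"
      by (intro add_left_mono J(3))
    finally show ?thesis by (simp add: z_def)
  qed
  have "(\<integral>\<^sup>+t. nlog (defect f (cis t)) \<partial>circ) \<le> (\<integral>\<^sup>+t. liminf (\<lambda>n. nlog (ennreal (x n t))) \<partial>circ)"
  proof (rule nn_integral_mono_AE)
    show "AE t in circ. nlog (defect f (cis t)) \<le> liminf (\<lambda>n. nlog (ennreal (x n t)))"
      using AE_circD[OF AE_nt_value[OF f]]
    proof eventually_elim
      case (elim t)
      define w where "w = nt_value f (cis t)"
      have w: "has_nt_limit f w (cis t)" using elim by (simp add: w_def)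
      define y where "y = 1 - norm w"
      have y: "y \<ge> 0" "defect f (cis t) = ennreal y" using nt_limit_norm_le[OF f w] by (auto simp: y_def)
      have xl: "(\<lambda>n. x n t) \<longlonglongrightarrow> y" unfolding x_def y_def
        by (intro tendsto_intros filterlim_compose[OF has_nt_limit_radial[OF w] approach_at_left]) simp
      have "(\<lambda>n. nlog (ennreal (x n t))) \<longlonglongrightarrow> nlog (ennreal y)"
      proof (cases "y = 0")
        case False
        then have "(\<lambda>n. ennreal (- ln (x n t))) \<longlonglongrightarrow> ennreal (- ln y)"
          by (intro tendsto_intros xl)
        then show ?thesis using False y(1) x0 by (simp add: nlog_ennreal)
      next
        case True
        have "filterlim (\<lambda>n. x n t) (at_right 0) sequentially"
          using xl True by (simp add: filterlim_at x0 less_imp_neq[OF x0, symmetric])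
        then have "filterlim (\<lambda>n. ln (x n t)) at_bot sequentially" by (rule filterlim_compose[OF ln_at_0])
        then have "filterlim (\<lambda>n. - ln (x n t)) at_top sequentially" by (simp add: filterlim_uminus_at_top)
        then have "(\<lambda>n. ennreal (- ln (x n t))) \<longlonglongrightarrow> \<infinity>" by (simp add: ennreal_tendsto_top_eq_at_top)
        then show ?thesis using True x0 by (simp add: nlog_ennreal) (simp add: nlog_def)
      qed
      then show ?case unfolding y(2) by (simp add: lim_imp_Liminf)
    qed
  qed
  also have "\<dots> \<le> liminf (\<lambda>n. \<integral>\<^sup>+t. nlog (ennreal (x n t)) \<partial>circ)"
    by (rule nn_integral_liminf) measurable
  also have "\<dots> \<le> liminf (\<lambda>n. ennreal (ln 2) + (\<integral>\<^sup>+t. S (cis t) \<partial>circ))"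
  proof (intro Liminf_mono always_eventually allI)
    fix n
    have "(\<integral>\<^sup>+t. nlog (ennreal (x n t)) \<partial>circ) \<le> (\<integral>\<^sup>+t. ennreal (ln 2) + (\<integral>\<^sup>+s. S (cis s) * ennreal (poisson (of_real (approach n) * cis t) (cis s)) \<partial>circ) \<partial>circ)"
      by (intro nn_integral_mono key)
    also have "\<dots> = (\<integral>\<^sup>+t. ennreal (ln 2) \<partial>circ) + (\<integral>\<^sup>+t. \<integral>\<^sup>+s. S (cis s) * ennreal (poisson (of_real (approach n) * cis t) (cis s)) \<partial>circ \<partial>circ)"
      by (rule nn_integral_add) (unfold poisson_def, measurable)
    also have "\<dots> = ennreal (ln 2) + (\<integral>\<^sup>+t. S (cis t) \<partial>circ)"
      using approach[of n] by (subst poisson_tonelli) (auto simp: circ.emeasure_space_1)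
    finally show "(\<integral>\<^sup>+t. nlog (ennreal (x n t)) \<partial>circ) \<le> \<dots>" .
  qed
  also have "\<dots> < \<infinity>" using fin by (simp add: Liminf_const)
  finally have "(\<integral>\<^sup>+t. nlog (defect f (cis t)) \<partial>circ) < \<infinity>" .
  moreover have "log_integral f unit_circle = - enn2ereal (\<integral>\<^sup>+t. nlog (defect f (cis t)) \<partial>circ)"
    using log_integral_eq[OF f, of UNIV] by simp
  ultimately have "log_integral f unit_circle > -\<infinity>"
    by (cases "\<integral>\<^sup>+t. nlog (defect f (cis t)) \<partial>circ") (auto simp: enn2ereal_ennreal)
  then show ?thesis by (simp add: f_def[abs_def])
qed


section \<open>Nets of atoms around the sets \<open>F n\<close>\<close>

lemma suminf_ennreal_finite:
  fixes x :: "nat \<Rightarrow> ennreal"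
  assumes fin: "\<And>j. x j < \<infinity>" and c: "c \<ge> 0" and le: "\<And>j. j \<ge> J \<Longrightarrow> x j \<le> ennreal (c * (1/2) ^ j)"
  shows "(\<Sum>j. x j) < \<infinity>"
proof -
  define y where "y j = enn2real (x j)" for j
  have xy: "x j = ennreal (y j)" for j using fin[of j] by (simp add: y_def)
  have y0: "y j \<ge> 0" for j by (simp add: y_def)
  have "summable (\<lambda>j. c * (1/2 :: real) ^ j)" by (intro summable_mult summable_geometric) simp
  then have "summable y"
  proof (rule summable_comparison_test'[of _ J])
    fix j assume "j \<ge> J"
    then have "ennreal (y j) \<le> ennreal (c * (1/2) ^ j)" using le xy by simp
    then show "norm (y j) \<le> c * (1/2) ^ j" using c y0 by (simp add: ennreal_le_iff)
  qed
  then show ?thesis unfolding xy using y0 by (simp add: suminf_ennreal2)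
qed

lemma exists_points_avoiding:
  assumes E: "AE t in circ. cis t \<notin> E" and i: "i < N"
  obtains t where "t \<in> {2 * pi * real i / real N<..<2 * pi * real (Suc i) / real N}" "cis t \<notin> E"
proof -
  define a b where "a = 2 * pi * real i / real N" and "b = 2 * pi * real (Suc i) / real N"
  have ab: "0 \<le> a" "a < b" using i by (auto simp: a_def b_def divide_strict_right_mono)
  have "b \<le> 2 * pi * real N / real N" unfolding b_def using i by (intro divide_right_mono mult_left_mono) auto
  then have b: "b \<le> 2 * pi" using i by simp
  have "\<exists>t\<in>{a<..<b}. cis t \<notin> E"
  proof (rule ccontr)
    assume "\<not> ?thesis"
    then have "AE t in circ. t \<notin> {a<..<b}" using E by (auto elim: eventually_mono)
    then have "{a<..<b} \<in> null_sets circ" by (subst AE_iff_null_sets) auto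
    then have "emeasure circ {a<..<b} = 0" by (rule null_setsD1)
    moreover have "(\<integral>\<^sup>+t. indicator {a<..<b} t \<partial>circ) = emeasure circ {a<..<b}" by (rule nn_integral_indicator) simp
    ultimately have "(\<integral>\<^sup>+t. indicator {a<..<b} t \<partial>circ) = 0" by (simp only:)
    moreover have "(\<integral>\<^sup>+t. indicator {a<..<b} t \<partial>circ) = (\<integral>\<^sup>+t\<in>{0..<2*pi}. indicator {a<..<b} t \<partial>lborel) / ennreal (2 * pi)"
      by (rule nn_integral_circ) simp
    moreover have "(\<integral>\<^sup>+t\<in>{0..<2*pi}. indicator {a<..<b} t \<partial>lborel) = (\<integral>\<^sup>+t. indicator {a<..<b} t \<partial>lborel)"
      using ab b by (intro nn_integral_cong) (auto simp: indicator_def)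
    moreover have "(\<integral>\<^sup>+t. indicator {a<..<b} t \<partial>lborel) = ennreal (b - a)" using ab by simp
    ultimately show False using ab by (simp add: divide_ennreal ennreal_eq_0_iff divide_le_0_iff)
  qed
  then show thesis using that unfolding a_def b_def by blast
qed

lemma unit_circle_near_point:
  assumes \<zeta>: "norm \<zeta> = 1" and N: "N > 0"
    and t: "\<And>i. i < N \<Longrightarrow> t i \<in> {2 * pi * real i / real N<..<2 * pi * real (Suc i) / real N}"
  obtains i where "i < N" "norm (cis (t i) - \<zeta>) \<le> 2 * pi / real N"
proof -
  define s where "s = Arg2pi \<zeta>"
  have s: "\<zeta> = cis s" "0 \<le> s" "s < 2 * pi"
    using \<zeta> Arg2pi_ge_0[of \<zeta>] Arg2pi_lt_2pi[of \<zeta>] by (simp_all add: s_def complex_norm_eq_1_exp cis_conv_exp)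
  define i where "i = nat \<lfloor>s * real N / (2 * pi)\<rfloor>"
  have i: "real i \<le> s * real N / (2 * pi)" "s * real N / (2 * pi) < real i + 1"
    using s by (auto simp: i_def)
  then have si: "2 * pi * real i / real N \<le> s" "s < 2 * pi * real (Suc i) / real N"
    using N by (simp_all add: field_simps)
  have "s * real N / (2 * pi) < real N" using s N by (simp add: field_simps)
  then have iN: "i < N" using i by linarith
  have "2 * pi * real (Suc i) / real N = 2 * pi * real i / real N + 2 * pi / real N"
    by (simp add: add_divide_distrib algebra_simps)
  then have "\<bar>t i - s\<bar> \<le> 2 * pi / real N" using t[OF iN] si by (auto simp: abs_le_iff)
  then have "norm (cis (t i) - \<zeta>) \<le> 2 * pi / real N" unfolding s(1) using norm_cis_diff_le order_trans by blast
  then show thesis using that iN by blast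
qed

lemma nn_integral_triple:
  fixes h :: "nat \<times> nat \<times> nat \<Rightarrow> ennreal"
  shows "(\<integral>\<^sup>+x. h x \<partial>count_space UNIV) = (\<Sum>n. \<Sum>j. \<Sum>i. h (n, j, i))"
proof -
  have "(\<integral>\<^sup>+x. h x \<partial>count_space UNIV) = (\<integral>\<^sup>+n. \<integral>\<^sup>+y. h (n, y) \<partial>count_space UNIV \<partial>count_space UNIV)"
    by (rule nn_integral_fst_count_space[symmetric])
  also have "\<dots> = (\<integral>\<^sup>+n. \<integral>\<^sup>+j. \<integral>\<^sup>+i. h (n, j, i) \<partial>count_space UNIV \<partial>count_space UNIV \<partial>count_space UNIV)"
    by (subst nn_integral_fst_count_space[symmetric]) simp
  finally show ?thesis by (simp add: nn_integral_count_space_nat)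
qed

text \<open>An atom of mass mesh^2 contributes at least 1 within one mesh width, so off
  \<open>E\<close> every level \<open>n\<close> adds at least 1 and the sum diverges. On
  \<open>F n\<close> the atoms of scale \<open>j\<close> are at distance at least (1/2)^j / 2, and
  their total mass is made tiny through \<open>N\<close>. If a point of \<open>E\<close> is not yet
  in \<open>F n\<close>, all but finitely many shells of that level stay away from it, and no node
  lies in \<open>E\<close>, so the level is still finite.\<close>

lemma atomic_potential:
  fixes F :: "nat \<Rightarrow> complex set"
  assumes F: "incseq F" "\<And>n. closed (F n)" "\<And>n. F n \<noteq> {}" "\<And>n. F n \<subseteq> unit_circle"
    and null: "AE t in circ. cis t \<notin> (\<Union>n. F n)"
  obtains M :: "(nat \<times> nat \<times> nat) measure" and X where
    "finite_measure M" "X \<in> borel_measurable M" "\<And>x. norm (X x) = 1"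
    "\<And>\<zeta>. norm \<zeta> = 1 \<Longrightarrow> inverse_square_potential M X \<zeta> < \<infinity> \<longleftrightarrow> \<zeta> \<in> (\<Union>n. F n)"
proof -
  define E where "E = (\<Union>n. F n)"
  \<comment> \<open>The mass at scale \<open>j\<close> is at most
    \<open>4 * pi\<^sup>2 / N \<le> 40 / N\<close>, and on \<open>F n\<close> the kernel is at most
    4 * 4^j; this choice makes the product 160 * 4^j / N equal to (1/2)^n * (1/2)^j.\<close>
  define N :: "nat \<Rightarrow> nat \<Rightarrow> nat" where "N n j = 160 * 2 ^ (n + 3 * j)" for n j
  have N0: "N n j > 0" for n j by (simp add: N_def)
  define t where "t n j i = (SOME t. t \<in> {2 * pi * real i / real (N n j)<..<2 * pi * real (Suc i) / real (N n j)} \<and> cis t \<notin> E)" for n j i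
  have tt: "t n j i \<in> {2 * pi * real i / real (N n j)<..<2 * pi * real (Suc i) / real (N n j)} \<and> cis (t n j i) \<notin> E"
    if "i < N n j" for n j i
    unfolding t_def by (rule someI_ex) (use exists_points_avoiding[OF null that, folded E_def] in blast)
  have t: "t n j i \<in> {2 * pi * real i / real (N n j)<..<2 * pi * real (Suc i) / real (N n j)}"
    and tE: "cis (t n j i) \<notin> E" if "i < N n j" for n j i using tt[OF that] by blast+
  \<comment> \<open>If the distance d of \<open>\<zeta>\<close> to \<open>F n\<close> satisfies
    (1/2)^j <= d <= 2 * (1/2)^j, then a node within (1/2)^j / 2 of \<open>\<zeta>\<close> obeys
    these bounds.\<close>
  define shell where "shell n j i \<longleftrightarrow> i < N n j \<and> (1/2) ^ j / 2 \<le> infdist (cis (t n j i)) (F n) \<and> infdist (cis (t n j i)) (F n) \<le> 4 * (1/2) ^ j" for n j i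
  define w where "w n j i = (if shell n j i then (2 * pi / real (N n j))\<^sup>2 else 0)" for n j i
  define M where "M = density (count_space UNIV) (\<lambda>(n, j, i). ennreal (w n j i))"
  define X where "X = (\<lambda>(n, j, i). cis (t n j i))"
  have w0: "w n j i \<ge> 0" for n j i by (simp add: w_def)
  have wz: "w n j i = 0" if "i \<notin> {..<N n j}" for n j i using that by (simp add: w_def shell_def)
  have int: "(\<integral>\<^sup>+x. h x \<partial>M) = (\<Sum>n. \<Sum>j. \<Sum>i<N n j. ennreal (w n j i) * h (n, j, i))" for h :: "nat \<times> nat \<times> nat \<Rightarrow> ennreal"
  proof -
    have "(\<integral>\<^sup>+x. h x \<partial>M) = (\<integral>\<^sup>+x. (case x of (n, j, i) \<Rightarrow> ennreal (w n j i)) * h x \<partial>count_space UNIV)"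
      unfolding M_def by (rule nn_integral_density) auto
    also have "\<dots> = (\<Sum>n. \<Sum>j. \<Sum>i. ennreal (w n j i) * h (n, j, i))"
      by (simp add: nn_integral_triple)
    also have "\<dots> = (\<Sum>n. \<Sum>j. \<Sum>i<N n j. ennreal (w n j i) * h (n, j, i))"
      by (intro suminf_cong suminf_finite) (use wz in auto)
    finally show ?thesis .
  qed
  have wsum: "(\<Sum>i<N n j. w n j i) \<le> (1/2) ^ n * (1/2) ^ j / 4 * (1/4) ^ j" for n j
  proof -
    have "(\<Sum>i<N n j. w n j i) \<le> (\<Sum>i<N n j. (2 * pi / real (N n j))\<^sup>2)"
      by (intro sum_mono) (simp add: w_def)
    also have "\<dots> = 4 * pi\<^sup>2 / real (N n j)" using N0[of n j] by (simp add: power2_eq_square field_simps)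
    also have "\<dots> \<le> 40 / real (N n j)"
    proof (rule divide_right_mono)
      have "pi \<le> 3.15" using pi_approx by simp
      then have "pi * pi \<le> 3.15 * 3.15" by (intro mult_mono) auto
      then show "4 * pi\<^sup>2 \<le> 40" by (simp add: power2_eq_square)
    qed simp
    also have "\<dots> = (1/2) ^ n * (1/2) ^ j / 4 * (1/4) ^ j"
    proof -
      have "(2::real) ^ (n + 3 * j) = 2 ^ n * (2 ^ j * 4 ^ j)"
        by (simp add: power_add power_mult flip: power_mult_distrib)
      then show ?thesis by (simp add: N_def power_divide)
    qed
    finally show ?thesis .
  qed
  have Xm: "X \<in> borel_measurable M" by (simp add: M_def)
  have X1: "norm (X x) = 1" for x by (cases x) (simp add: X_def)
  have pot: "inverse_square_potential M X \<zeta>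
     = (\<Sum>n. \<Sum>j. \<Sum>i<N n j. ennreal (w n j i) * inverse (ennreal ((norm (cis (t n j i) - \<zeta>))\<^sup>2)))" for \<zeta>
    unfolding inverse_square_potential_def int by (simp add: X_def)
  have term_le: "(\<Sum>i<N n j. ennreal (w n j i) * inverse (ennreal ((norm (cis (t n j i) - \<zeta>))\<^sup>2)))
      \<le> ennreal (inverse (\<delta>\<^sup>2) * ((1/2) ^ n * (1/2) ^ j / 4 * (1/4) ^ j))"
    if \<delta>: "\<delta> > 0" and far: "\<And>i. shell n j i \<Longrightarrow> \<delta> \<le> norm (cis (t n j i) - \<zeta>)" for n j \<zeta> \<delta>
  proof -
    have "(\<Sum>i<N n j. ennreal (w n j i) * inverse (ennreal ((norm (cis (t n j i) - \<zeta>))\<^sup>2)))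
       \<le> (\<Sum>i<N n j. ennreal (inverse (\<delta>\<^sup>2) * w n j i))"
    proof (rule sum_mono)
      fix i
      show "ennreal (w n j i) * inverse (ennreal ((norm (cis (t n j i) - \<zeta>))\<^sup>2)) \<le> ennreal (inverse (\<delta>\<^sup>2) * w n j i)"
      proof (cases "shell n j i")
        case True
        have sq: "\<delta>\<^sup>2 \<le> (norm (cis (t n j i) - \<zeta>))\<^sup>2" using far[OF True] \<delta> by (intro power_mono) auto
        have d2: "0 < \<delta>\<^sup>2" using \<delta> by simp
        have "inverse (ennreal ((norm (cis (t n j i) - \<zeta>))\<^sup>2)) = ennreal (inverse ((norm (cis (t n j i) - \<zeta>))\<^sup>2))"
          using sq d2 by (intro inverse_ennreal) linarith
        also have "\<dots> \<le> ennreal (inverse (\<delta>\<^sup>2))" using sq d2 by (intro ennreal_leI le_imp_inverse_le)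
        finally have "ennreal (w n j i) * inverse (ennreal ((norm (cis (t n j i) - \<zeta>))\<^sup>2)) \<le> ennreal (w n j i) * ennreal (inverse (\<delta>\<^sup>2))"
          by (rule mult_left_mono) simp
        also have "\<dots> = ennreal (inverse (\<delta>\<^sup>2) * w n j i)" using w0 by (simp add: ennreal_mult'[symmetric] mult.commute)
        finally show ?thesis .
      qed (simp add: w_def)
    qed
    also have "\<dots> = ennreal (inverse (\<delta>\<^sup>2) * (\<Sum>i<N n j. w n j i))"
      using w0 \<delta> by (subst sum_ennreal) (auto simp: sum_distrib_left)
    also have "\<dots> \<le> ennreal (inverse (\<delta>\<^sup>2) * ((1/2) ^ n * (1/2) ^ j / 4 * (1/4) ^ j))"
      by (intro ennreal_leI mult_left_mono wsum) simp
    finally show ?thesis .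
  qed
  have term_in: "(\<Sum>i<N n j. ennreal (w n j i) * inverse (ennreal ((norm (cis (t n j i) - \<zeta>))\<^sup>2))) \<le> ennreal ((1/2) ^ n * (1/2) ^ j)"
    if \<zeta>: "\<zeta> \<in> F n" for n j \<zeta>
  proof -
    have "(1/2) ^ j / 2 \<le> norm (cis (t n j i) - \<zeta>)" if "shell n j i" for i
      using that infdist_le[OF \<zeta>, of "cis (t n j i)"] by (simp add: shell_def dist_norm)
    then have "(\<Sum>i<N n j. ennreal (w n j i) * inverse (ennreal ((norm (cis (t n j i) - \<zeta>))\<^sup>2)))
       \<le> ennreal (inverse (((1/2) ^ j / 2)\<^sup>2) * ((1/2) ^ n * (1/2) ^ j / 4 * (1/4) ^ j))"
      by (intro term_le) auto
    also have "inverse (((1/2::real) ^ j / 2)\<^sup>2) * ((1/2) ^ n * (1/2) ^ j / 4 * (1/4) ^ j) = (1/2) ^ n * (1/2) ^ j"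
    proof -
      have sq: "((1/2::real) ^ j / 2)\<^sup>2 = (1/4) ^ j / 4"
        by (simp add: power2_eq_square flip: power_mult_distrib)
      show ?thesis unfolding sq by simp
    qed
    finally show ?thesis .
  qed
  have fin: "inverse_square_potential M X \<zeta> < \<infinity>" if \<zeta>E: "\<zeta> \<in> E" and n1: "norm \<zeta> = 1" for \<zeta>
    unfolding pot
  proof -
    obtain m where m: "\<zeta> \<in> F m" using \<zeta>E by (auto simp: E_def)
    have mn: "\<zeta> \<in> F n" if "n \<ge> m" for n using m F(1) that by (auto simp: incseq_def)
    let ?T = "\<lambda>n j. (\<Sum>i<N n j. ennreal (w n j i) * inverse (ennreal ((norm (cis (t n j i) - \<zeta>))\<^sup>2)))"
    have Tfin: "?T n j < \<infinity>" for n j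
    proof -
      have "ennreal (w n j i) * inverse (ennreal ((norm (cis (t n j i) - \<zeta>))\<^sup>2)) < \<infinity>" if "i < N n j" for i
      proof -
        have "cis (t n j i) \<noteq> \<zeta>" using tE[OF that] \<zeta>E by auto
        then have "inverse (ennreal ((norm (cis (t n j i) - \<zeta>))\<^sup>2)) = ennreal (inverse ((norm (cis (t n j i) - \<zeta>))\<^sup>2))"
          by (intro inverse_ennreal) simp
        then show ?thesis by (simp add: ennreal_mult_less_top)
      qed
      then show ?thesis by simp
    qed
    have inner: "(\<Sum>j. ?T n j) < \<infinity>" for n
    proof (cases "\<zeta> \<in> F n")
      case True
      then show ?thesis
        by (intro suminf_ennreal_finite[where c = "(1/2) ^ n" and J = 0] Tfin term_in) auto
    next
      \<comment> \<open>This happens for finitely many \<open>n < m\<close> only. Shells with 4 *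
        (1/2)^j <= \<delta> / 2 keep a distance of at least \<delta> / 2 from
        \<open>\<zeta>\<close>; the finitely many other scales are finite by
        \<open>Tfin\<close>.\<close>
      case False
      define \<delta> where "\<delta> = infdist \<zeta> (F n)"
      have \<delta>: "\<delta> > 0" using False F(2,3)[of n] infdist_pos_not_in_closed unfolding \<delta>_def by blast
      obtain J :: nat where J: "(1/2) ^ J < \<delta> / 8" using real_arch_pow_inv[of "\<delta> / 8" "1/2"] \<delta> by auto
      have "?T n j \<le> ennreal (inverse ((\<delta> / 2)\<^sup>2) * (1/2) ^ j)" if j: "j \<ge> J" for j
      proof -
        have "(1/2 :: real) ^ j \<le> (1/2) ^ J" using j by (intro power_decreasing) auto
        with J have small: "4 * (1/2) ^ j \<le> \<delta> / 2" by linarith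
        have "\<delta> / 2 \<le> norm (cis (t n j i) - \<zeta>)" if "shell n j i" for i
        proof -
          have "\<delta> \<le> infdist (cis (t n j i)) (F n) + dist \<zeta> (cis (t n j i))"
            unfolding \<delta>_def by (rule infdist_triangle)
          then show ?thesis using that small by (simp add: shell_def dist_norm norm_minus_commute)
        qed
        then have "?T n j \<le> ennreal (inverse ((\<delta> / 2)\<^sup>2) * ((1/2) ^ n * (1/2) ^ j / 4 * (1/4) ^ j))"
          using \<delta> by (intro term_le) auto
        also have "\<dots> \<le> ennreal (inverse ((\<delta> / 2)\<^sup>2) * (1/2) ^ j)"
        proof (intro ennreal_leI mult_left_mono)
          have "(1/2::real) ^ n * (1/4 * (1/4) ^ j) \<le> 1 * (1 * 1)"
            by (intro mult_mono power_le_one) auto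
          then have "(1/2::real) ^ n * (1/4 * (1/4) ^ j) * (1/2) ^ j \<le> 1 * (1/2) ^ j" by (intro mult_right_mono) auto
          then show "(1/2::real) ^ n * (1/2) ^ j / 4 * (1/4) ^ j \<le> (1/2) ^ j" by (simp add: mult_ac)
        qed simp
        finally show ?thesis .
      qed
      then show ?thesis
        by (intro suminf_ennreal_finite[where c = "inverse ((\<delta> / 2)\<^sup>2)" and J = J] Tfin) auto
    qed
    have outer: "(\<Sum>j. ?T n j) \<le> ennreal (2 * (1/2) ^ n)" if "n \<ge> m" for n
    proof -
      have "(\<Sum>j. ?T n j) \<le> (\<Sum>j. ennreal ((1/2) ^ n * (1/2) ^ j))"
        by (intro suminf_le term_in mn that) auto
      also have "\<dots> = ennreal (\<Sum>j. (1/2) ^ n * (1/2) ^ j)"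
        by (rule suminf_ennreal2) (auto intro!: summable_mult summable_geometric)
      also have "(\<Sum>j. (1/2::real) ^ n * (1/2) ^ j) = (1/2) ^ n * (\<Sum>j. (1/2) ^ j)"
        by (rule suminf_mult) (auto intro!: summable_geometric)
      also have "(\<Sum>j. (1 / 2 :: real) ^ j) = 2" by (subst suminf_geometric) auto
      finally show ?thesis by (simp add: mult.commute)
    qed
    show "(\<Sum>n. \<Sum>j. ?T n j) < \<infinity>"
      by (rule suminf_ennreal_finite[where c = 2 and J = m, OF inner _ outer]) auto
  qed
  have inf: "inverse_square_potential M X \<zeta> = \<infinity>" if \<zeta>E: "\<zeta> \<notin> E" and n1: "norm \<zeta> = 1" for \<zeta>
  proof -
    let ?T = "\<lambda>n j. (\<Sum>i<N n j. ennreal (w n j i) * inverse (ennreal ((norm (cis (t n j i) - \<zeta>))\<^sup>2)))"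
    have ge1: "1 \<le> (\<Sum>j. ?T n j)" for n
    proof -
      define d where "d = infdist \<zeta> (F n)"
      have "\<zeta> \<notin> F n" using \<zeta>E by (auto simp: E_def)
      then have d: "d > 0" using F(2,3)[of n] infdist_pos_not_in_closed unfolding d_def by blast
      obtain e where e: "e \<in> F n" using F(3) by blast
      then have "norm e = 1" using F(4)[of n] by auto
      then have "dist \<zeta> e \<le> 2" using n1 norm_triangle_ineq4[of \<zeta> e] by (simp add: dist_norm)
      then have d2: "d \<le> 2" using infdist_le[OF e, of \<zeta>] by (simp add: d_def)
      have ex: "\<exists>j. (1/2) ^ j \<le> d" using real_arch_pow_inv[OF d, of "1/2"] by (auto intro: less_imp_le)
      \<comment> \<open>Minimality also gives d <= 2 * (1/2)^j; at scale 0 this is the diameter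
        bound \<open>d2\<close>.\<close>
      define j where "j = (LEAST j. (1/2) ^ j \<le> d)"
      have j1: "(1/2) ^ j \<le> d" unfolding j_def by (rule LeastI_ex[OF ex])
      have j2: "d \<le> 2 * (1/2) ^ j"
      proof (cases j)
        case 0
        then show ?thesis using d2 by simp
      next
        case (Suc k)
        then have "\<not> (1/2) ^ k \<le> d" using not_less_Least[of k "\<lambda>j. (1/2) ^ j \<le> d"] unfolding j_def[symmetric] by simp
        then show ?thesis using Suc by simp
      qed
      obtain i where i: "i < N n j" "norm (cis (t n j i) - \<zeta>) \<le> 2 * pi / real (N n j)"
        by (rule unit_circle_near_point[OF n1 N0[of n j] t[of _ n j]]) (assumption, rule that)
      have mesh: "2 * pi / real (N n j) \<le> (1/2) ^ j / 2"
      proof -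
        have "2 * pi \<le> 8" using pi_less_4 by simp
        also have "8 \<le> (1/2) ^ j / 2 * real (N n j)"
        proof -
          have "(2::real) ^ (n + 3 * j) = 2 ^ n * (2 ^ j * 4 ^ j)"
            by (simp add: power_add power_mult flip: power_mult_distrib)
          then have "(1/2) ^ j / 2 * real (N n j) = 80 * (2 ^ n * 4 ^ j)"
            by (simp add: N_def power_divide)
          moreover have "(1::real) * 1 \<le> 2 ^ n * 4 ^ j" by (intro mult_mono) auto
          ultimately show ?thesis by linarith
        qed
        finally show ?thesis using N0[of n j] by (simp add: pos_divide_le_eq)
      qed
      have "infdist (cis (t n j i)) (F n) \<le> d + dist (cis (t n j i)) \<zeta>" unfolding d_def by (rule infdist_triangle)
      moreover have "d \<le> infdist (cis (t n j i)) (F n) + dist \<zeta> (cis (t n j i))" unfolding d_def by (rule infdist_triangle)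
      moreover have "dist (cis (t n j i)) \<zeta> \<le> (1/2) ^ j / 2" using i mesh by (simp add: dist_norm)
      moreover have "dist \<zeta> (cis (t n j i)) \<le> (1/2) ^ j / 2" using i mesh by (simp add: dist_norm norm_minus_commute)
      moreover have "(0::real) < (1/2) ^ j" by simp
      ultimately have "shell n j i" using i j1 j2 by (simp add: shell_def)
      then have wi: "w n j i = (2 * pi / real (N n j))\<^sup>2" by (simp add: w_def)
      have "1 \<le> ennreal (w n j i) * inverse (ennreal ((norm (cis (t n j i) - \<zeta>))\<^sup>2))"
      proof (cases "cis (t n j i) = \<zeta>")
        case True
        have "w n j i > 0" unfolding wi using N0[of n j] by simp
        then show ?thesis using True by (simp add: ennreal_mult_top ennreal_eq_0_iff)
      next
        case False
        then have p: "(norm (cis (t n j i) - \<zeta>))\<^sup>2 > 0" by simp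
        have "(norm (cis (t n j i) - \<zeta>))\<^sup>2 \<le> w n j i" unfolding wi using i by (intro power_mono) auto
        then have "1 \<le> w n j i * inverse ((norm (cis (t n j i) - \<zeta>))\<^sup>2)" using p by (simp add: field_simps)
        then have "1 \<le> ennreal (w n j i * inverse ((norm (cis (t n j i) - \<zeta>))\<^sup>2))" by (simp add: ennreal_ge_1)
        also have "\<dots> = ennreal (w n j i) * inverse (ennreal ((norm (cis (t n j i) - \<zeta>))\<^sup>2))"
          using p by (subst inverse_ennreal) (auto intro!: ennreal_mult' w0)
        finally show ?thesis .
      qed
      also have "\<dots> \<le> ?T n j" using i by (intro member_le_sum) auto
      also have "\<dots> = (\<Sum>k\<in>{j}. ?T n k)" by simp
      also have "\<dots> \<le> (\<Sum>k. ?T n k)" by (rule sum_le_suminf) auto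
      finally show ?thesis .
    qed
    have big: "of_nat k \<le> (\<Sum>n. \<Sum>j. ?T n j)" for k
    proof -
      have "of_nat k = (\<Sum>n<k. (1::ennreal))" by simp
      also have "\<dots> \<le> (\<Sum>n<k. \<Sum>j. ?T n j)" by (intro sum_mono ge1)
      also have "\<dots> \<le> (\<Sum>n. \<Sum>j. ?T n j)" by (rule sum_le_suminf) auto
      finally show ?thesis .
    qed
    have "(\<Sum>n. \<Sum>j. ?T n j) = top"
    proof (rule ccontr)
      assume "(\<Sum>n. \<Sum>j. ?T n j) \<noteq> top"
      then have "(\<Sum>n. \<Sum>j. ?T n j) < top" by (simp only: top.not_eq_extremum)
      then obtain k where "(\<Sum>n. \<Sum>j. ?T n j) < of_nat k" using ennreal_Ex_less_of_nat by blast
      with big[of k] show False by (rule leD[THEN notE])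
    qed
    then show ?thesis unfolding pot by simp
  qed
  show thesis
  proof (rule that[of M X])
    show "finite_measure M"
    proof (rule finite_measureI)
      have "emeasure M (space M) = (\<integral>\<^sup>+x. 1 \<partial>M)" by simp
      also have "\<dots> = (\<Sum>n. \<Sum>j. \<Sum>i<N n j. ennreal (w n j i))" unfolding int by simp
      also have "\<dots> \<le> (\<Sum>n. \<Sum>j. ennreal ((1/2) ^ n * (1/2) ^ j))"
      proof (intro suminf_le)
        fix n j
        have "(\<Sum>i<N n j. ennreal (w n j i)) = ennreal (\<Sum>i<N n j. w n j i)" using w0 by (intro sum_ennreal) auto
        also have "\<dots> \<le> ennreal ((1/2) ^ n * (1/2) ^ j)"
        proof (rule ennreal_leI)
          have "(\<Sum>i<N n j. w n j i) \<le> (1/2) ^ n * (1/2) ^ j / 4 * (1/4) ^ j" by (rule wsum)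
          also have "\<dots> = (1/2) ^ n * (1/2) ^ j * (1/4 * (1/4) ^ j)" by simp
          also have "\<dots> \<le> (1/2) ^ n * (1/2) ^ j * (1 * 1)"
            by (intro mult_left_mono mult_mono power_le_one) auto
          finally show "(\<Sum>i<N n j. w n j i) \<le> (1/2) ^ n * (1/2) ^ j" by simp
        qed
        finally show "(\<Sum>i<N n j. ennreal (w n j i)) \<le> ennreal ((1/2) ^ n * (1/2) ^ j)" .
      qed auto
      also have "\<dots> < \<infinity>"
      proof (rule suminf_ennreal_finite[where c = 2 and J = 0])
        have eq: "(\<Sum>j. ennreal ((1/2) ^ n * (1/2) ^ j)) = ennreal (2 * (1/2) ^ n)" for n
        proof -
          have "(\<Sum>j. ennreal ((1/2) ^ n * (1/2) ^ j)) = ennreal (\<Sum>j. (1/2) ^ n * (1/2) ^ j)"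
            by (rule suminf_ennreal2) (auto intro!: summable_mult summable_geometric)
          also have "(\<Sum>j. (1/2::real) ^ n * (1/2) ^ j) = (1/2) ^ n * (\<Sum>j. (1/2) ^ j)"
            by (rule suminf_mult) (auto intro!: summable_geometric)
          also have "(\<Sum>j. (1 / 2 :: real) ^ j) = 2" by (subst suminf_geometric) auto
          finally show ?thesis by (simp add: mult.commute)
        qed
        show "(\<Sum>j. ennreal ((1/2) ^ n * (1/2) ^ j)) < \<infinity>" for n unfolding eq by simp
        show "(\<Sum>j. ennreal ((1/2) ^ n * (1/2) ^ j)) \<le> ennreal (2 * (1/2) ^ n)" for n unfolding eq by simp
      qed auto
      finally show "emeasure M (space M) \<noteq> \<infinity>" by simp
    qed
    show "inverse_square_potential M X \<zeta> < \<infinity> \<longleftrightarrow> \<zeta> \<in> (\<Union>n. F n)" if "norm \<zeta> = 1" for \<zeta>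
      using fin[OF _ that] inf[OF _ that] unfolding E_def[symmetric] by (cases "\<zeta> \<in> E") auto
  qed (use Xm X1 in auto)
qed


lemma AE_not_in_of_log_dist:
  assumes "(\<integral>\<^sup>+t. log_dist F (cis t) \<partial>circ) < \<infinity>"
  shows "AE t in circ. cis t \<notin> F"
proof -
  have "AE t in circ. log_dist F (cis t) \<noteq> \<infinity>"
    by (rule nn_integral_PInf_AE) (use assms in auto)
  then show ?thesis
  proof eventually_elim
    case (elim t)
    then show ?case by (auto simp: log_dist_def nlog_def)
  qed
qed

text \<open>Each summand of \<open>S\<close> alone bounds the density by \<open>A n\<close> times
  the squared distance to \<open>F n\<close>, hence to any of its points, so the integrand of the
  potential stays below \<open>A n\<close>. The budgets (1/2)^n for the integrals of the summands
  make \<open>S\<close> integrable.\<close>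

lemma absolutely_continuous_potential:
  fixes F :: "nat \<Rightarrow> complex set"
  assumes F: "\<And>n. F n \<noteq> {}" "\<And>n. (\<integral>\<^sup>+t. log_dist (F n) (cis t) \<partial>circ) < \<infinity>"
  obtains S :: "complex \<Rightarrow> ennreal" where "S \<in> borel_measurable borel" "(\<integral>\<^sup>+t. S (cis t) \<partial>circ) < \<infinity>"
    "\<And>n \<zeta>. \<zeta> \<in> F n \<Longrightarrow>
      inverse_square_potential (density circ (\<lambda>t. ennreal (exp_neg (S (cis t))))) cis \<zeta> < \<infinity>"
proof -
  have "\<exists>A\<ge>1. (\<integral>\<^sup>+t. nlog (ennreal (A * (infdist (cis t) (F n))\<^sup>2)) \<partial>circ) \<le> ennreal ((1/2) ^ n)" for n
    by (rule truncated_log_small[OF F(2)[of n], of "(1/2) ^ n"]) auto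
  then have "\<forall>n. \<exists>A. A \<ge> 1 \<and> (\<integral>\<^sup>+t. nlog (ennreal (A * (infdist (cis t) (F n))\<^sup>2)) \<partial>circ) \<le> ennreal ((1/2) ^ n)"
    by blast
  from choice[OF this] obtain A :: "nat \<Rightarrow> real" where A: "\<And>n. A n \<ge> 1"
    and Ale: "\<And>n. (\<integral>\<^sup>+t. nlog (ennreal (A n * (infdist (cis t) (F n))\<^sup>2)) \<partial>circ) \<le> ennreal ((1/2) ^ n)"
    by blast
  define L where "L n \<xi> = nlog (ennreal (A n * (infdist \<xi> (F n))\<^sup>2))" for n \<xi>
  have Lm [measurable]: "L n \<in> borel_measurable borel" for n
  proof -
    have "(\<lambda>\<xi>. A n * (infdist \<xi> (F n))\<^sup>2) \<in> borel_measurable borel"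
      by (intro borel_measurable_continuous_onI continuous_intros)
    then show ?thesis unfolding L_def by measurable
  qed
  define S where "S \<xi> = (\<Sum>n. L n \<xi>)" for \<xi>
  have Sm [measurable]: "S \<in> borel_measurable borel" unfolding S_def by measurable
  show thesis
  proof (rule that[OF Sm])
    have "(\<integral>\<^sup>+t. S (cis t) \<partial>circ) = (\<Sum>n. \<integral>\<^sup>+t. L n (cis t) \<partial>circ)"
      unfolding S_def by (rule nn_integral_suminf) simp
    also have "\<dots> < \<infinity>"
    proof (rule suminf_ennreal_finite[where c = 1 and J = 0])
      show "(\<integral>\<^sup>+t. L n (cis t) \<partial>circ) < \<infinity>" for n
        using Ale[of n] unfolding L_def by (rule le_less_trans) simp
      show "(\<integral>\<^sup>+t. L n (cis t) \<partial>circ) \<le> ennreal (1 * (1/2) ^ n)" for n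
        using Ale[of n] unfolding L_def by simp
    qed simp
    finally show "(\<integral>\<^sup>+t. S (cis t) \<partial>circ) < \<infinity>" .
    fix n \<zeta> assume \<zeta>: "\<zeta> \<in> F n"
    have bound: "exp_neg (S \<xi>) \<le> A n * (norm (\<xi> - \<zeta>))\<^sup>2" for \<xi>
    proof -
      have "L n \<xi> = (\<Sum>k\<in>{n}. L k \<xi>)" by simp
      also have "\<dots> \<le> S \<xi>" unfolding S_def by (rule sum_le_suminf) auto
      finally have "exp_neg (S \<xi>) \<le> A n * (infdist \<xi> (F n))\<^sup>2"
        unfolding L_def by (rule exp_neg_le) (use A[of n] in simp)
      also have "\<dots> \<le> A n * (norm (\<xi> - \<zeta>))\<^sup>2"
        using infdist_le[OF \<zeta>, of \<xi>] A[of n] infdist_nonneg[of \<xi> "F n"]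
        by (intro mult_left_mono power_mono) (auto simp: dist_norm)
      finally show ?thesis .
    qed
    have "inverse_square_potential (density circ (\<lambda>t. ennreal (exp_neg (S (cis t))))) cis \<zeta>
       = (\<integral>\<^sup>+t. ennreal (exp_neg (S (cis t))) * inverse (ennreal ((norm (cis t - \<zeta>))\<^sup>2)) \<partial>circ)"
      unfolding inverse_square_potential_def by (rule nn_integral_density) measurable
    also have "\<dots> \<le> (\<integral>\<^sup>+t. ennreal (A n) \<partial>circ)"
    proof (rule nn_integral_mono)
      fix t
      show "ennreal (exp_neg (S (cis t))) * inverse (ennreal ((norm (cis t - \<zeta>))\<^sup>2)) \<le> ennreal (A n)"
      proof (cases "cis t = \<zeta>")
        \<comment> \<open>The density vanishes at this point, and \<open>0 * \<infinity> = 0\<close>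
          in \<open>ennreal\<close>.\<close>
        case True
        then have "exp_neg (S (cis t)) = 0" using bound[of "cis t"] exp_neg_bounds(1)[of "S (cis t)"] by simp
        then show ?thesis by simp
      next
        case False
        then have p: "(norm (cis t - \<zeta>))\<^sup>2 > 0" by simp
        have "ennreal (exp_neg (S (cis t))) * inverse (ennreal ((norm (cis t - \<zeta>))\<^sup>2))
           = ennreal (exp_neg (S (cis t)) * inverse ((norm (cis t - \<zeta>))\<^sup>2))"
          using p by (subst inverse_ennreal) (auto simp: ennreal_mult' exp_neg_bounds)
        also have "\<dots> \<le> ennreal (A n)"
          using bound[of "cis t"] p by (intro ennreal_leI) (simp add: field_simps)
        finally show ?thesis .
      qed
    qed
    also have "\<dots> < \<infinity>" by (simp add: circ.emeasure_space_1)
    finally show "inverse_square_potential (density circ (\<lambda>t. ennreal (exp_neg (S (cis t))))) cis \<zeta> < \<infinity>" .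
  qed
qed

text \<open>Both parts of \<open>g\<close> have nonnegative real part, so the radial bound holds for
  \<open>g\<close> exactly when it holds for \<open>g1\<close> and \<open>g2\<close>. The absolutely
  continuous part makes \<open>Re g\<close> positive and the logarithmic integral finite; the atomic
  part excludes the points off \<open>E\<close>. For \<open>E = {}\<close> there is no exhaustion by
  nonempty sets, and the constant 0 serves.\<close>

lemma exists_self_map_with_caratheodory_set:
  assumes "countable_union_BC E"
  shows "\<exists>f. holo_self_map f \<and> log_integral f unit_circle > -\<infinity> \<and> caratheodory_set f = E"
proof (cases "E = {}")
  case True
  have self: "holo_self_map (\<lambda>_. 0)" by (auto simp: holo_self_map_def)
  have "defect (\<lambda>_. 0) (cis t) = 1" for t by (simp add: defect_def Liminf_const)
  then have "(\<integral>\<^sup>+t. nlog (defect (\<lambda>_. 0) (cis t)) \<partial>circ) = 0" by (simp add: nlog_def)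
  then have "log_integral (\<lambda>_. 0) unit_circle > -\<infinity>"
    using log_integral_eq[OF self, of UNIV] by (simp add: zero_ennreal.rep_eq)
  moreover have "caratheodory_set (\<lambda>_. 0) = {}"
  proof -
    have "\<not> (\<forall>r. 0 \<le> r \<longrightarrow> r < 1 \<longrightarrow> 1 \<le> M * (1 - r))" for M :: real
    proof
      assume M: "\<forall>r. 0 \<le> r \<longrightarrow> r < 1 \<longrightarrow> 1 \<le> M * (1 - r)"
      then have "M \<ge> 1" by (metis diff_zero mult.right_neutral order_refl zero_less_one)
      then have "0 \<le> 1 - 1 / (2 * M)" "1 - 1 / (2 * M) < 1" by (auto simp: field_simps)
      then have "1 \<le> M * (1 - (1 - 1 / (2 * M)))" using M by blast
      then show False using \<open>M \<ge> 1\<close> by simp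
    qed
    then show ?thesis unfolding julia_caratheodory[OF self] by simp
  qed
  ultimately show ?thesis using self True by blast
next
  case False
  obtain F where F: "incseq F" "E = (\<Union>n. F n)" "\<And>n. closed (F n)" "\<And>n. F n \<noteq> {}" "\<And>n. F n \<subseteq> unit_circle"
    "\<And>n. (\<integral>\<^sup>+t. log_dist (F n) (cis t) \<partial>circ) < \<infinity>"
    by (rule countable_union_BC_exhaustion[OF assms False]) (rule that)
  have null: "AE t in circ. cis t \<notin> (\<Union>n. F n)"
    using AE_not_in_of_log_dist[OF F(6)] by (simp add: AE_all_countable)
  obtain M2 :: "(nat \<times> nat \<times> nat) measure" and X2 where
    M2: "finite_measure M2" "X2 \<in> borel_measurable M2" "\<And>x. norm (X2 x) = 1"
    and pot2: "\<And>\<zeta>. norm \<zeta> = 1 \<Longrightarrow> inverse_square_potential M2 X2 \<zeta> < \<infinity> \<longleftrightarrow> \<zeta> \<in> (\<Union>n. F n)"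
    by (rule atomic_potential[OF F(1,3,4,5) null]) (rule that)
  obtain S where Sm [measurable]: "S \<in> borel_measurable borel" and Sfin: "(\<integral>\<^sup>+t. S (cis t) \<partial>circ) < \<infinity>"
    and pot1: "\<And>n \<zeta>. \<zeta> \<in> F n \<Longrightarrow>
      inverse_square_potential (density circ (\<lambda>t. ennreal (exp_neg (S (cis t))))) cis \<zeta> < \<infinity>"
    by (rule absolutely_continuous_potential[OF F(4,6)]) (rule that)
  define M1 where "M1 = density circ (\<lambda>t. ennreal (exp_neg (S (cis t))))"
  have int1: "(\<integral>\<^sup>+t. h t \<partial>M1) = (\<integral>\<^sup>+t. ennreal (exp_neg (S (cis t))) * h t \<partial>circ)"
    if "h \<in> borel_measurable borel" for h
    unfolding M1_def by (rule nn_integral_density) (use that in auto)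
  have M1: "finite_measure M1"
  proof (rule finite_measureI)
    have "emeasure M1 (space M1) = (\<integral>\<^sup>+t. 1 \<partial>M1)" by simp
    also have "\<dots> = (\<integral>\<^sup>+t. ennreal (exp_neg (S (cis t))) * 1 \<partial>circ)" by (rule int1) simp
    also have "\<dots> \<le> (\<integral>\<^sup>+t. 1 \<partial>circ)"
      by (intro nn_integral_mono) (simp add: exp_neg_bounds ennreal_le_1)
    also have "\<dots> < \<infinity>" by (simp add: circ.emeasure_space_1)
    finally show "emeasure M1 (space M1) \<noteq> \<infinity>" by simp
  qed
  have X1: "cis \<in> borel_measurable M1" "\<And>t. norm (cis t) = 1" by (simp_all add: M1_def)
  obtain g1 where g1: "g1 holomorphic_on unit_disc"
    "\<And>z. z \<in> unit_disc \<Longrightarrow> ennreal (Re (g1 z)) = (\<integral>\<^sup>+x. ennreal (poisson z (cis x)) \<partial>M1)"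
    "\<And>z. z \<in> unit_disc \<Longrightarrow> Re (g1 z) \<ge> 0"
    by (rule herglotz_integral[OF M1 X1]) (rule that)
  obtain g2 where g2: "g2 holomorphic_on unit_disc"
    "\<And>z. z \<in> unit_disc \<Longrightarrow> ennreal (Re (g2 z)) = (\<integral>\<^sup>+x. ennreal (poisson z (X2 x)) \<partial>M2)"
    "\<And>z. z \<in> unit_disc \<Longrightarrow> Re (g2 z) \<ge> 0"
    by (rule herglotz_integral[OF M2]) (rule that)
  define g where "g z = g1 z + g2 z" for z
  have Re1: "ennreal (Re (g1 z)) = (\<integral>\<^sup>+t. ennreal (exp_neg (S (cis t))) * ennreal (poisson z (cis t)) \<partial>circ)"
    if "z \<in> unit_disc" for z
    unfolding g1(2)[OF that] by (rule int1) simp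
  have pos: "Re (g z) > 0" if z: "z \<in> unit_disc" for z
  proof -
    have "0 < ennreal (Re (g1 z))"
      unfolding Re1[OF z] by (rule jensen_poisson(1)[OF Sm Sfin]) (use z in simp)
    then show ?thesis using g2(3)[OF z] by (simp add: g_def)
  qed
  have hol: "g holomorphic_on unit_disc" unfolding g_def by (intro holomorphic_intros g1 g2)
  have self: "holo_self_map (\<lambda>z. exp (- g z))" by (rule caratheodory_set_exp(1)[OF hol pos])
  have "log_integral (\<lambda>z. exp (- g z)) unit_circle > -\<infinity>"
  proof (rule log_integral_exp_finite[OF Sm Sfin self])
    fix z :: complex assume z: "z \<in> unit_disc"
    have "Re (g1 z) \<le> Re (g z)" using g2(3)[OF z] by (simp add: g_def)
    then show "(\<integral>\<^sup>+t. ennreal (exp_neg (S (cis t))) * ennreal (poisson z (cis t)) \<partial>circ) \<le> ennreal (Re (g z))"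
      unfolding Re1[OF z, symmetric] by (rule ennreal_leI)
  qed
  moreover have "caratheodory_set (\<lambda>z. exp (- g z)) = E"
  proof -
    have iff: "(\<exists>B. \<forall>r. 0 \<le> r \<longrightarrow> r < 1 \<longrightarrow> Re (g (of_real r * \<zeta>)) \<le> B * (1 - r)) \<longleftrightarrow> \<zeta> \<in> E" if \<zeta>: "norm \<zeta> = 1" for \<zeta>
    proof -
      have disc: "of_real r * \<zeta> \<in> unit_disc" if "0 \<le> r" "r < 1" for r using that \<zeta> by (simp add: norm_mult)
      have "(\<exists>B. \<forall>r. 0 \<le> r \<longrightarrow> r < 1 \<longrightarrow> Re (g (of_real r * \<zeta>)) \<le> B * (1 - r)) \<longleftrightarrow>
        (\<exists>B. \<forall>r. 0 \<le> r \<longrightarrow> r < 1 \<longrightarrow> Re (g1 (of_real r * \<zeta>)) \<le> B * (1 - r)) \<and>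
        (\<exists>B. \<forall>r. 0 \<le> r \<longrightarrow> r < 1 \<longrightarrow> Re (g2 (of_real r * \<zeta>)) \<le> B * (1 - r))" (is "?L \<longleftrightarrow> ?R1 \<and> ?R2")
      proof (intro iffI conjI)
        assume ?L
        then obtain B where B: "\<And>r. 0 \<le> r \<Longrightarrow> r < 1 \<Longrightarrow> Re (g (of_real r * \<zeta>)) \<le> B * (1 - r)" by blast
        have "Re (g1 (of_real r * \<zeta>)) \<le> B * (1 - r)" "Re (g2 (of_real r * \<zeta>)) \<le> B * (1 - r)" if "0 \<le> r" "r < 1" for r
          using B[OF that] g1(3)[OF disc[OF that]] g2(3)[OF disc[OF that]] by (simp_all add: g_def)
        then show ?R1 ?R2 by blast+
      next
        assume "?R1 \<and> ?R2"
        then obtain B1 B2 where B: "\<And>r. 0 \<le> r \<Longrightarrow> r < 1 \<Longrightarrow> Re (g1 (of_real r * \<zeta>)) \<le> B1 * (1 - r)"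
          "\<And>r. 0 \<le> r \<Longrightarrow> r < 1 \<Longrightarrow> Re (g2 (of_real r * \<zeta>)) \<le> B2 * (1 - r)" by blast
        have "Re (g (of_real r * \<zeta>)) \<le> (B1 + B2) * (1 - r)" if "0 \<le> r" "r < 1" for r
          using B(1)[OF that] B(2)[OF that] by (simp add: g_def distrib_right)
        then show ?L by blast
      qed
      also have "?R1 \<longleftrightarrow> inverse_square_potential M1 cis \<zeta> < \<infinity>"
        by (rule radial_bound_iff_potential_finite[OF X1 g1(2,3) \<zeta>])
      also have "?R2 \<longleftrightarrow> inverse_square_potential M2 X2 \<zeta> < \<infinity>"
        by (rule radial_bound_iff_potential_finite[OF M2(2,3) g2(2,3) \<zeta>])
      also have "inverse_square_potential M1 cis \<zeta> < \<infinity> \<and> inverse_square_potential M2 X2 \<zeta> < \<infinity> \<longleftrightarrow> \<zeta> \<in> E"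
        using pot1 pot2[OF \<zeta>] unfolding F(2) M1_def by blast
      finally show ?thesis .
    qed
    have sub: "E \<subseteq> unit_circle" using F(2,5) by blast
    have "caratheodory_set (\<lambda>z. exp (- g z))
        = {\<zeta> \<in> unit_circle. \<exists>B. \<forall>r. 0 \<le> r \<longrightarrow> r < 1 \<longrightarrow> Re (g (of_real r * \<zeta>)) \<le> B * (1 - r)}"
      by (rule caratheodory_set_exp(2)[OF hol pos])
    also have "\<dots> = {\<zeta> \<in> unit_circle. \<zeta> \<in> E}" by (intro Collect_cong conj_cong refl iff) simp
    also have "\<dots> = E" using sub by blast
    finally show ?thesis .
  qed
  ultimately show ?thesis using self by blast
qed

theorem theorem1:
  "(\<forall>f I. holo_self_map f \<longrightarrow> open_arc I \<longrightarrow> log_integral f I > -\<infinity> \<longrightarrow>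
       countable_union_BC (caratheodory_set f \<inter> I)) \<and>
   (\<forall>E. countable_union_BC E \<longrightarrow>
       (\<exists>f. holo_self_map f \<and> log_integral f unit_circle > -\<infinity> \<and> caratheodory_set f = E))"
  using caratheodory_set_countable_union_BC exists_self_map_with_caratheodory_set
  by (simp add: open_arc_def)

end
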